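(* Let $0<q\le 1$ and suppose that $\mathcal{A}$ is a proper $q$-Banach subalgebra of $\mathcal{B}(\ell^2(\mathbb{G}))$, that $A,B,Q,R\in\mathcal{A}$, and that $Q$ and $R$ are positive and strictly positive on $\ell^2(\mathbb{G})$, respectively. Let $X\in\mathcal{B}(\ell^2(\mathbb{G}))$ denote the unique positive definite solution of the Riccati equation $$A^*X+XA-XBR^{-1}B^*X+Q=0,$$ and let $A_X=A-BR^{-1}B^*X$. Assume that (i) $(A,B)$ is exponentially stabilizable and $(A,Q^{1/2})$ is exponentially detectable; and (ii) the dual Riccati equation $$AY+YA^*-YQY+BR^{-1}B^*=0$$ has a self-adjoint solution $Y\in\mathcal{B}(\ell^2(\mathbb{G}))$ such that $I+YX$ is invertible in $\mathcal{B}(\ell^2(\mathbb{G}))$. Then $X\in\mathcal{A}$ and $A_X$ is exponentially stable on $\mathcal{A}$.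
   Context: $\mathbb{G}\subset\mathbb{Z}^d$ ($d\ge 1$) is the discrete spatial domain, and $\mathcal{B}(\ell^2(\mathbb{G}))$ is the Banach algebra of bounded linear operators on $\ell^2(\mathbb{G})$, identified with (infinite) matrices indexed by $\mathbb{G}\times\mathbb{G}$. An operator $Q$ is positive if it is self-adjoint with $\langle Qx,x\rangle\ge 0$ for all $x$; it is strictly positive if it is self-adjoint and $\langle Qx,x\rangle\ge c\|x\|_2^2$ for some $c>0$ and all $x$. A matrix $A$ in $\mathcal{A}$ (or in $\mathcal{B}(\ell^2(\mathbb{G}))$) is exponentially stable on $\mathcal{A}$ (resp. on $\mathcal{B}(\ell^2(\mathbb{G}))$) if there are $E,\alpha>0$ with $\|e^{tA}\|\le Ee^{-\alpha t}$ for all $t\ge 0$ in the corresponding ($q$-)norm. $(A,B)$ is exponentially stabilizable if $A+BF$ is exponentially stable on $\mathcal{B}(\ell^2(\mathbb{G}))$ for some bounded $F$; $(A,C)$ is exponentially detectable if $A+LC$ is exponentially stable on $\mathcal{B}(\ell^2(\mathbb{G}))$ for some bounded $L$. The paper takes existence and uniqueness of the positive definite (strictly positive) solution $X$ from classical LQR theory. For $0<q\le 1$, a complex vector space $\mathcal{A}$ of matrices is a $q$-Banach space with $q$-norm $\|\cdot\|_{\mathcal{A}}$ if it is complete with respect to the metric $d(A,B)=\|A-B\|_{\mathcal{A}}^q$ and, for all $A,B\in\mathcal{A}$, $\alpha\in\mathbb{C}$: (i) $\|A\|_{\mathcal{A}}\ge 0$, with equality iff $A=0$; (ii) $\|\alpha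 A\|_{\mathcal{A}}=|\alpha|\,\|A\|_{\mathcal{A}}$; (iii) $\|A+B\|_{\mathcal{A}}^q\le\|A\|_{\mathcal{A}}^q+\|B\|_{\mathcal{A}}^q$. A $q$-Banach space $\mathcal{A}$ is a $q$-Banach algebra if it contains the unit element $I$, with $M:=\|I\|_{\mathcal{A}}<\infty$, and there is a constant $K_0>0$ with (iv) $AB\in\mathcal{A}$ and $\|AB\|_{\mathcal{A}}\le K_0\|A\|_{\mathcal{A}}\|B\|_{\mathcal{A}}$ for all $A,B\in\mathcal{A}$. A $q$-Banach algebra $\mathcal{A}$ of matrices on $\mathbb{G}$ is proper (a proper $q$-Banach subalgebra of $\mathcal{B}(\ell^2(\mathbb{G}))$) if: (P1) $A^*\in\mathcal{A}$ and $\|A^*\|_{\mathcal{A}}=\|A\|_{\mathcal{A}}$ for all $A\in\mathcal{A}$; (P2) $\mathcal{A}$ is a subalgebra of $\mathcal{B}(\ell^2(\mathbb{G}))$ and $\|A\|_{\mathcal{B}(\ell^2(\mathbb{G}))}\le\|A\|_{\mathcal{A}}$ for all $A\in\mathcal{A}$; (P3) $\mathcal{A}$ is a differential subalgebra of $\mathcal{B}=\mathcal{B}(\ell^2(\mathbb{G}))$ of some order $\theta\in(0,1]$: there is a constant $D>0$ such that for all $A,B\in\mathcal{A}$, $$\|AB\|_{\mathcal{A}}^q\le D\,\|A\|_{\mathcal{A}}^q\|B\|_{\mathcal{A}}^q\left(\Big(\tfrac{\|A\|_{\mathcal{B}}}{\|A\|_{\mathcal{A}}}\Big)^{q\theta}+\Big(\tfrac{\|B\|_{\mathcal{B}}}{\|B\|_{\mathcal{A}}}\Big)^{q\theta}\right)$$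 (right side read as $0$ if $A=0$ or $B=0$). *)

theory Defs
  imports "HOL-Analysis.Analysis"
begin

section \<open>The Hilbert space of square-summable families\<close>

typedef 'i ell2 = "{x :: 'i \<Rightarrow> complex. (\<lambda>i. (cmod (x i))\<^sup>2) summable_on UNIV}"
  morphisms coord Abs_ell2
  by (rule exI[of _ "\<lambda>_. 0"]) simp

setup_lifting type_definition_ell2

lemma square_summable_add:
  assumes "(\<lambda>i. (cmod (x i))\<^sup>2) summable_on UNIV" "(\<lambda>i. (cmod (y i))\<^sup>2) summable_on UNIV"
  shows "(\<lambda>i. (cmod (x i + y i))\<^sup>2) summable_on UNIV"
proof (rule summable_on_comparison_test)
  show "(\<lambda>i. 2 * (cmod (x i))\<^sup>2 + 2 * (cmod (y i))\<^sup>2) summable_on UNIV"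
    by (intro summable_on_add summable_on_cmult_right assms)
  show "(cmod (x i + y i))\<^sup>2 \<le> 2 * (cmod (x i))\<^sup>2 + 2 * (cmod (y i))\<^sup>2" for i
  proof -
    have "(cmod (x i + y i))\<^sup>2 \<le> (cmod (x i) + cmod (y i))\<^sup>2"
      by (intro power_mono norm_triangle_ineq) auto
    also have "\<dots> \<le> 2 * (cmod (x i))\<^sup>2 + 2 * (cmod (y i))\<^sup>2"
      using zero_le_power2[of "cmod (x i) - cmod (y i)"]
      by (simp add: power2_sum power2_diff)
    finally show ?thesis .
  qed
qed simp_all

lemma square_summable_scale:
  assumes "(\<lambda>i. (cmod (x i))\<^sup>2) summable_on UNIV"
  shows "(\<lambda>i. (cmod (c * x i))\<^sup>2) summable_on UNIV"
  using summable_on_cmult_right[OF assms, of "(cmod c)\<^sup>2"]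
  by (simp add: norm_mult power_mult_distrib)

lemma square_summable_mult:
  assumes "(\<lambda>i. (cmod (x i))\<^sup>2) summable_on UNIV" "(\<lambda>i. (cmod (y i))\<^sup>2) summable_on UNIV"
  shows "(\<lambda>i. x i * cnj (y i)) summable_on UNIV"
proof (rule abs_summable_summable, rule summable_on_comparison_test)
  show "(\<lambda>i. (cmod (x i))\<^sup>2 + (cmod (y i))\<^sup>2) summable_on UNIV"
    by (intro summable_on_add assms)
  show "cmod (x i * cnj (y i)) \<le> (cmod (x i))\<^sup>2 + (cmod (y i))\<^sup>2" for i
  proof -
    have "0 \<le> cmod (x i) * cmod (y i)"
      by simp
    moreover have "2 * (cmod (x i) * cmod (y i)) \<le> (cmod (x i))\<^sup>2 + (cmod (y i))\<^sup>2"
      using zero_le_power2[of "cmod (x i) - cmod (y i)"] by (simp add: power2_diff)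
    ultimately have "cmod (x i) * cmod (y i) \<le> (cmod (x i))\<^sup>2 + (cmod (y i))\<^sup>2"
      by linarith
    then show ?thesis
      by (simp add: norm_mult)
  qed
qed simp_all

lift_definition scaleC_ell2 :: "complex \<Rightarrow> 'i ell2 \<Rightarrow> 'i ell2"  (infixr \<open>*\<^sub>C\<close> 75)
  is "\<lambda>c x i. c * x i"
  by (rule square_summable_scale)

text \<open>The inner product is linear in the first argument.\<close>

definition cinner :: "'i ell2 \<Rightarrow> 'i ell2 \<Rightarrow> complex" where
  "cinner x y = (\<Sum>\<^sub>\<infinity>i. coord x i * cnj (coord y i))"

lemma coord_square_summable: "(\<lambda>i. (cmod (coord x i))\<^sup>2) summable_on UNIV"
  using coord[of x] by simp

lemma coord_mult_summable: "(\<lambda>i. coord x i * cnj (coord y i)) summable_on UNIV"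
  by (intro square_summable_mult coord_square_summable)

text \<open>
  The instance below makes available the bounded operator type
  \<open>'i ell2 \<Rightarrow>\<^sub>L 'i ell2\<close>. The library class \<open>real_inner\<close> forgets the complex structure, so
  complex linearity of operators is imposed separately.
\<close>

instantiation ell2 :: (type) real_inner
begin

lift_definition zero_ell2 :: "'a ell2" is "\<lambda>_. 0" by simp
lift_definition plus_ell2 :: "'a ell2 \<Rightarrow> 'a ell2 \<Rightarrow> 'a ell2" is "\<lambda>x y i. x i + y i"
  by (rule square_summable_add)
lift_definition uminus_ell2 :: "'a ell2 \<Rightarrow> 'a ell2" is "\<lambda>x i. - x i" by simp
definition minus_ell2 :: "'a ell2 \<Rightarrow> 'a ell2 \<Rightarrow> 'a ell2" where "minus_ell2 x y = x + (- y)"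
definition scaleR_ell2 :: "real \<Rightarrow> 'a ell2 \<Rightarrow> 'a ell2" where
  "scaleR_ell2 r x = complex_of_real r *\<^sub>C x"
definition inner_ell2 :: "'a ell2 \<Rightarrow> 'a ell2 \<Rightarrow> real" where "inner_ell2 x y = Re (cinner x y)"
definition norm_ell2 :: "'a ell2 \<Rightarrow> real" where
  "norm_ell2 x = sqrt (\<Sum>\<^sub>\<infinity>i. (cmod (coord x i))\<^sup>2)"
definition sgn_ell2 :: "'a ell2 \<Rightarrow> 'a ell2" where "sgn_ell2 x = inverse (norm x) *\<^sub>R x"
definition dist_ell2 :: "'a ell2 \<Rightarrow> 'a ell2 \<Rightarrow> real" where "dist_ell2 x y = norm (x - y)"
definition uniformity_ell2 :: "('a ell2 \<times> 'a ell2) filter" where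
  "uniformity_ell2 = (INF e\<in>{0<..}. principal {(x, y). dist x y < e})"
definition open_ell2 :: "'a ell2 set \<Rightarrow> bool" where
  "open_ell2 U = (\<forall>x\<in>U. \<forall>\<^sub>F (x', y) in uniformity. x' = x \<longrightarrow> y \<in> U)"

instance
proof
  fix x y z :: "'a ell2" and r s :: real
  have inner_self: "x \<bullet> x = (\<Sum>\<^sub>\<infinity>i. (cmod (coord x i))\<^sup>2)" for x :: "'a ell2"
    using infsum_Re[OF coord_mult_summable[of x x]]
    by (simp add: inner_ell2_def cinner_def flip: complex_norm_square)
  show "x + y + z = x + (y + z)" by transfer (simp add: add.assoc)
  show "x + y = y + x" by transfer (simp add: add.commute)
  show "0 + x = x" by transfer simp
  show "- x + x = 0" by transfer simp
  show "x - y = x + - y" by (simp add: minus_ell2_def)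
  show "r *\<^sub>R (x + y) = r *\<^sub>R x + r *\<^sub>R y"
    unfolding scaleR_ell2_def by transfer (simp add: distrib_left)
  show "(r + s) *\<^sub>R x = r *\<^sub>R x + s *\<^sub>R x"
    unfolding scaleR_ell2_def by transfer (simp add: distrib_right)
  show "r *\<^sub>R s *\<^sub>R x = (r * s) *\<^sub>R x"
    unfolding scaleR_ell2_def by transfer (simp add: mult.assoc)
  show "1 *\<^sub>R x = x" unfolding scaleR_ell2_def by transfer simp
  show "dist x y = norm (x - y)" by (simp add: dist_ell2_def)
  show "sgn x = inverse (norm x) *\<^sub>R x" by (simp add: sgn_ell2_def)
  show "(uniformity :: ('a ell2 \<times> 'a ell2) filter) =
      (INF e\<in>{0<..}. principal {(x, y). dist x y < e})"
    by (simp add: uniformity_ell2_def)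
  show "open U = (\<forall>x\<in>U. \<forall>\<^sub>F (x', y) in uniformity. x' = x \<longrightarrow> y \<in> U)" for U :: "'a ell2 set"
    by (simp add: open_ell2_def)
  have "cinner y x = cnj (cinner x y)"
    by (simp add: cinner_def mult.commute flip: infsum_cnj)
  then show "x \<bullet> y = y \<bullet> x" by (simp add: inner_ell2_def)
  have "cinner (x + y) z = cinner x z + cinner y z"
    by (simp add: cinner_def plus_ell2.rep_eq distrib_right infsum_add coord_mult_summable)
  then show "(x + y) \<bullet> z = x \<bullet> z + y \<bullet> z" by (simp add: inner_ell2_def)
  have "cinner (r *\<^sub>R x) y = complex_of_real r * cinner x y"
    by (simp add: cinner_def scaleR_ell2_def scaleC_ell2.rep_eq mult.assoc
        infsum_cmult_right coord_mult_summable)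
  then show "(r *\<^sub>R x) \<bullet> y = r * (x \<bullet> y)" by (simp add: inner_ell2_def)
  show "0 \<le> x \<bullet> x" by (simp add: inner_self infsum_nonneg)
  show "(x \<bullet> x = 0) = (x = 0)"
  proof
    assume "x \<bullet> x = 0"
    then have "(cmod (coord x i))\<^sup>2 = 0" for i
      using nonneg_infsum_le_0D[OF _ coord_square_summable[of x]] by (simp add: inner_self)
    then show "x = 0" by (intro coord_inject[THEN iffD1]) (auto simp: zero_ell2.rep_eq)
  next
    assume "x = 0"
    then show "x \<bullet> x = 0" by (simp add: inner_self zero_ell2.rep_eq)
  qed
  show "norm x = sqrt (x \<bullet> x)" by (simp add: norm_ell2_def inner_self)
qed

end

section \<open>Bounded operators\<close>

lift_definition restrict_ell2 :: "'i set \<Rightarrow> 'i ell2 \<Rightarrow> 'i ell2"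
  is "\<lambda>G x i. if i \<in> G then x i else 0"
  by (erule summable_on_comparison_test) auto

lift_definition proj_op :: "'i set \<Rightarrow> 'i ell2 \<Rightarrow>\<^sub>L 'i ell2" is restrict_ell2
proof (rule bounded_linear_intro)
  fix G :: "'i set" and x y :: "'i ell2" and r :: real
  show "restrict_ell2 G (x + y) = restrict_ell2 G x + restrict_ell2 G y"
    by transfer auto
  show "restrict_ell2 G (r *\<^sub>R x) = r *\<^sub>R restrict_ell2 G x"
    unfolding scaleR_ell2_def by transfer auto
  have "(\<Sum>\<^sub>\<infinity>i. (cmod (coord (restrict_ell2 G x) i))\<^sup>2) \<le> (\<Sum>\<^sub>\<infinity>i. (cmod (coord x i))\<^sup>2)"
    by (intro infsum_mono coord_square_summable) (simp add: restrict_ell2.rep_eq)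
  then show "norm (restrict_ell2 G x) \<le> norm x * 1"
    by (simp add: norm_ell2_def)
qed

lift_definition scale_op :: "complex \<Rightarrow> 'i ell2 \<Rightarrow>\<^sub>L 'i ell2" is scaleC_ell2
proof (rule bounded_linear_intro)
  fix c :: complex and x y :: "'i ell2" and r :: real
  show "c *\<^sub>C (x + y) = c *\<^sub>C x + c *\<^sub>C y"
    by transfer (simp add: distrib_left)
  show "c *\<^sub>C (r *\<^sub>R x) = r *\<^sub>R (c *\<^sub>C x)"
    unfolding scaleR_ell2_def by transfer (simp add: mult.left_commute)
  have "(\<Sum>\<^sub>\<infinity>i. (cmod (coord (c *\<^sub>C x) i))\<^sup>2) = (cmod c)\<^sup>2 * (\<Sum>\<^sub>\<infinity>i. (cmod (coord x i))\<^sup>2)"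
    by (simp add: scaleC_ell2.rep_eq norm_mult power_mult_distrib
        infsum_cmult_right coord_square_summable)
  then show "norm (c *\<^sub>C x) \<le> norm x * cmod c"
    by (simp add: norm_ell2_def real_sqrt_mult mult.commute)
qed

abbreviation op_mult ::
    "('i ell2 \<Rightarrow>\<^sub>L 'i ell2) \<Rightarrow> ('i ell2 \<Rightarrow>\<^sub>L 'i ell2) \<Rightarrow> ('i ell2 \<Rightarrow>\<^sub>L 'i ell2)"  (infixl \<open>\<cdot>\<close> 70)
  where "S \<cdot> T \<equiv> blinfun_compose S T"

text \<open>
  For \<open>G :: 'i set\<close>, the space \<open>\<ell>\<^sup>2(G)\<close> is identified with the families on \<open>'i\<close> that vanish
  outside \<open>G\<close>, and a bounded operator on \<open>\<ell>\<^sup>2(G)\<close> with its extension by zero on the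
  orthogonal complement. This identification is isometric and respects sums, products and
  adjoints; the unit becomes the orthogonal projection \<open>proj_op G\<close>. It is thus \<open>proj_op G\<close>, and
  not the identity of the ambient type, that enters inverses and exponentials.
\<close>

definition ell2_on :: "'i set \<Rightarrow> 'i ell2 set" where
  "ell2_on G = {x. \<forall>i. i \<notin> G \<longrightarrow> coord x i = 0}"

definition bounded_ops :: "'i set \<Rightarrow> ('i ell2 \<Rightarrow>\<^sub>L 'i ell2) set" where
  "bounded_ops G =
    {T. (\<forall>c x. blinfun_apply T (c *\<^sub>C x) = c *\<^sub>C blinfun_apply T x) \<and>
      proj_op G \<cdot> T \<cdot> proj_op G = T}"

definition op_adj :: "('i ell2 \<Rightarrow>\<^sub>L 'i ell2) \<Rightarrow> ('i ell2 \<Rightarrow>\<^sub>L 'i ell2)" where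
  "op_adj T = (THE S. \<forall>x y. cinner (blinfun_apply T x) y = cinner x (blinfun_apply S y))"

definition self_adjoint :: "'i set \<Rightarrow> ('i ell2 \<Rightarrow>\<^sub>L 'i ell2) \<Rightarrow> bool" where
  "self_adjoint G T \<longleftrightarrow> T \<in> bounded_ops G \<and> op_adj T = T"

text \<open>For self-adjoint \<open>T\<close> the number \<open>cinner (T x) x\<close> is real, so taking \<open>Re\<close> loses nothing.\<close>

definition positive_op :: "'i set \<Rightarrow> ('i ell2 \<Rightarrow>\<^sub>L 'i ell2) \<Rightarrow> bool" where
  "positive_op G T \<longleftrightarrow> self_adjoint G T \<and>
    (\<forall>x\<in>ell2_on G. 0 \<le> Re (cinner (blinfun_apply T x) x))"

definition strictly_positive_op :: "'i set \<Rightarrow> ('i ell2 \<Rightarrow>\<^sub>L 'i ell2) \<Rightarrow> bool" where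
  "strictly_positive_op G T \<longleftrightarrow> self_adjoint G T \<and>
    (\<exists>c>0. \<forall>x\<in>ell2_on G. c * (norm x)\<^sup>2 \<le> Re (cinner (blinfun_apply T x) x))"

definition op_sqrt :: "'i set \<Rightarrow> ('i ell2 \<Rightarrow>\<^sub>L 'i ell2) \<Rightarrow> ('i ell2 \<Rightarrow>\<^sub>L 'i ell2)" where
  "op_sqrt G T = (THE S. positive_op G S \<and> S \<cdot> S = T)"

definition is_op_inverse ::
    "'i set \<Rightarrow> ('i ell2 \<Rightarrow>\<^sub>L 'i ell2) \<Rightarrow> ('i ell2 \<Rightarrow>\<^sub>L 'i ell2) \<Rightarrow> bool" where
  "is_op_inverse G T S \<longleftrightarrow> S \<in> bounded_ops G \<and> T \<cdot> S = proj_op G \<and> S \<cdot> T = proj_op G"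

definition op_invertible :: "'i set \<Rightarrow> ('i ell2 \<Rightarrow>\<^sub>L 'i ell2) \<Rightarrow> bool" where
  "op_invertible G T \<longleftrightarrow> T \<in> bounded_ops G \<and> (\<exists>S. is_op_inverse G T S)"

definition op_inv :: "'i set \<Rightarrow> ('i ell2 \<Rightarrow>\<^sub>L 'i ell2) \<Rightarrow> ('i ell2 \<Rightarrow>\<^sub>L 'i ell2)" where
  "op_inv G T = (THE S. is_op_inverse G T S)"

primrec op_power :: "'i set \<Rightarrow> ('i ell2 \<Rightarrow>\<^sub>L 'i ell2) \<Rightarrow> nat \<Rightarrow> ('i ell2 \<Rightarrow>\<^sub>L 'i ell2)" where
  "op_power G T 0 = proj_op G"
| "op_power G T (Suc n) = T \<cdot> op_power G T n"

definition op_exp :: "'i set \<Rightarrow> ('i ell2 \<Rightarrow>\<^sub>L 'i ell2) \<Rightarrow> ('i ell2 \<Rightarrow>\<^sub>L 'i ell2)" where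
  "op_exp G T = (\<Sum>n. (1 / fact n) *\<^sub>R op_power G T n)"

section \<open>Proper \<open>q\<close>-Banach subalgebras\<close>

text \<open>
  The function \<open>qnorm\<close> is total on the ambient type; only its values on the carrier \<open>\<A>\<close> matter.
\<close>

locale q_banach_space =
  fixes q :: real
    and \<A> :: "('i ell2 \<Rightarrow>\<^sub>L 'i ell2) set"
    and qnorm :: "('i ell2 \<Rightarrow>\<^sub>L 'i ell2) \<Rightarrow> real"
  assumes q_pos: "0 < q" and q_le_1: "q \<le> 1"
    and zero_mem: "0 \<in> \<A>"
    and add_mem: "\<lbrakk>A \<in> \<A>; B \<in> \<A>\<rbrakk> \<Longrightarrow> A + B \<in> \<A>"
    and scale_mem: "A \<in> \<A> \<Longrightarrow> scale_op c \<cdot> A \<in> \<A>"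
    and qnorm_nonneg: "A \<in> \<A> \<Longrightarrow> 0 \<le> qnorm A"
    and qnorm_eq_0_iff: "A \<in> \<A> \<Longrightarrow> qnorm A = 0 \<longleftrightarrow> A = 0"
    and qnorm_scale: "A \<in> \<A> \<Longrightarrow> qnorm (scale_op c \<cdot> A) = cmod c * qnorm A"
    and qnorm_add: "\<lbrakk>A \<in> \<A>; B \<in> \<A>\<rbrakk> \<Longrightarrow>
      qnorm (A + B) powr q \<le> qnorm A powr q + qnorm B powr q"
    and qnorm_complete: "\<lbrakk>\<And>n :: nat. S n \<in> \<A>;
        \<And>e. 0 < e \<Longrightarrow> \<exists>N. \<forall>m\<ge>N. \<forall>n\<ge>N. qnorm (S m - S n) powr q < e\<rbrakk> \<Longrightarrow>
      \<exists>L\<in>\<A>. (\<lambda>n. qnorm (S n - L) powr q) \<longlonglongrightarrow> 0"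

locale q_banach_algebra = q_banach_space q \<A> qnorm
  for q :: real
    and G :: "'i set"
    and \<A> :: "('i ell2 \<Rightarrow>\<^sub>L 'i ell2) set"
    and qnorm :: "('i ell2 \<Rightarrow>\<^sub>L 'i ell2) \<Rightarrow> real" +
  assumes one_mem: "proj_op G \<in> \<A>"
    and mult_mem: "\<lbrakk>A \<in> \<A>; B \<in> \<A>\<rbrakk> \<Longrightarrow> A \<cdot> B \<in> \<A>"
    and qnorm_mult: "\<exists>K\<^sub>0>0. \<forall>A\<in>\<A>. \<forall>B\<in>\<A>. qnorm (A \<cdot> B) \<le> K\<^sub>0 * qnorm A * qnorm B"

text \<open>
  In the differential inequality the right-hand side is \<open>0\<close> when \<open>A = 0\<close> or \<open>B = 0\<close>, because
  \<open>qnorm 0 powr q = 0 powr q = 0\<close>.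
\<close>

locale proper_q_banach_subalgebra = q_banach_algebra q G \<A> qnorm
  for q :: real
    and G :: "'i set"
    and \<A> :: "('i ell2 \<Rightarrow>\<^sub>L 'i ell2) set"
    and qnorm :: "('i ell2 \<Rightarrow>\<^sub>L 'i ell2) \<Rightarrow> real" +
  assumes adj_mem: "A \<in> \<A> \<Longrightarrow> op_adj A \<in> \<A>"
    and qnorm_adj: "A \<in> \<A> \<Longrightarrow> qnorm (op_adj A) = qnorm A"
    and subset_bounded_ops: "\<A> \<subseteq> bounded_ops G"
    and norm_le_qnorm: "A \<in> \<A> \<Longrightarrow> norm A \<le> qnorm A"
    and differential: "\<exists>\<theta> D. 0 < \<theta> \<and> \<theta> \<le> 1 \<and> 0 < D \<and>
      (\<forall>A\<in>\<A>. \<forall>B\<in>\<A>. qnorm (A \<cdot> B) powr q \<le>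
        D * qnorm A powr q * qnorm B powr q *
          ((norm A / qnorm A) powr (q * \<theta>) + (norm B / qnorm B) powr (q * \<theta>)))"

section \<open>Stability\<close>

text \<open>
  Exponential stability on an algebra \<open>\<A>\<close> of operators with (quasi-)norm \<open>nrm\<close>. The exponential
  is the one of \<open>\<B>(\<ell>\<^sup>2(G))\<close>; membership in \<open>\<A>\<close> is required so that \<open>nrm\<close> is only used on \<open>\<A>\<close>.
\<close>

definition exp_stable ::
    "'i set \<Rightarrow> ('i ell2 \<Rightarrow>\<^sub>L 'i ell2) set \<Rightarrow> (('i ell2 \<Rightarrow>\<^sub>L 'i ell2) \<Rightarrow> real)
      \<Rightarrow> ('i ell2 \<Rightarrow>\<^sub>L 'i ell2) \<Rightarrow> bool" where
  "exp_stable G \<A> nrm A \<longleftrightarrow> A \<in> \<A> \<and>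
    (\<exists>E>0. \<exists>\<alpha>>0. \<forall>t\<ge>0. op_exp G (t *\<^sub>R A) \<in> \<A> \<and>
      nrm (op_exp G (t *\<^sub>R A)) \<le> E * exp (- \<alpha> * t))"

definition exp_stabilizable ::
    "'i set \<Rightarrow> ('i ell2 \<Rightarrow>\<^sub>L 'i ell2) \<Rightarrow> ('i ell2 \<Rightarrow>\<^sub>L 'i ell2) \<Rightarrow> bool" where
  "exp_stabilizable G A B \<longleftrightarrow>
    (\<exists>F\<in>bounded_ops G. exp_stable G (bounded_ops G) norm (A + B \<cdot> F))"

definition exp_detectable ::
    "'i set \<Rightarrow> ('i ell2 \<Rightarrow>\<^sub>L 'i ell2) \<Rightarrow> ('i ell2 \<Rightarrow>\<^sub>L 'i ell2) \<Rightarrow> bool" where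
  "exp_detectable G A C \<longleftrightarrow>
    (\<exists>L\<in>bounded_ops G. exp_stable G (bounded_ops G) norm (A + L \<cdot> C))"

end

theory Submission
  imports Defs
begin

text \<open>
  The Hamiltonian \<open>H = (A, -S; -Q, -A\<^sup>*)\<close> with \<open>S = B R\<^sup>-\<^sup>1 B\<^sup>*\<close> is conjugated by
  \<open>T = (1, -Y; X, 1)\<close> to a block-diagonal operator with blocks \<open>A\<^sub>X\<close> and
  \<open>- (1 + X Y)\<^sup>-\<^sup>1 A\<^sub>X\<^sup>* (1 + X Y)\<close>. The Lyapunov argument for detectable pairs shows that \<open>A\<^sub>X\<close>
  is stable on \<open>\<ell>\<^sup>2\<close>, so \<open>(1 + exp (n H))\<^sup>-\<^sup>1\<close> tends in operator norm to the projection with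
  block column \<open>(Z; X Z)\<close>, where \<open>Z = (1 + Y X)\<^sup>-\<^sup>1\<close>. A differential subalgebra sees the same
  spectral radius as the operator norm; hence it is inverse-closed, and it contains every
  idempotent that is an operator-norm limit of commuting elements, because such an idempotent is
  a power series in a nearby element. So \<open>Z\<close> and \<open>X Z\<close>, and with them \<open>X\<close>, lie in the
  algebra, and the spectral radius estimate for \<open>exp A\<^sub>X\<close> transfers stability to it.
\<close>

section \<open>The Banach algebra of bounded endomorphisms\<close>

text \<open>The conjugation by \<open>T\<close> takes place among all bounded operators, because
  \<open>X\<close> and \<open>Y\<close> are not known to lie in the algebra; only \<open>H\<close>
  is. Every membership therefore has to be obtained from \<open>H\<close> by operations that stay
  inside: exponentials, inverses, and limits controlled by the operator norm. A contour integral
  would require integration in a space that is merely \<open>q\<close>-normed, so the spectral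
  projection is reached by power series and sequences alone.

  The unit of the algebra is \<open>proj_op G\<close>, whereas exponentials and Neumann series are
  taken around the identity. The algebra is therefore enlarged by operators on the complement of
  \<open>ell2_on G\<close>, and the equations are padded there by scalars for which every condition
  holds trivially.

  Stability on the Hilbert space is shown in discrete time: for one small step \<open>h\<close>, an
  energy function equivalent to the squared norm shrinks by a fixed factor, with all second-order
  errors estimated explicitly. This avoids differentiating along trajectories.\<close>

text \<open>
  The type of bounded operators is wrapped in order to carry a ring structure, so that the
  library theory of power series and of \<open>exp\<close> in Banach algebras applies.
\<close>

typedef (overloaded) 'a endo = "UNIV :: ('a::real_normed_vector \<Rightarrow>\<^sub>L 'a) set"
  morphisms op_of Endo ..

setup_lifting type_definition_endo

lift_definition ap :: "'a::real_normed_vector endo \<Rightarrow> 'a \<Rightarrow> 'a" is blinfun_apply .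

lemma endo_eqI: "(\<And>x. ap S x = ap T x) \<Longrightarrow> S = T"
  by transfer (rule blinfun_eqI)

instantiation endo :: (real_normed_vector) real_normed_algebra
begin

lift_definition zero_endo :: "'a endo" is 0 .
lift_definition plus_endo :: "'a endo \<Rightarrow> 'a endo \<Rightarrow> 'a endo" is plus .
lift_definition minus_endo :: "'a endo \<Rightarrow> 'a endo \<Rightarrow> 'a endo" is minus .
lift_definition uminus_endo :: "'a endo \<Rightarrow> 'a endo" is uminus .
lift_definition scaleR_endo :: "real \<Rightarrow> 'a endo \<Rightarrow> 'a endo" is scaleR .
lift_definition times_endo :: "'a endo \<Rightarrow> 'a endo \<Rightarrow> 'a endo" is blinfun_compose .
lift_definition norm_endo :: "'a endo \<Rightarrow> real" is norm .
definition sgn_endo :: "'a endo \<Rightarrow> 'a endo" where "sgn_endo x = inverse (norm x) *\<^sub>R x"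
definition dist_endo :: "'a endo \<Rightarrow> 'a endo \<Rightarrow> real" where "dist_endo x y = norm (x - y)"
definition uniformity_endo :: "('a endo \<times> 'a endo) filter" where
  "uniformity_endo = (INF e\<in>{0<..}. principal {(x, y). dist x y < e})"
definition open_endo :: "'a endo set \<Rightarrow> bool" where
  "open_endo U = (\<forall>x\<in>U. \<forall>\<^sub>F (x', y) in uniformity. x' = x \<longrightarrow> y \<in> U)"

instance
proof
  fix a b c :: "'a endo" and r s :: real
  show "a + b + c = a + (b + c)" "a + b = b + a" "0 + a = a" "- a + a = 0" "a - b = a + - b"
    by (transfer; simp add: algebra_simps)+
  show "r *\<^sub>R (a + b) = r *\<^sub>R a + r *\<^sub>R b" "(r + s) *\<^sub>R a = r *\<^sub>R a + s *\<^sub>R a"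
    "r *\<^sub>R s *\<^sub>R a = (r * s) *\<^sub>R a" "1 *\<^sub>R a = a"
    by (transfer; simp add: algebra_simps)+
  show "a * b * c = a * (b * c)" "(a + b) * c = a * c + b * c" "a * (b + c) = a * b + a * c"
    "r *\<^sub>R a * b = r *\<^sub>R (a * b)" "a * r *\<^sub>R b = r *\<^sub>R (a * b)"
    by (transfer; rule blinfun_eqI; simp add: blinfun.bilinear_simps)+
  show "norm (a * b) \<le> norm a * norm b" by transfer (rule norm_blinfun_compose)
  show "norm a = 0 \<longleftrightarrow> a = 0" "norm (a + b) \<le> norm a + norm b" "norm (r *\<^sub>R a) = \<bar>r\<bar> * norm a"
    by (transfer; simp add: norm_triangle_ineq)+
qed (simp_all add: sgn_endo_def dist_endo_def uniformity_endo_def open_endo_def)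

end

instantiation endo :: ("{real_normed_vector, perfect_space}") real_normed_algebra_1
begin

lift_definition one_endo :: "'a endo" is id_blinfun .

instance
proof
  fix a :: "'a endo"
  show "norm (1 :: 'a endo) = 1" by transfer (rule norm_blinfun_id)
  then show "(0 :: 'a endo) \<noteq> 1" by (metis norm_zero zero_neq_one)
  show "1 * a = a" "a * 1 = a"
    by (transfer; rule blinfun_eqI; simp)+
qed

end

instance endo :: (banach) banach
proof
  fix X :: "nat \<Rightarrow> 'a endo"
  assume "Cauchy X"
  then have "Cauchy (\<lambda>n. op_of (X n))"
    unfolding Cauchy_def dist_norm by (simp add: norm_endo.rep_eq minus_endo.rep_eq)
  then obtain L where "(\<lambda>n. op_of (X n)) \<longlonglongrightarrow> L"
    using Cauchy_convergent convergent_def by blast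
  then have "X \<longlonglongrightarrow> Endo L"
    unfolding LIMSEQ_def dist_norm
    by (simp add: norm_endo.rep_eq minus_endo.rep_eq Endo_inverse)
  then show "convergent X" by (auto simp: convergent_def)
qed

lemma bounded_bilinear_ap: "bounded_bilinear ap"
proof (rule bounded_bilinear.intro)
  fix a a' :: "'a endo" and b b' :: 'a and r :: real
  show "ap (a + a') b = ap a b + ap a' b" "ap a (b + b') = ap a b + ap a b'"
    "ap (r *\<^sub>R a) b = r *\<^sub>R ap a b" "ap a (r *\<^sub>R b) = r *\<^sub>R ap a b"
    by (transfer; simp add: blinfun.bilinear_simps)+
  have "norm (ap a b) \<le> norm a * norm b * 1" for a :: "'a endo" and b :: 'a
    by transfer (simp add: norm_blinfun)
  then show "\<exists>K. \<forall>(a :: 'a endo) b. norm (ap a b) \<le> norm a * norm b * K" by blast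
qed

interpretation ap: bounded_bilinear ap
  by (rule bounded_bilinear_ap)

lemma norm_ap: "norm (ap T x) \<le> norm T * norm x"
  by transfer (rule norm_blinfun)

lemma ap_mult [simp]: "ap (S * T) x = ap S (ap T x)"
  by transfer simp

lemma ap_one [simp]: "ap 1 x = x"
  by transfer simp

lemmas ap_simps [simp] =
  ap.add_left ap.add_right ap.diff_left ap.diff_right ap.minus_left ap.minus_right
  ap.zero_left ap.zero_right ap.scaleR_left ap.scaleR_right

lemma norm_endo_bound:
  assumes "0 \<le> c" "\<And>x. norm (ap T x) \<le> c * norm x"
  shows "norm T \<le> c"
  using assms by transfer (auto intro!: norm_blinfun_bound)

lift_definition mk_endo :: "('a::real_normed_vector \<Rightarrow> 'a) \<Rightarrow> 'a endo" is Blinfun .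

lemma ap_mk_endo: "bounded_linear f \<Longrightarrow> ap (mk_endo f) = f"
  by transfer (simp add: bounded_linear_Blinfun_apply)

section \<open>Adjoints and positivity on a real Hilbert space\<close>

text \<open>A relation rather than a function, since on a general real inner product space an
  adjoint need not exist. For complex linear operators on \<open>ell2\<close> the real adjoint is
  also the complex one, see \<open>is_adj_cinner\<close>.\<close>

definition is_adj :: "'a::real_inner endo \<Rightarrow> 'a endo \<Rightarrow> bool" where
  "is_adj S T \<longleftrightarrow> (\<forall>x y. ap S x \<bullet> y = x \<bullet> ap T y)"

lemma is_adjD: "is_adj S T \<Longrightarrow> ap S x \<bullet> y = x \<bullet> ap T y"
  by (simp add: is_adj_def)

lemma is_adj_sym: "is_adj S T \<Longrightarrow> is_adj T S"
  by (metis is_adj_def inner_commute)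

lemma is_adj_add: "is_adj S T \<Longrightarrow> is_adj S' T' \<Longrightarrow> is_adj (S + S') (T + T')"
  and is_adj_diff: "is_adj S T \<Longrightarrow> is_adj S' T' \<Longrightarrow> is_adj (S - S') (T - T')"
  and is_adj_minus: "is_adj S T \<Longrightarrow> is_adj (- S) (- T)"
  and is_adj_scaleR: "is_adj S T \<Longrightarrow> is_adj (r *\<^sub>R S) (r *\<^sub>R T)"
  and is_adj_mult: "is_adj S T \<Longrightarrow> is_adj S' T' \<Longrightarrow> is_adj (S * S') (T' * T)"
  by (simp_all add: is_adj_def inner_simps)

lemma is_adj_one: "is_adj 1 (1 :: 'a::{real_inner, perfect_space} endo)"
  by (simp add: is_adj_def)

lemma is_adj_power:
  fixes S T :: "'a::{real_inner, perfect_space} endo"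
  shows "is_adj S T \<Longrightarrow> is_adj (S ^ n) (T ^ n)"
proof (induction n)
  case (Suc n)
  then have "is_adj (S * S ^ n) (T ^ n * T)" by (blast intro: is_adj_mult)
  then show ?case by (simp add: power_commutes)
qed (simp add: is_adj_one)

lemma is_adj_unique:
  assumes "is_adj S T" "is_adj S T'"
  shows "T = T'"
proof (rule endo_eqI)
  fix y
  have "x \<bullet> (ap T y - ap T' y) = 0" for x
    using is_adjD[OF assms(1), of x y] is_adjD[OF assms(2), of x y] by (simp add: inner_diff_right)
  then have "(ap T y - ap T' y) \<bullet> (ap T y - ap T' y) = 0" .
  then show "ap T y = ap T' y" by simp
qed

lemma norm_is_adj_le:
  assumes "is_adj S T"
  shows "norm T \<le> norm S"
proof (rule norm_endo_bound)
  fix y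
  have "norm (ap T y) * norm (ap T y) = ap S (ap T y) \<bullet> y"
    using assms by (simp add: is_adj_def flip: power2_norm_eq_inner power2_eq_square)
  also have "\<dots> \<le> norm (ap S (ap T y)) * norm y" by (rule norm_cauchy_schwarz)
  also have "\<dots> \<le> norm (ap T y) * (norm S * norm y)"
    using mult_right_mono[OF norm_ap[of S "ap T y"], of "norm y"] by (simp add: algebra_simps)
  finally show "norm (ap T y) \<le> norm S * norm y"
    by (cases "norm (ap T y) = 0") (auto dest: mult_left_le_imp_le)
qed simp

lemma norm_is_adj: "is_adj S T \<Longrightarrow> norm T = norm S"
  by (meson is_adj_sym norm_is_adj_le order_antisym)

lemma is_adj_sums:
  assumes "\<And>n. is_adj (f n) (g n)" "f sums S" "g sums T"
  shows "is_adj S T"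
  unfolding is_adj_def
proof (intro allI)
  fix x y
  have "(\<lambda>n. ap (f n) x \<bullet> y) sums (ap S x \<bullet> y)"
    using bounded_linear.sums[OF bounded_linear_inner_left, OF bounded_linear.sums[OF ap.bounded_linear_left assms(2)]] .
  moreover have "(\<lambda>n. x \<bullet> ap (g n) y) sums (x \<bullet> ap T y)"
    using bounded_linear.sums[OF bounded_linear_inner_right, OF bounded_linear.sums[OF ap.bounded_linear_left assms(3)]] .
  ultimately show "ap S x \<bullet> y = x \<bullet> ap T y"
    using is_adjD[OF assms(1)] by (simp add: sums_unique2)
qed

lemma is_adj_exp:
  fixes S T :: "'a::{real_inner, banach, perfect_space} endo"
  assumes "is_adj S T"
  shows "is_adj (exp S) (exp T)"
  using exp_converges[of S] exp_converges[of T]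
  by (rule is_adj_sums[rotated]) (auto intro: is_adj_scaleR is_adj_power assms)

section \<open>Positive operators and their quadratic forms\<close>

definition posop :: "'a::real_inner endo \<Rightarrow> bool" where
  "posop T \<longleftrightarrow> is_adj T T \<and> (\<forall>x. 0 \<le> ap T x \<bullet> x)"

text \<open>The discriminant argument for a form that may be degenerate: the quadratic in
  \<open>t\<close> given by the form at \<open>x + t y\<close> is nonnegative, and
  \<open>t = - b / a\<close> is its minimum. If \<open>a = 0\<close> it is affine in
  \<open>t\<close>, which forces \<open>b = 0\<close>.\<close>

lemma posop_cauchy_schwarz:
  assumes "posop T"
  shows "(ap T x \<bullet> y)\<^sup>2 \<le> (ap T x \<bullet> x) * (ap T y \<bullet> y)"
proof -
  have sym: "ap T y \<bullet> x = ap T x \<bullet> y"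
    using assms by (metis posop_def is_adj_def inner_commute)
  have quad: "0 \<le> ap T x \<bullet> x + 2 * t * (ap T x \<bullet> y) + t\<^sup>2 * (ap T y \<bullet> y)" for t
  proof -
    have "0 \<le> ap T (x + t *\<^sub>R y) \<bullet> (x + t *\<^sub>R y)" using assms by (simp only: posop_def)
    then show ?thesis by (simp add: inner_simps sym power2_eq_square algebra_simps)
  qed
  define a b c where "a = ap T y \<bullet> y" "b = ap T x \<bullet> y" "c = ap T x \<bullet> x"
  have "0 \<le> a" "0 \<le> c" using assms by (auto simp: a_b_c_def posop_def)
  have q: "0 \<le> c + 2 * t * b + t\<^sup>2 * a" for t using quad[of t] by (simp add: a_b_c_def)
  have "b\<^sup>2 \<le> c * a"
  proof (cases "a = 0")
    case True
    have "b = 0"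
    proof (rule ccontr)
      assume "b \<noteq> 0"
      \<comment> \<open>With \<open>a = 0\<close> the quadratic is \<open>c + 2 * t * b\<close>, and
        this \<open>t\<close> makes it equal to -1.\<close>
      then have "2 * (- (c + 1) / (2 * b)) * b = - (c + 1)" by (simp add: field_simps)
      then show False using q[of "- (c + 1) / (2 * b)"] True by simp
    qed
    then show ?thesis using True by simp
  next
    case False
    then have "a > 0" using \<open>0 \<le> a\<close> by simp
    then have "0 \<le> (c + 2 * (- b / a) * b + (- b / a)\<^sup>2 * a) * a"
      using q[of "- b / a"] by (intro mult_nonneg_nonneg) auto
    also have "\<dots> = c * a - b\<^sup>2" using \<open>a > 0\<close> by (simp add: field_simps power2_eq_square)
    finally show ?thesis by simp
  qed
  then show ?thesis by (simp add: a_b_c_def)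
qed

text \<open>Cauchy-Schwarz for the form of \<open>T\<close> with \<open>y = T x\<close>, followed by
  cancellation of the squared norm of \<open>T x\<close>. Keeping one factor of the form on the
  right lets a vanishing form force \<open>T x = 0\<close>, and lets dissipated energy control
  \<open>T x\<close>.\<close>

lemma posop_norm_ap_le:
  assumes "posop T" "0 \<le> c" "\<And>x. ap T x \<bullet> x \<le> c * (norm x)\<^sup>2"
  shows "(norm (ap T x))\<^sup>2 \<le> c * (ap T x \<bullet> x)"
proof (cases "ap T x = 0")
  case False
  have "((norm (ap T x))\<^sup>2)\<^sup>2 \<le> (ap T x \<bullet> x) * (ap T (ap T x) \<bullet> ap T x)"
    using posop_cauchy_schwarz[OF assms(1), of x "ap T x"] by (simp add: power2_norm_eq_inner)
  also have "\<dots> \<le> (ap T x \<bullet> x) * (c * (norm (ap T x))\<^sup>2)"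
    using assms by (intro mult_left_mono) (auto simp: posop_def)
  finally have "(norm (ap T x))\<^sup>2 * (norm (ap T x))\<^sup>2 \<le> (c * (ap T x \<bullet> x)) * (norm (ap T x))\<^sup>2"
    by (simp add: power2_eq_square algebra_simps)
  then show ?thesis by (rule mult_right_le_imp_le) (use False in simp)
qed (use assms in \<open>auto simp: posop_def\<close>)

lemma posop_norm_le:
  assumes "posop T" "0 \<le> c" "\<And>x. ap T x \<bullet> x \<le> c * (norm x)\<^sup>2"
  shows "norm T \<le> c"
proof (rule norm_endo_bound)
  fix x
  have "(norm (ap T x))\<^sup>2 \<le> c * (ap T x \<bullet> x)" by (rule posop_norm_ap_le) fact+
  also have "\<dots> \<le> c * (c * (norm x)\<^sup>2)" using assms by (intro mult_left_mono) auto
  finally have "(norm (ap T x))\<^sup>2 \<le> (c * norm x)\<^sup>2" by (simp add: power2_eq_square algebra_simps)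
  then show "norm (ap T x) \<le> c * norm x" by (rule power2_le_imp_le) (simp add: assms)
qed fact

lemma inner_ap_le_norm: "ap T x \<bullet> x \<le> norm T * (norm x)\<^sup>2"
proof -
  have "ap T x \<bullet> x \<le> norm (ap T x) * norm x" by (rule norm_cauchy_schwarz)
  also have "\<dots> \<le> (norm T * norm x) * norm x" by (intro mult_right_mono norm_ap) simp
  finally show ?thesis by (simp add: power2_eq_square algebra_simps)
qed

lemma posop_norm_ap_le_norm: "posop T \<Longrightarrow> (norm (ap T x))\<^sup>2 \<le> norm T * (ap T x \<bullet> x)"
  by (intro posop_norm_ap_le) (auto intro: inner_ap_le_norm)

text \<open>On unit vectors the form of \<open>T / norm T\<close> lies between
  \<open>c / norm T\<close> and 1, so the form of the difference lies between 0 and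
  \<open>1 - c / norm T\<close>; for positive operators such a bound is a norm bound. This makes
  coercive operators invertible by a Neumann series.\<close>

lemma norm_one_minus_scaled_lt_1:
  fixes T :: "'a::{real_inner, perfect_space} endo"
  assumes "is_adj T T" "0 < c" "\<And>x. c * (norm x)\<^sup>2 \<le> ap T x \<bullet> x"
  shows "T \<noteq> 0" "norm (1 - (1 / norm T) *\<^sub>R T) < 1"
proof -
  have "(1 :: 'a endo) \<noteq> 0" by simp
  then obtain v :: 'a where "v \<noteq> 0" by (metis ap_one ap.zero_left endo_eqI)
  then show T0: "T \<noteq> 0" using assms(3)[of v] \<open>0 < c\<close> by (auto simp: mult_le_0_iff)
  then have n: "norm T > 0" by simp
  have "c * (norm v)\<^sup>2 \<le> norm T * (norm v)\<^sup>2"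
    using assms(3)[of v] inner_ap_le_norm[of T v] by linarith
  then have "c \<le> norm T" using \<open>v \<noteq> 0\<close> by simp
  have "norm (1 - (1 / norm T) *\<^sub>R T) \<le> 1 - c / norm T"
  proof (rule posop_norm_le)
    have "(1 / norm T) * (ap T x \<bullet> x) \<le> (norm x)\<^sup>2" for x
      using inner_ap_le_norm[of T x] n by (simp add: field_simps)
    then show "posop (1 - (1 / norm T) *\<^sub>R T)"
      using assms(1) unfolding posop_def
      by (auto intro!: is_adj_diff is_adj_one is_adj_scaleR simp: inner_simps power2_norm_eq_inner)
    show "0 \<le> 1 - c / norm T" using n \<open>c \<le> norm T\<close> by simp
    show "ap (1 - (1 / norm T) *\<^sub>R T) x \<bullet> x \<le> (1 - c / norm T) * (norm x)\<^sup>2" for x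
      using divide_right_mono[OF assms(3)[of x], of "norm T"]
      by (simp add: inner_simps power2_norm_eq_inner algebra_simps)
  qed
  also have "\<dots> < 1" using n \<open>0 < c\<close> by simp
  finally show "norm (1 - (1 / norm T) *\<^sub>R T) < 1" .
qed

section \<open>Binomial series\<close>

text \<open>The ratio of consecutive coefficients, \<open>(a - n) / (n + 1)\<close>, has absolute
  value at most 1 in this range of \<open>a\<close>. Hence the binomial series is dominated by the
  geometric series.\<close>

lemma abs_gbinomial_le_1:
  fixes a :: real
  assumes "-1 \<le> a" "a \<le> 1"
  shows "\<bar>a gchoose n\<bar> \<le> 1"
proof (induction n)
  case (Suc n)
  have "(a gchoose Suc n) = (a gchoose n) * ((a - of_nat n) / of_nat (Suc n))"
    by (simp add: gbinomial_prod_rev field_simps)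
  moreover have "\<bar>(a - of_nat n) / of_nat (Suc n)\<bar> \<le> 1"
    using assms by (simp add: abs_le_iff field_simps)
  ultimately show ?case using Suc mult_le_one by (metis abs_ge_zero abs_mult)
qed simp

definition binomial_series :: "real \<Rightarrow> 'a::{real_normed_algebra_1, banach} \<Rightarrow> 'a" where
  "binomial_series a x = (\<Sum>n. (a gchoose n) *\<^sub>R x ^ n)"

lemma suminf_commute:
  fixes y :: "'a::real_normed_algebra"
  assumes "summable f" "\<And>n. y * f n = f n * y"
  shows "y * suminf f = suminf f * y"
  using suminf_mult[OF assms(1), of y] suminf_mult2[OF assms(1), of y] assms(2) by simp

lemma binomial_series_commute:
  fixes x :: "'a::{real_normed_algebra_1, banach}"
  assumes "summable (\<lambda>n. norm ((a gchoose n) *\<^sub>R x ^ n))" "y * x = x * y"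
  shows "y * binomial_series a x = binomial_series a x * y"
  unfolding binomial_series_def
  by (rule suminf_commute[OF summable_norm_cancel[OF assms(1)]])
    (simp add: power_commuting_commutes assms(2))

text \<open>In the Cauchy product the powers combine to \<open>x ^ k\<close>, and Vandermonde's
  convolution sums the coefficients.\<close>

lemma binomial_series_mult:
  fixes x :: "'a::{real_normed_algebra_1, banach}"
  assumes "summable (\<lambda>n. norm ((a gchoose n) *\<^sub>R x ^ n))" "summable (\<lambda>n. norm ((b gchoose n) *\<^sub>R x ^ n))"
  shows "(\<lambda>n. ((a + b) gchoose n) *\<^sub>R x ^ n) sums (binomial_series a x * binomial_series b x)"
proof -
  have "(\<Sum>i\<le>k. (a gchoose i) *\<^sub>R x ^ i * (b gchoose (k - i)) *\<^sub>R x ^ (k - i)) =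
      ((a + b) gchoose k) *\<^sub>R x ^ k" for k
  proof -
    have "(\<Sum>i\<le>k. (a gchoose i) *\<^sub>R x ^ i * (b gchoose (k - i)) *\<^sub>R x ^ (k - i)) =
        (\<Sum>i\<le>k. ((a gchoose i) * (b gchoose (k - i))) *\<^sub>R x ^ k)"
      by (intro sum.cong) (auto simp: mult.commute simp flip: power_add)
    also have "\<dots> = ((a + b) gchoose k) *\<^sub>R x ^ k"
      by (simp add: gbinomial_Vandermonde atMost_atLeast0 flip: scaleR_sum_left)
    finally show ?thesis .
  qed
  then show ?thesis
    using Cauchy_product_sums[OF assms] by (simp add: binomial_series_def)
qed

lemma summable_norm_binomial_series:
  fixes x :: "'a::{real_normed_algebra_1, banach}"
  assumes "norm x < 1" "-1 \<le> a" "a \<le> 1"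
  shows "summable (\<lambda>n. norm ((a gchoose n) *\<^sub>R x ^ n))"
proof (rule summable_comparison_test')
  show "summable (\<lambda>n. norm x ^ n)" using assms(1) by (simp add: summable_geometric)
  show "norm (norm ((a gchoose n) *\<^sub>R x ^ n)) \<le> norm x ^ n" for n
    using mult_mono[OF abs_gbinomial_le_1[OF assms(2,3), of n] norm_power_ineq[of x n]] by simp
qed

lemma gbinomial_minus_one: "((-1 :: real) gchoose n) = (-1) ^ n"
  using gbinomial_minus[of "1 :: real" n] binomial_gbinomial[of n n, where 'a = real] by simp

text \<open>Two series with exponent -1/2 multiply to the one with exponent -1, the geometric series
  of \<open>- x\<close>, whose product with \<open>1 + x\<close> telescopes.\<close>

lemma binomial_series_inverse_sqrt:
  fixes x :: "'a::{real_normed_algebra_1, banach}"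
  assumes "norm x < 1"
  shows "(1 + x) * (binomial_series (-1/2) x * binomial_series (-1/2) x) = 1"
proof -
  let ?B = "binomial_series (-1/2) x * binomial_series (-1/2) x"
  have "summable (\<lambda>n. norm (((-1/2) gchoose n) *\<^sub>R x ^ n))"
    by (rule summable_norm_binomial_series) (use assms in auto)
  from binomial_series_mult[OF this this]
  have "(\<lambda>n. (- x) ^ n) sums ?B"
    by (simp add: gbinomial_minus_one power_minus[of x] scaleR_conv_of_real)
  then have "(\<lambda>n. (1 + x) * (- x) ^ n) sums ((1 + x) * ?B)" by (rule sums_mult)
  moreover have "(\<lambda>n. (1 + x) * (- x) ^ n) = (\<lambda>n. (- x) ^ n - (- x) ^ Suc n)"
    by (simp add: distrib_right)
  moreover have "(\<lambda>n. (- x) ^ n - (- x) ^ Suc n) sums (1 - 0)"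
    using telescope_sums'[OF LIMSEQ_power_zero, of "- x"] assms by simp
  ultimately show ?thesis using sums_unique2 by fastforce
qed

lemma norm_binomial_series_minus_1:
  fixes x :: "'a::{real_normed_algebra_1, banach}"
  assumes "norm x \<le> 1 / 2" "-1 \<le> a" "a \<le> 1"
  shows "norm (binomial_series a x - 1) \<le> 2 * norm x"
proof -
  have s: "summable (\<lambda>n. norm ((a gchoose n) *\<^sub>R x ^ n))"
    by (rule summable_norm_binomial_series) (use assms in auto)
  then have s': "summable (\<lambda>n. norm ((a gchoose Suc n) *\<^sub>R x ^ Suc n))"
    by (subst summable_Suc_iff)
  have le: "norm ((a gchoose Suc n) *\<^sub>R x ^ Suc n) \<le> norm x * (1 / 2) ^ n" for n
  proof -
    have "norm ((a gchoose Suc n) *\<^sub>R x ^ Suc n) \<le> 1 * norm x ^ Suc n"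
      using mult_mono[OF abs_gbinomial_le_1[OF assms(2,3), of "Suc n"] norm_power_ineq[of x "Suc n"]] by simp
    also have "\<dots> \<le> norm x * (1 / 2) ^ n"
      using assms(1) by (simp add: mult_left_mono power_mono del: power_one_over)
    finally show ?thesis .
  qed
  have "binomial_series a x - 1 = (\<Sum>n. (a gchoose Suc n) *\<^sub>R x ^ Suc n)"
    using suminf_split_head[OF summable_norm_cancel[OF s]] by (simp add: binomial_series_def)
  also have "norm \<dots> \<le> (\<Sum>n. norm ((a gchoose Suc n) *\<^sub>R x ^ Suc n))"
    by (rule summable_norm[OF s'])
  also have "\<dots> \<le> (\<Sum>n. norm x * (1 / 2) ^ n)"
    by (intro suminf_le le s' summable_mult summable_geometric) auto
  also have "\<dots> = 2 * norm x" by (simp add: suminf_mult suminf_geometric)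
  finally show ?thesis .
qed

text \<open>Two commuting involutions at distance less than \<open>2\<close> agree, since \<open>d = s - t\<close> has \<open>d\<^sup>3 = 4 d\<close>.\<close>

lemma commuting_involutions_eq:
  fixes s t :: "'a::real_normed_algebra_1"
  assumes "s * s = 1" "t * t = 1" "s * t = t * s" "norm (s - t) < 2"
  shows "s = t"
proof -
  let ?d = "s - t"
  have s: "s * (s * u) = u" and t: "t * (t * u) = u" and c: "t * (s * u) = s * (t * u)" for u
    using assms by (metis mult.assoc mult_1)+
  have "?d * ?d * ?d = 4 *\<^sub>R ?d"
    using assms by (simp add: algebra_simps s t c scaleR_conv_of_real flip: mult_2 scaleR_2)
  then have "4 * norm ?d = norm (?d * ?d * ?d)" by simp
  also have "\<dots> \<le> norm ?d * norm ?d * norm ?d"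
    by (meson norm_mult_ineq mult_right_mono norm_ge_zero order_trans)
  finally have "4 * norm ?d \<le> (norm ?d * norm ?d) * norm ?d" .
  moreover have "norm ?d * norm ?d < 2 * 2"
    by (rule mult_strict_mono) (use assms in auto)
  ultimately have "norm ?d = 0"
    by (metis mult_right_le_imp_le norm_ge_zero not_le less_le mult_numeral_1 numeral_Bit0_eq_double)
  then show ?thesis by simp
qed

section \<open>Powers of exponentials, Neumann series, summability of powers\<close>

lemma exp_real_scaleR:
  fixes x :: "'a::{real_normed_algebra_1, banach}"
  shows "exp (real n *\<^sub>R x) = exp x ^ n"
proof (induction n)
  case (Suc n)
  have "exp (real (Suc n) *\<^sub>R x) = exp (x + real n *\<^sub>R x)" by (simp add: scaleR_add_left)
  also have "\<dots> = exp x * exp (real n *\<^sub>R x)" by (rule exp_add_commuting) simp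
  finally show ?case using Suc by simp
qed simp

lemma neumann_series:
  fixes x :: "'a::{real_normed_algebra_1, banach}"
  assumes "norm x < 1"
  shows "(1 - x) * (\<Sum>n. x ^ n) = 1" "(\<Sum>n. x ^ n) * (1 - x) = 1"
    "norm (\<Sum>n. x ^ n) \<le> 1 / (1 - norm x)"
proof -
  have s: "(\<lambda>n. x ^ n) sums (\<Sum>n. x ^ n)"
    using assms complete_algebra_summable_geometric summable_sums by blast
  have d: "(\<lambda>n. x ^ n - x ^ Suc n) sums 1"
    using telescope_sums'[OF LIMSEQ_power_zero, of x] assms by simp
  have "(\<lambda>n. (1 - x) * x ^ n) = (\<lambda>n. x ^ n - x ^ Suc n)"
    "(\<lambda>n. x ^ n * (1 - x)) = (\<lambda>n. x ^ n - x ^ Suc n)"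
    by (simp_all add: left_diff_distrib right_diff_distrib power_commutes)
  then show "(1 - x) * (\<Sum>n. x ^ n) = 1" "(\<Sum>n. x ^ n) * (1 - x) = 1"
    using sums_mult[OF s, of "1 - x"] sums_mult2[OF s, of "1 - x"] d
    by (metis sums_unique2)+
  have n: "summable (\<lambda>n. norm x ^ n)" using assms by (simp add: summable_geometric)
  have n': "summable (\<lambda>n. norm (x ^ n))"
    by (rule summable_comparison_test'[OF n]) (simp add: norm_power_ineq)
  have "norm (\<Sum>n. x ^ n) \<le> (\<Sum>n. norm (x ^ n))" by (rule summable_norm[OF n'])
  also have "\<dots> \<le> (\<Sum>n. norm x ^ n)" by (intro suminf_le norm_power_ineq n n')
  also have "\<dots> = 1 / (1 - norm x)" using assms by (simp add: suminf_geometric)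
  finally show "norm (\<Sum>n. x ^ n) \<le> 1 / (1 - norm x)" .
qed

text \<open>The terms are eventually below 1, and there \<open>x n\<close> is at most its
  \<open>q\<close>-th power because \<open>q \<le> 1\<close>.\<close>

lemma summable_if_summable_powr:
  fixes x :: "nat \<Rightarrow> real"
  assumes "\<And>n. 0 \<le> x n" "0 < q" "q \<le> 1" "summable (\<lambda>n. x n powr q)"
  shows "summable x"
proof (rule summable_comparison_test_ev[OF _ assms(4)])
  have "eventually (\<lambda>n. x n powr q < 1) sequentially"
    using summable_LIMSEQ_zero[OF assms(4)] by (rule order_tendstoD) simp
  then show "eventually (\<lambda>n. norm (x n) \<le> x n powr q) sequentially"
  proof eventually_elim
    case (elim n)
    then have "x n < 1"
      using ge_one_powr_ge_zero[of "x n" q] assms(2) by linarith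
    then show ?case
      using powr_mono'[of q 1 "x n"] assms(1)[of n] assms(3) by simp
  qed
qed

section \<open>Differential subalgebras\<close>

text \<open>
  The weight \<open>\<nu>\<close> plays the role of the \<open>q\<close>-th power of a \<open>q\<close>-norm, which makes it subadditive.
  The differential inequality is stated in a form that passes to matrices over the algebra.
\<close>

locale diff_algebra =
  fixes \<A> :: "'a::{real_inner, banach, perfect_space} endo set"
    and \<nu> :: "'a endo \<Rightarrow> real" and q :: real
  assumes q_bounds: "0 < q" "q \<le> 1"
    and one_mem: "1 \<in> \<A>"
    and add_mem: "S \<in> \<A> \<Longrightarrow> T \<in> \<A> \<Longrightarrow> S + T \<in> \<A>"
    and scaleR_mem: "T \<in> \<A> \<Longrightarrow> r *\<^sub>R T \<in> \<A>"
    and mult_mem: "S \<in> \<A> \<Longrightarrow> T \<in> \<A> \<Longrightarrow> S * T \<in> \<A>"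
    and adj_ex: "T \<in> \<A> \<Longrightarrow> \<exists>S\<in>\<A>. is_adj T S"
    and nu_nonneg: "T \<in> \<A> \<Longrightarrow> 0 \<le> \<nu> T"
    and nu_scaleR: "T \<in> \<A> \<Longrightarrow> \<nu> (r *\<^sub>R T) = \<bar>r\<bar> powr q * \<nu> T"
    and norm_powr_le: "T \<in> \<A> \<Longrightarrow> norm T powr q \<le> \<nu> T"
    and nu_mult: "\<exists>K\<ge>1. \<forall>S\<in>\<A>. \<forall>T\<in>\<A>. \<nu> (S * T) \<le> K * \<nu> S * \<nu> T"
    and nu_differential: "\<exists>\<theta> D. 0 < \<theta> \<and> \<theta> \<le> 1 \<and> 1 \<le> D \<and>
      (\<forall>S\<in>\<A>. \<forall>T\<in>\<A>. \<forall>s b. \<nu> S \<le> s \<longrightarrow> \<nu> T \<le> s \<longrightarrow> norm S \<le> b \<longrightarrow> norm T \<le> b \<longrightarrow>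
        \<nu> (S * T) \<le> D * s powr (2 - \<theta>) * b powr (q * \<theta>))"
    and suminf_mem: "(\<And>n :: nat. f n \<in> \<A>) \<Longrightarrow> summable (\<lambda>n. \<nu> (f n)) \<Longrightarrow>
      suminf f \<in> \<A> \<and> \<nu> (suminf f) \<le> (\<Sum>n. \<nu> (f n))"
begin

lemma minus_mem: "T \<in> \<A> \<Longrightarrow> - T \<in> \<A>"
  using scaleR_mem[of T "-1"] by simp

lemma diff_mem: "S \<in> \<A> \<Longrightarrow> T \<in> \<A> \<Longrightarrow> S - T \<in> \<A>"
  using add_mem[of S "- T"] minus_mem by simp

lemma power_mem: "T \<in> \<A> \<Longrightarrow> T ^ n \<in> \<A>"
  by (induction n) (auto intro: one_mem mult_mem)

lemma adj_mem: "T \<in> \<A> \<Longrightarrow> is_adj T S \<Longrightarrow> S \<in> \<A>"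
  using adj_ex is_adj_unique by blast

text \<open>
  The key estimate: the differential inequality, iterated along squarings, shows that the spectral
  radius in the algebra does not exceed the operator norm.
\<close>

lemma nu_dyadic_powers_vanish:
  assumes "x \<in> \<A>" "norm x < 1" "0 < e"
  shows "\<exists>k. \<nu> (x ^ (2 ^ k)) \<le> e"
proof -
  obtain \<theta> D where \<theta>: "0 < \<theta>" "\<theta> \<le> 1" and D: "1 \<le> D"
    and diff: "\<And>S s b. S \<in> \<A> \<Longrightarrow> \<nu> S \<le> s \<Longrightarrow> norm S \<le> b \<Longrightarrow>
      \<nu> (S * S) \<le> D * s powr (2 - \<theta>) * b powr (q * \<theta>)"
    using nu_differential by metis
  obtain b where b: "norm x < b" "b < 1" using dense assms(2) by blast
  then have "0 < b" by (metis norm_ge_zero order_le_less_trans)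
  define \<gamma> where "\<gamma> = b powr q"
  have \<gamma>: "0 < \<gamma>" "\<gamma> < 1"
    using \<open>0 < b\<close> b q_bounds powr_less_mono2[of q b 1] by (auto simp: \<gamma>_def)
  \<comment> \<open>Squaring gives the exponent \<open>2 - \<theta>\<close> on the old bound. Half
    of the gain \<open>\<theta>\<close> is kept to absorb the constant \<open>D\<close>; what
    matters is that \<open>\<mu>\<close> stays below 2.\<close>
  define \<mu> where "\<mu> = 2 - \<theta> / 2"
  have \<mu>: "1 < \<mu>" "\<mu> < 2" using \<theta> by (auto simp: \<mu>_def)
  \<comment> \<open>The first entry yields \<open>D \<le> F powr (\<theta> / 2)\<close>, which is
    exactly the spare part of the exponent; the second entry starts the induction.\<close>
  define F where "F = max (D powr (2 / \<theta>)) (\<nu> x / \<gamma>)"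
  have F1: "1 \<le> F"
    using D \<theta> by (auto simp: F_def le_max_iff_disj intro: ge_one_powr_ge_zero)
  have FD: "D \<le> F powr (\<theta> / 2)"
  proof -
    have "D = (D powr (2 / \<theta>)) powr (\<theta> / 2)" using D \<theta> by (simp add: powr_powr)
    also have "\<dots> \<le> F powr (\<theta> / 2)" using D \<theta> by (intro powr_mono2) (auto simp: F_def)
    finally show ?thesis .
  qed
  have bound: "\<nu> (x ^ (2 ^ k)) \<le> F powr (\<mu> ^ k) * \<gamma> ^ (2 ^ k)" for k
  proof (induction k)
    case 0
    have "\<nu> x / \<gamma> \<le> F" by (simp add: F_def)
    then show ?case using \<gamma> F1 by (simp add: field_simps)
  next
    case (Suc k)
    let ?s = "F powr (\<mu> ^ k) * \<gamma> ^ (2 ^ k)"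
    have nb: "norm (x ^ (2 ^ k)) \<le> b ^ (2 ^ k)"
      using b by (intro order_trans[OF norm_power_ineq] power_mono) auto
    have "\<nu> (x ^ (2 ^ Suc k)) = \<nu> (x ^ (2 ^ k) * x ^ (2 ^ k))"
      by (simp add: mult_2 flip: power_add)
    also have "\<dots> \<le> D * ?s powr (2 - \<theta>) * (b ^ (2 ^ k)) powr (q * \<theta>)"
      by (intro diff power_mem assms Suc.IH nb)
    also have "(b ^ (2 ^ k)) powr (q * \<theta>) = (\<gamma> ^ (2 ^ k)) powr \<theta>"
      using \<open>0 < b\<close> by (simp add: \<gamma>_def powr_powr mult_ac flip: powr_realpow)
    also have "D * ?s powr (2 - \<theta>) * (\<gamma> ^ (2 ^ k)) powr \<theta> =
        D * F powr (\<mu> ^ k * (2 - \<theta>)) * (\<gamma> ^ (2 ^ k)) powr 2"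
      using \<gamma> F1 by (simp add: powr_mult powr_powr flip: powr_add)
    also have "\<dots> \<le> F powr (\<mu> ^ k * (\<theta> / 2)) * F powr (\<mu> ^ k * (2 - \<theta>)) * (\<gamma> ^ (2 ^ k)) powr 2"
    proof (intro mult_right_mono)
      have "D \<le> F powr (\<theta> / 2)" by (rule FD)
      also have "\<dots> \<le> F powr (\<mu> ^ k * (\<theta> / 2))"
        using F1 \<theta> one_le_power[of \<mu> k] \<mu> by (intro powr_mono) auto
      finally show "D \<le> F powr (\<mu> ^ k * (\<theta> / 2))" .
    qed auto
    also have "\<dots> = F powr (\<mu> ^ Suc k) * (\<gamma> ^ (2 ^ k)) ^ 2"
      using \<gamma> F1 by (simp add: \<mu>_def algebra_simps flip: powr_add powr_numeral)
    also have "(\<gamma> ^ (2 ^ k)) ^ 2 = \<gamma> ^ (2 ^ Suc k)"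
      by (simp add: mult.commute flip: power_mult)
    finally show ?case .
  qed
  have "(\<lambda>k. (\<mu> / 2) ^ k * ln F + ln \<gamma>) \<longlonglongrightarrow> 0 * ln F + ln \<gamma>"
    using \<mu> by (intro tendsto_intros LIMSEQ_power_zero) auto
  moreover have "filterlim (\<lambda>k. 2 ^ k :: real) at_top sequentially"
    by (intro filterlim_at_infinity_imp_filterlim_at_top filterlim_realpow_sequentially_gt1) auto
  ultimately have "filterlim (\<lambda>k. ((\<mu> / 2) ^ k * ln F + ln \<gamma>) * 2 ^ k) at_bot sequentially"
    using \<gamma> by (intro filterlim_tendsto_neg_mult_at_bot[where c = "ln \<gamma>"]) auto
  then have "eventually (\<lambda>k. ((\<mu> / 2) ^ k * ln F + ln \<gamma>) * 2 ^ k \<le> ln e) sequentially"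
    by (simp add: filterlim_at_bot)
  then obtain k where k: "((\<mu> / 2) ^ k * ln F + ln \<gamma>) * 2 ^ k \<le> ln e"
    by (meson eventually_sequentially order_refl)
  \<comment> \<open>The growth exponent \<open>\<mu> ^ k\<close> is negligible against the decay
    exponent \<open>2 ^ k\<close>, so the logarithm of the bound tends to minus infinity for every
    \<open>F\<close>.\<close>
  have "F powr (\<mu> ^ k) * \<gamma> ^ (2 ^ k) = exp (((\<mu> / 2) ^ k * ln F + ln \<gamma>) * 2 ^ k)"
    using F1 \<gamma> by (simp add: powr_def exp_add algebra_simps power_divide flip: powr_realpow)
  also have "\<dots> \<le> e" using k \<open>0 < e\<close> by (metis exp_le_cancel_iff exp_ln)
  finally show ?thesis using bound[of k] by (intro exI[of _ k]) linarith
qed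

text \<open>Some power \<open>y = x ^ N\<close> has weight at most \<open>1 / K\<close>, which
  cancels the multiplicative constant \<open>K\<close> at each further multiplication by
  \<open>y\<close>. Division with remainder by \<open>N\<close> leaves only finitely many other
  factors.\<close>

lemma nu_powers_bounded_1:
  assumes "x \<in> \<A>" "norm x < 1"
  shows "\<exists>C\<ge>0. \<forall>n. \<nu> (x ^ n) \<le> C"
proof -
  obtain K where K: "1 \<le> K" "\<And>S T. S \<in> \<A> \<Longrightarrow> T \<in> \<A> \<Longrightarrow> \<nu> (S * T) \<le> K * \<nu> S * \<nu> T"
    using nu_mult by metis
  obtain k where k: "\<nu> (x ^ (2 ^ k)) \<le> 1 / K"
    using nu_dyadic_powers_vanish[OF assms, of "1 / K"] K by auto
  define N y where "N = (2 :: nat) ^ k" and "y = x ^ N"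
  have y: "y \<in> \<A>" "\<nu> y \<le> 1 / K" using k power_mem assms by (auto simp: y_def N_def)
  have yj: "\<nu> (y ^ j) \<le> \<nu> 1 + 1" for j
  proof -
    have "\<nu> (y ^ Suc i) \<le> 1 / K" for i
    proof (induction i)
      case (Suc i)
      have "\<nu> (y ^ Suc (Suc i)) \<le> K * \<nu> y * \<nu> (y ^ Suc i)"
        using K(2)[OF y(1) power_mem[OF y(1), of "Suc i"]] by simp
      also have "\<dots> \<le> K * (1 / K) * (1 / K)"
        using Suc y K nu_nonneg[OF y(1)] nu_nonneg[OF power_mem[OF y(1), of "Suc i"]]
        by (intro mult_mono) auto
      finally show ?case using K by simp
    qed (use y in simp)
    moreover have "1 / K \<le> 1" using K by simp
    ultimately show ?thesis
      using nu_nonneg[OF one_mem] by (cases j) (auto intro: order_trans add_increasing simp del: power_Suc)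
  qed
  define C where "C = K * (\<nu> 1 + 1) * (\<Sum>r<N. \<nu> (x ^ r))"
  have nn: "0 \<le> \<nu> (x ^ r)" for r using nu_nonneg power_mem assms by blast
  have "\<nu> (x ^ n) \<le> C" for n
  proof -
    have "x ^ n = y ^ (n div N) * x ^ (n mod N)"
      by (simp add: y_def flip: power_mult power_add)
    also have "\<nu> \<dots> \<le> K * \<nu> (y ^ (n div N)) * \<nu> (x ^ (n mod N))"
      by (intro K power_mem y assms)
    also have "\<dots> \<le> K * (\<nu> 1 + 1) * (\<Sum>r<N. \<nu> (x ^ r))"
    proof (intro mult_mono yj)
      show "\<nu> (x ^ (n mod N)) \<le> (\<Sum>r<N. \<nu> (x ^ r))"
        by (rule member_le_sum) (auto simp: nn N_def)
    qed (use K nn nu_nonneg[OF one_mem] nu_nonneg[OF power_mem[OF y(1)]] in auto)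
    finally show ?thesis by (simp add: C_def)
  qed
  moreover have "0 \<le> C"
    unfolding C_def using K nn nu_nonneg[OF one_mem] by (intro mult_nonneg_nonneg sum_nonneg) auto
  ultimately show ?thesis by blast
qed

section \<open>Spectral radius bound and power series inside the algebra\<close>

lemma nu_powers_bounded:
  assumes "x \<in> \<A>" "norm x < \<rho>"
  shows "\<exists>C\<ge>0. \<forall>n. \<nu> (x ^ n) \<le> C * (\<rho> ^ n) powr q"
proof -
  have \<rho>: "\<rho> > 0" using assms(2) by (metis norm_ge_zero order_le_less_trans)
  obtain C where C: "0 \<le> C" "\<And>n. \<nu> (((1 / \<rho>) *\<^sub>R x) ^ n) \<le> C"
    using nu_powers_bounded_1[of "(1 / \<rho>) *\<^sub>R x"] assms \<rho> scaleR_mem by auto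
  have "\<nu> (x ^ n) \<le> C * (\<rho> ^ n) powr q" for n
  proof -
    have "x ^ n = (\<rho> ^ n) *\<^sub>R ((1 / \<rho>) *\<^sub>R x) ^ n" using \<rho> by (simp add: scaleR_power power_one_over)
    also have "\<nu> \<dots> = (\<rho> ^ n) powr q * \<nu> (((1 / \<rho>) *\<^sub>R x) ^ n)"
      using \<rho> by (subst nu_scaleR) (auto intro: power_mem scaleR_mem assms)
    also have "\<dots> \<le> (\<rho> ^ n) powr q * C" by (intro mult_left_mono C) simp
    finally show ?thesis by (simp add: mult.commute)
  qed
  then show ?thesis using C(1) by blast
qed

text \<open>The radius of convergence is compared with the operator norm of \<open>x\<close>, not
  with its weight. A number \<open>\<sigma>\<close> strictly between \<open>norm x\<close> and
  \<open>\<rho>\<close> bounds the growth of the powers, and the terms then decay geometrically with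
  ratio \<open>(\<sigma> / \<rho>) powr q\<close>.\<close>

lemma power_series_mem:
  fixes c :: "nat \<Rightarrow> real"
  assumes "x \<in> \<A>" "norm x < \<rho>" "\<And>n. \<bar>c n\<bar> * \<rho> ^ n \<le> M"
  shows "(\<Sum>n. c n *\<^sub>R x ^ n) \<in> \<A>"
proof -
  obtain \<sigma> where \<sigma>: "norm x < \<sigma>" "\<sigma> < \<rho>" using dense assms(2) by blast
  then have "0 < \<sigma>" by (metis norm_ge_zero order_le_less_trans)
  then have "0 < \<rho>" using \<sigma> by simp
  obtain C where C: "0 \<le> C" "\<And>n. \<nu> (x ^ n) \<le> C * (\<sigma> ^ n) powr q"
    using nu_powers_bounded[OF assms(1) \<sigma>(1)] by blast
  have "summable (\<lambda>n. \<nu> (c n *\<^sub>R x ^ n))"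
  proof (rule summable_comparison_test)
    have "(\<sigma> / \<rho>) powr q < 1" using \<sigma> \<open>0 < \<sigma>\<close> q_bounds powr_less_mono2[of q "\<sigma> / \<rho>" 1] by auto
    then show "summable (\<lambda>n. (C * M powr q) * ((\<sigma> / \<rho>) powr q) ^ n)"
      by (intro summable_mult summable_geometric) auto
    have "norm (\<nu> (c n *\<^sub>R x ^ n)) \<le> (C * M powr q) * ((\<sigma> / \<rho>) powr q) ^ n" for n
    proof -
      have "norm (\<nu> (c n *\<^sub>R x ^ n)) = \<bar>c n\<bar> powr q * \<nu> (x ^ n)"
        using nu_nonneg[OF power_mem[OF assms(1), of n]] by (simp add: nu_scaleR power_mem assms)
      also have "\<dots> \<le> \<bar>c n\<bar> powr q * (C * (\<sigma> ^ n) powr q)"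
        by (intro mult_left_mono C) auto
      also have "\<dots> = C * (\<bar>c n\<bar> * \<rho> ^ n) powr q * ((\<sigma> / \<rho>) ^ n) powr q"
        using \<open>0 < \<rho>\<close> \<open>0 < \<sigma>\<close> by (simp add: powr_mult power_divide powr_divide)
      also have "\<dots> \<le> C * M powr q * ((\<sigma> / \<rho>) ^ n) powr q"
        using C(1) q_bounds \<open>0 < \<rho>\<close> by (intro mult_right_mono mult_left_mono powr_mono2 assms(3)) auto
      also have "((\<sigma> / \<rho>) ^ n) powr q = ((\<sigma> / \<rho>) powr q) ^ n"
        using \<open>0 < \<rho>\<close> \<open>0 < \<sigma>\<close> by (simp add: powr_powr mult.commute flip: powr_realpow)
      finally show ?thesis .
    qed
    then show "\<exists>N. \<forall>n\<ge>N. norm (\<nu> (c n *\<^sub>R x ^ n)) \<le> (C * M powr q) * ((\<sigma> / \<rho>) powr q) ^ n" by blast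
  qed
  then show ?thesis by (intro suminf_mem[THEN conjunct1] scaleR_mem power_mem assms(1))
qed

lemma one_minus_inverse:
  assumes "x \<in> \<A>" "norm x < 1"
  obtains y where "y \<in> \<A>" "(1 - x) * y = 1" "y * (1 - x) = 1"
proof (rule that)
  show "(\<Sum>n. x ^ n) \<in> \<A>" using power_series_mem[OF assms, of "\<lambda>_. 1" 1] by simp
qed (rule neumann_series[OF assms(2)])+

text \<open>\<open>T / norm T\<close> is 1 minus an element of operator norm below 1, so the Neumann
  series stays in the algebra.\<close>

lemma coercive_inverse:
  assumes "T \<in> \<A>" "is_adj T T" "0 < c" "\<And>x. c * (norm x)\<^sup>2 \<le> ap T x \<bullet> x"
  obtains S where "S \<in> \<A>" "T * S = 1" "S * T = 1"
proof -
  note n = norm_one_minus_scaled_lt_1[OF assms(2-4)]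
  have "1 - (1 / norm T) *\<^sub>R T \<in> \<A>" by (intro diff_mem one_mem scaleR_mem assms)
  from one_minus_inverse[OF this n(2)] obtain y where
    y: "y \<in> \<A>" "(1 / norm T) *\<^sub>R T * y = 1" "y * (1 / norm T) *\<^sub>R T = 1"
    by (metis diff_diff_eq2 add_diff_cancel_left')
  show ?thesis
  proof (rule that)
    show "(1 / norm T) *\<^sub>R y \<in> \<A>" by (intro scaleR_mem y)
    show "T * (1 / norm T) *\<^sub>R y = 1" using y(2) by simp
    show "(1 / norm T) *\<^sub>R y * T = 1" using y(3) by simp
  qed
qed

text \<open>Hulanicki's argument: \<open>T\<^sup>* T\<close> is coercive when \<open>T\<close> is invertible.\<close>

lemma inverse_closed:
  assumes "T \<in> \<A>" "T * S = 1" "S * T = 1"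
  shows "S \<in> \<A>"
proof -
  obtain T' where T': "T' \<in> \<A>" "is_adj T T'" using adj_ex assms(1) by blast
  have S0: "norm S > 0" using assms(2) by auto
  have "(1 / (norm S)\<^sup>2) * (norm x)\<^sup>2 \<le> ap (T' * T) x \<bullet> x" for x
  proof -
    have "norm x = norm (ap S (ap T x))" using assms(3) by (metis ap_mult ap_one)
    also have "\<dots> \<le> norm S * norm (ap T x)" by (rule norm_ap)
    finally have "(norm x)\<^sup>2 \<le> (norm S * norm (ap T x))\<^sup>2" by (rule power_mono) simp
    moreover have "ap (T' * T) x \<bullet> x = (norm (ap T x))\<^sup>2"
      using is_adjD[OF is_adj_sym[OF T'(2)]] by (simp add: power2_norm_eq_inner)
    ultimately show ?thesis using S0 by (simp add: field_simps)
  qed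
  moreover have "is_adj (T' * T) (T' * T)" by (intro is_adj_mult T' is_adj_sym[OF T'(2)])
  ultimately obtain V where V: "V \<in> \<A>" "V * (T' * T) = 1"
    using coercive_inverse[of "T' * T" "1 / (norm S)\<^sup>2"] T' assms(1) S0 by (auto intro: mult_mem)
  have "S = V * (T' * T) * S" using V by simp
  also have "\<dots> = V * T'" using assms(2) by (simp add: mult.assoc)
  finally show ?thesis using V T' by (auto intro: mult_mem)
qed

section \<open>Exponentials inside the algebra\<close>

lemma exp_coeff_bound: "0 \<le> \<rho> \<Longrightarrow> \<bar>1 / fact n\<bar> * \<rho> ^ n \<le> exp (\<rho> :: real)"
proof -
  assume \<rho>: "0 \<le> \<rho>"
  have "(\<Sum>k\<in>{n}. \<rho> ^ k /\<^sub>R fact k) \<le> (\<Sum>k. \<rho> ^ k /\<^sub>R fact k)"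
    using \<rho> by (intro sum_le_suminf summable_exp_generic) auto
  then show ?thesis by (simp add: exp_def field_simps)
qed

lemma exp_mem: "x \<in> \<A> \<Longrightarrow> exp x \<in> \<A>"
  using power_series_mem[of x "norm x + 1" "\<lambda>n. 1 / fact n" "exp (norm x + 1)"]
    exp_coeff_bound[of "norm x + 1"]
  by (simp add: exp_def inverse_eq_divide)

lemma nu_exp_bounded:
  assumes "x \<in> \<A>"
  shows "\<exists>C\<ge>0. \<forall>t\<in>{0..1}. \<nu> (exp (t *\<^sub>R x)) \<le> C"
proof -
  define \<rho> where "\<rho> = norm x + 1"
  have \<rho>: "1 \<le> \<rho>" by (simp add: \<rho>_def)
  obtain C where C: "0 \<le> C" "\<And>n. \<nu> (x ^ n) \<le> C * (\<rho> ^ n) powr q"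
    using nu_powers_bounded[OF assms, of \<rho>] by (auto simp: \<rho>_def)
  \<comment> \<open>Bounding \<open>(2 * \<rho>) ^ n / fact n\<close> by
    \<open>exp (2 * \<rho>)\<close> leaves a factor \<open>(1 / 2) ^ n\<close>: a geometric majorant
    that does not depend on \<open>t\<close>.\<close>
  define h where "h n = C * exp (2 * \<rho>) powr q * ((1 / 2) powr q) ^ n" for n
  have "(1 / 2) powr q < 1" using q_bounds powr_less_mono2[of q "1 / 2" 1] by auto
  then have h: "summable h"
    unfolding h_def by (intro summable_mult summable_geometric) auto
  have le: "\<nu> ((t *\<^sub>R x) ^ n /\<^sub>R fact n) \<le> h n" if t: "t \<in> {0..1}" for t n
  proof -
    have "\<nu> ((t *\<^sub>R x) ^ n /\<^sub>R fact n) = \<bar>t ^ n / fact n\<bar> powr q * \<nu> (x ^ n)"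
      using nu_scaleR[OF power_mem[OF assms], of "t ^ n / fact n" n]
      by (simp add: scaleR_power divide_inverse mult.commute)
    also have "\<dots> \<le> (1 / fact n) powr q * (C * (\<rho> ^ n) powr q)"
      using t q_bounds nu_nonneg[OF power_mem[OF assms, of n]]
      by (intro mult_mono C powr_mono2) (auto simp: power_le_one divide_right_mono)
    also have "\<dots> = C * (\<bar>1 / fact n\<bar> * (2 * \<rho>) ^ n) powr q * ((1 / 2) ^ n) powr q"
      using \<rho> by (simp add: power_mult_distrib power_divide powr_divide powr_mult)
    also have "\<dots> \<le> C * exp (2 * \<rho>) powr q * ((1 / 2) ^ n) powr q"
      using C(1) \<rho> q_bounds exp_coeff_bound[of "2 * \<rho>" n]
      by (intro mult_right_mono mult_left_mono powr_mono2) auto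
    also have "((1 / 2 :: real) ^ n) powr q = ((1 / 2) powr q) ^ n"
      by (simp add: powr_powr mult.commute flip: powr_realpow)
    finally show ?thesis by (simp add: h_def)
  qed
  have "\<nu> (exp (t *\<^sub>R x)) \<le> suminf h" if t: "t \<in> {0..1}" for t
  proof -
    have mem: "(t *\<^sub>R x) ^ n /\<^sub>R fact n \<in> \<A>" for n by (intro scaleR_mem power_mem assms)
    have s: "summable (\<lambda>n. \<nu> ((t *\<^sub>R x) ^ n /\<^sub>R fact n))"
      by (rule summable_comparison_test[OF _ h]) (use le[OF t] nu_nonneg[OF mem] in auto)
    have "\<nu> (exp (t *\<^sub>R x)) \<le> (\<Sum>n. \<nu> ((t *\<^sub>R x) ^ n /\<^sub>R fact n))"
      unfolding exp_def using suminf_mem[OF mem s] by blast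
    also have "\<dots> \<le> suminf h" by (intro suminf_le le t s h)
    finally show ?thesis .
  qed
  moreover have "0 \<le> suminf h" using C(1) by (intro suminf_nonneg h) (auto simp: h_def)
  ultimately show ?thesis by blast
qed

text \<open>Time is split into whole periods \<open>\<tau>\<close> and a remainder. Powers of
  \<open>exp (\<tau> *\<^sub>R x)\<close> decay in the algebra because the spectral radius there is
  governed by the operator norm, and the remainder is bounded uniformly by
  \<open>nu_exp_bounded\<close>.\<close>

lemma nu_exp_decay:
  assumes "x \<in> \<A>" "0 < \<tau>" "norm (exp (\<tau> *\<^sub>R x)) < 1"
  shows "\<exists>E>0. \<exists>\<alpha>>0. \<forall>t\<ge>0. \<nu> (exp (t *\<^sub>R x)) \<le> E * exp (- \<alpha> * t)"
proof -
  obtain K where K: "1 \<le> K" "\<And>S T. S \<in> \<A> \<Longrightarrow> T \<in> \<A> \<Longrightarrow> \<nu> (S * T) \<le> K * \<nu> S * \<nu> T"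
    using nu_mult by metis
  obtain \<rho> where \<rho>: "norm (exp (\<tau> *\<^sub>R x)) < \<rho>" "\<rho> < 1" using dense assms(3) by blast
  then have \<rho>0: "0 < \<rho>" by (metis norm_ge_zero order_le_less_trans)
  have mem: "exp (t *\<^sub>R x) \<in> \<A>" for t by (intro exp_mem scaleR_mem assms)
  obtain C where C: "0 \<le> C" "\<And>n. \<nu> (exp (\<tau> *\<^sub>R x) ^ n) \<le> C * (\<rho> ^ n) powr q"
    using nu_powers_bounded[OF mem \<rho>(1)] by blast
  obtain C' where C': "0 \<le> C'" "\<And>t. t \<in> {0..1} \<Longrightarrow> \<nu> (exp (t *\<^sub>R (\<tau> *\<^sub>R x))) \<le> C'"
    using nu_exp_bounded[OF scaleR_mem[OF assms(1)]] by metis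
  define \<alpha> where "\<alpha> = - q * ln \<rho> / \<tau>"
  have \<alpha>: "0 < \<alpha>" using \<rho> \<rho>0 q_bounds assms(2) by (simp add: \<alpha>_def divide_neg_pos mult_pos_neg)
  \<comment> \<open>The factor \<open>exp (\<alpha> * \<tau>)\<close> pays for the incomplete last
    period; the summand 1 only makes \<open>E\<close> positive.\<close>
  define E where "E = K * C * C' * exp (\<alpha> * \<tau>) + 1"
  have E: "0 < E" using K C(1) C'(1) by (simp add: E_def add_nonneg_pos)
  have "\<nu> (exp (t *\<^sub>R x)) \<le> E * exp (- \<alpha> * t)" if "0 \<le> t" for t
  proof -
    define n where "n = nat \<lfloor>t / \<tau>\<rfloor>"
    define s where "s = t / \<tau> - real n"
    have s: "s \<in> {0..1}" using that assms(2) unfolding s_def n_def by (auto; linarith)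
    have t: "t = real n * \<tau> + s * \<tau>" using assms(2) by (simp add: s_def field_simps)
    have "exp (t *\<^sub>R x) = exp (real n *\<^sub>R (\<tau> *\<^sub>R x) + s *\<^sub>R (\<tau> *\<^sub>R x))"
      by (simp add: t scaleR_add_left)
    also have "\<dots> = exp (\<tau> *\<^sub>R x) ^ n * exp (s *\<^sub>R (\<tau> *\<^sub>R x))"
      by (subst exp_add_commuting) (simp, simp only: exp_real_scaleR)
    also have "\<nu> \<dots> \<le> K * \<nu> (exp (\<tau> *\<^sub>R x) ^ n) * \<nu> (exp (s *\<^sub>R (\<tau> *\<^sub>R x)))"
      using mem[of "s * \<tau>"] by (intro K power_mem mem) auto
    also have "\<dots> \<le> K * (C * (\<rho> ^ n) powr q) * C'"
      using nu_nonneg[OF mem[of "s * \<tau>"]] nu_nonneg[OF power_mem[OF mem]] C(1) K(1)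
      by (intro mult_mono C C' s) auto
    also have "(\<rho> ^ n) powr q = exp (- \<alpha> * (real n * \<tau>))"
      using \<rho>0 assms(2) by (simp add: \<alpha>_def powr_def ln_realpow)
    also have "\<dots> \<le> exp (\<alpha> * \<tau>) * exp (- \<alpha> * t)"
      using s \<alpha> assms(2) by (simp add: t algebra_simps flip: exp_add)
    finally have "\<nu> (exp (t *\<^sub>R x)) \<le> K * (C * (exp (\<alpha> * \<tau>) * exp (- \<alpha> * t))) * C'"
      using K(1) C(1) C'(1) by (simp add: mult_left_mono mult_right_mono)
    also have "\<dots> \<le> E * exp (- \<alpha> * t)" by (simp add: E_def algebra_simps)
    finally show ?thesis .
  qed
  then show ?thesis using \<alpha> E by blast
qed

lemma binomial_series_mem:
  assumes "x \<in> \<A>" "norm x < 1" "-1 \<le> a" "a \<le> 1"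
  shows "binomial_series a x \<in> \<A>"
  unfolding binomial_series_def
  by (rule power_series_mem[where \<rho> = 1 and M = 1]) (use assms abs_gbinomial_le_1 in auto)

text \<open>
  The involution \<open>1 - 2 P\<close> equals \<open>s (s\<^sup>2) powr (-1/2)\<close> for any \<open>s\<close> near it that commutes with it.
\<close>

lemma idempotent_limit_mem:
  assumes p: "\<And>n :: nat. p n \<in> \<A>" and comm: "\<And>n. p n * P = P * p n"
    and idem: "P * P = P" and lim: "p \<longlonglongrightarrow> P"
  shows "P \<in> \<A>"
proof -
  define t where "t = 1 - 2 *\<^sub>R P"
  define s where "s n = 1 - 2 *\<^sub>R p n" for n
  define z where "z n = s n * s n - 1" for n
  have tt: "t * t = 1"
    by (simp add: t_def algebra_simps idem flip: scaleR_add_left)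
  have st: "s n * t = t * s n" for n by (simp add: s_def t_def algebra_simps comm)
  have s_lim: "s \<longlonglongrightarrow> t" unfolding s_def t_def by (intro tendsto_intros lim)
  have z_lim: "z \<longlonglongrightarrow> 0"
    using tendsto_diff[OF tendsto_mult[OF s_lim s_lim] tendsto_const[of 1]] by (simp add: z_def[abs_def] tt)
  \<comment> \<open>This sum bounds the distance from \<open>t\<close> to \<open>s n\<close> times
    the inverse square root of \<open>s n * s n\<close>. Below 2 the involution lemma applies;
    \<open>norm (z n) < 1 / 2\<close> is what the estimate of the square root series asks
    for.\<close>
  have "(\<lambda>n. norm (s n - t) + norm (s n) * (2 * norm (z n))) \<longlonglongrightarrow> norm (t - t) + norm t * (2 * norm (0 :: 'a endo))"
    by (intro tendsto_intros s_lim z_lim)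
  then have "eventually (\<lambda>n. norm (s n - t) + norm (s n) * (2 * norm (z n)) < 2) sequentially"
    by (rule order_tendstoD) simp
  moreover have "eventually (\<lambda>n. norm (z n) < 1 / 2) sequentially"
    using tendsto_norm[OF z_lim] by (rule order_tendstoD) simp
  ultimately have "eventually (\<lambda>n. norm (s n - t) + norm (s n) * (2 * norm (z n)) < 2 \<and> norm (z n) < 1 / 2) sequentially"
    by eventually_elim blast
  then obtain n where n: "norm (s n - t) + norm (s n) * (2 * norm (z n)) < 2" "norm (z n) < 1 / 2"
    using eventually_happens'[OF sequentially_bot] by blast
  define r where "r = binomial_series (-1/2) (z n)"
  have sum: "summable (\<lambda>k. norm (((-1/2) gchoose k) *\<^sub>R z n ^ k))"
    by (rule summable_norm_binomial_series) (use n in auto)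
  have rs: "s n * r = r * s n"
    unfolding r_def by (rule binomial_series_commute[OF sum]) (simp add: z_def algebra_simps)
  have zt: "t * z n = z n * t"
    unfolding z_def using st[of n] by (simp add: algebra_simps) (metis mult.assoc)
  have rt: "t * r = r * t"
    unfolding r_def by (rule binomial_series_commute[OF sum zt])
  have rr: "s n * s n * (r * r) = 1"
    using binomial_series_inverse_sqrt[of "z n"] n by (simp add: r_def z_def)
  have "s n * r = t"
  proof (rule commuting_involutions_eq[OF _ tt])
    show "s n * r * (s n * r) = 1" using rr rs by (metis mult.assoc)
    show "s n * r * t = t * (s n * r)" using rt st[of n] by (metis mult.assoc)
    have "norm (s n * r - t) = norm ((s n - t) + s n * (r - 1))" by (simp add: algebra_simps)
    also have "\<dots> \<le> norm (s n - t) + norm (s n) * norm (r - 1)"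
      by (intro order_trans[OF norm_triangle_ineq] add_left_mono norm_mult_ineq)
    also have "\<dots> \<le> norm (s n - t) + norm (s n) * (2 * norm (z n))"
      unfolding r_def by (intro add_left_mono mult_left_mono norm_binomial_series_minus_1) (use n in auto)
    finally show "norm (s n * r - t) < 2" using n by simp
  qed
  moreover have "s n \<in> \<A>" unfolding s_def by (intro diff_mem one_mem scaleR_mem p)
  moreover from this have "z n \<in> \<A>" unfolding z_def by (intro diff_mem one_mem mult_mem)
  then have "r \<in> \<A>" unfolding r_def by (rule binomial_series_mem) (use n in auto)
  ultimately have "t \<in> \<A>" using mult_mem by blast
  then have "(1 / 2) *\<^sub>R (1 - t) \<in> \<A>" by (intro scaleR_mem diff_mem one_mem)
  then show ?thesis by (simp add: t_def)
qed

lemma zero_mem: "0 \<in> \<A>"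
  using scaleR_mem[OF one_mem, of 0] by simp

lemma nu_zero: "\<nu> 0 = 0"
  using nu_scaleR[OF one_mem, of 0] by simp

text \<open>Subadditivity is the countable bound \<open>suminf_mem\<close> for the series
  \<open>S, T, 0, 0, ...\<close>, which is why it is not a separate axiom of the locale.\<close>

lemma nu_add:
  assumes "S \<in> \<A>" "T \<in> \<A>"
  shows "\<nu> (S + T) \<le> \<nu> S + \<nu> T"
proof -
  define f where "f n = (if n = 0 then S else if n = 1 then T else 0)" for n :: nat
  have "f n \<in> \<A>" for n using assms zero_mem by (simp add: f_def)
  moreover have "(\<lambda>n. \<nu> (f n)) sums (\<Sum>n\<in>{0, 1}. \<nu> (f n))"
    by (rule sums_finite) (auto simp: f_def nu_zero)
  moreover have "f sums (\<Sum>n\<in>{0, 1}. f n)" by (rule sums_finite) (auto simp: f_def)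
  ultimately show ?thesis
    using suminf_mem[of f] by (auto simp: sums_iff f_def)
qed

lemma summable_norm_if_summable_nu:
  assumes "\<And>n :: nat. f n \<in> \<A>" "summable (\<lambda>n. \<nu> (f n))"
  shows "summable (\<lambda>n. norm (f n))"
proof (rule summable_if_summable_powr[OF _ q_bounds])
  show "summable (\<lambda>n. norm (f n) powr q)"
    by (rule summable_comparison_test'[OF assms(2)]) (simp add: norm_powr_le assms(1))
qed simp

end

section \<open>Two by two matrices over the algebra\<close>

instance prod :: (perfect_space, perfect_space) perfect_space
proof
  fix x :: "'a \<times> 'b"
  show "\<not> open {x}"
    using open_image_fst[of "{x}"] not_open_singleton[of "fst x"] by auto
qed

text \<open>Blocks are indexed by \<open>bool\<close>, with \<open>True\<close> for the first
  component, so that block sums are sums over \<open>UNIV\<close>.\<close>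

definition proj_comp :: "bool \<Rightarrow> 'a \<times> 'a \<Rightarrow> 'a" where
  "proj_comp i z = (if i then fst z else snd z)"

definition inj_comp :: "bool \<Rightarrow> 'a::zero \<Rightarrow> 'a \<times> 'a" where
  "inj_comp j x = (if j then (x, 0) else (0, x))"

definition entry :: "bool \<Rightarrow> bool \<Rightarrow> ('a::real_normed_vector \<times> 'a) endo \<Rightarrow> 'a endo" where
  "entry i j T = mk_endo (\<lambda>x. proj_comp i (ap T (inj_comp j x)))"

definition mat_endo :: "(bool \<Rightarrow> bool \<Rightarrow> 'a::real_normed_vector endo) \<Rightarrow> ('a \<times> 'a) endo" where
  "mat_endo f = mk_endo (\<lambda>z. (ap (f True True) (fst z) + ap (f True False) (snd z),
    ap (f False True) (fst z) + ap (f False False) (snd z)))"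

lemma bounded_linear_proj_comp: "bounded_linear (proj_comp i :: 'a::real_normed_vector \<times> 'a \<Rightarrow> 'a)"
  unfolding proj_comp_def by (cases i) (simp_all add: bounded_linear_fst bounded_linear_snd)

lemma bounded_linear_inj_comp: "bounded_linear (inj_comp j :: 'a::real_normed_vector \<Rightarrow> 'a \<times> 'a)"
  unfolding inj_comp_def
  by (cases j) (auto intro!: bounded_linear_Pair bounded_linear_zero bounded_linear_ident)

lemma norm_inj_comp [simp]: "norm (inj_comp j x) = norm (x :: 'a::real_normed_vector)"
  by (simp add: inj_comp_def norm_prod_def)

lemma norm_proj_comp_le: "norm (proj_comp i z) \<le> norm (z :: 'a::real_normed_vector \<times> 'a)"
  using norm_fst_le[of "fst z" "snd z"] norm_snd_le[of "snd z" "fst z"] by (simp add: proj_comp_def)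

lemma ap_entry: "ap (entry i j T) x = proj_comp i (ap T (inj_comp j x))"
proof -
  have "bounded_linear (\<lambda>x. proj_comp i (ap T (inj_comp j x)))"
    by (intro bounded_linear_compose[OF bounded_linear_proj_comp]
        bounded_linear_compose[OF ap.bounded_linear_right] bounded_linear_inj_comp)
  then show ?thesis by (simp add: entry_def ap_mk_endo)
qed

lemma ap_mat_endo: "ap (mat_endo f) z = (ap (f True True) (fst z) + ap (f True False) (snd z),
    ap (f False True) (fst z) + ap (f False False) (snd z))"
proof -
  have "bounded_linear (\<lambda>z. (ap (f True True) (fst z) + ap (f True False) (snd z),
    ap (f False True) (fst z) + ap (f False False) (snd z)))"
    by (intro bounded_linear_Pair bounded_linear_add
        bounded_linear_compose[OF ap.bounded_linear_right] bounded_linear_fst bounded_linear_snd)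
  then show ?thesis by (simp add: mat_endo_def ap_mk_endo)
qed

lemma entry_mat_endo [simp]: "entry i j (mat_endo f) = f i j"
  by (rule endo_eqI) (simp add: ap_entry ap_mat_endo proj_comp_def inj_comp_def)

lemma mat_endo_entry [simp]: "mat_endo (\<lambda>i j. entry i j T) = T"
proof (rule endo_eqI)
  fix z :: "'a \<times> 'a"
  have "ap T z = ap T ((fst z, 0) + (0, snd z))" by (simp del: ap_simps)
  also have "\<dots> = ap T (fst z, 0) + ap T (0, snd z)" by (rule ap.add_right)
  finally show "ap (mat_endo (\<lambda>i j. entry i j T)) z = ap T z"
    by (simp only: ap_mat_endo ap_entry proj_comp_def inj_comp_def if_True if_False plus_prod_def)
qed

lemma endo_prod_eqI:
  assumes "\<And>i j. entry i j S = entry i j T"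
  shows "S = T"
proof -
  have "mat_endo (\<lambda>i j. entry i j S) = mat_endo (\<lambda>i j. entry i j T)" by (simp only: assms)
  then show ?thesis by simp
qed

lemma norm_entry_le: "norm (entry i j T) \<le> norm T"
proof (rule norm_endo_bound)
  show "norm (ap (entry i j T) x) \<le> norm T * norm x" for x
    using order_trans[OF norm_proj_comp_le norm_ap[of T "inj_comp j x"]] by (simp add: ap_entry)
qed simp

lemma bounded_linear_entry: "bounded_linear (entry i j)"
proof (rule bounded_linear_intro)
  show "entry i j (S + T) = entry i j S + entry i j T" for S T :: "('a \<times> 'a) endo"
    by (rule endo_eqI) (simp add: ap_entry proj_comp_def)
  show "entry i j (r *\<^sub>R T) = r *\<^sub>R entry i j T" for r and T :: "('a \<times> 'a) endo"
    by (rule endo_eqI) (simp add: ap_entry proj_comp_def)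
  show "norm (entry i j T) \<le> norm T * 1" for T :: "('a \<times> 'a) endo"
    using norm_entry_le by simp
qed

lemmas entry_simps [simp] =
  bounded_linear.linear[OF bounded_linear_entry, THEN linear_add]
  bounded_linear.linear[OF bounded_linear_entry, THEN linear_diff]
  bounded_linear.linear[OF bounded_linear_entry, THEN linear_cmul]

lemma entry_one [simp]: "entry i j (1 :: ('a::{real_normed_vector, perfect_space} \<times> 'a) endo) = (if i = j then 1 else 0)"
  by (rule endo_eqI) (auto simp: ap_entry proj_comp_def inj_comp_def)

lemma entry_mult: "entry i j (S * T) = entry i True S * entry True j T + entry i False S * entry False j T"
proof (rule endo_eqI)
  fix x
  have d: "z = inj_comp True (proj_comp True z) + inj_comp False (proj_comp False z)" for z :: "'a \<times> 'a"
    by (simp add: inj_comp_def proj_comp_def)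
  show "ap (entry i j (S * T)) x = ap (entry i True S * entry True j T + entry i False S * entry False j T) x"
    using arg_cong[OF d[of "ap T (inj_comp j x)"], of "\<lambda>z. proj_comp i (ap S z)"]
    by (simp add: ap_entry) (simp add: proj_comp_def)
qed

lemma norm_le_entries: "norm T \<le> (\<Sum>i\<in>UNIV. \<Sum>j\<in>UNIV. norm (entry i j T))"
proof (rule norm_endo_bound)
  fix z :: "'a \<times> 'a"
  have fs: "norm (fst z) \<le> norm z" "norm (snd z) \<le> norm z"
    using norm_fst_le[of "fst z" "snd z"] norm_snd_le[of "snd z" "fst z"] by simp_all
  have le: "norm (ap (entry i True T) (fst z) + ap (entry i False T) (snd z)) \<le>
      (norm (entry i True T) + norm (entry i False T)) * norm z" for i
    unfolding distrib_right
    by (intro order_trans[OF norm_triangle_ineq] add_mono order_trans[OF norm_ap] mult_left_mono fs) auto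
  have "norm (ap T z) = norm (ap (mat_endo (\<lambda>i j. entry i j T)) z)" by simp
  also have "\<dots> \<le> norm (ap (entry True True T) (fst z) + ap (entry True False T) (snd z)) +
     norm (ap (entry False True T) (fst z) + ap (entry False False T) (snd z))"
    unfolding ap_mat_endo norm_Pair by (rule sqrt_sum_squares_le_sum) auto
  also have "\<dots> \<le> (\<Sum>i\<in>UNIV. \<Sum>j\<in>UNIV. norm (entry i j T)) * norm z"
    using le[of True] le[of False] by (simp add: UNIV_bool algebra_simps)
  finally show "norm (ap T z) \<le> (\<Sum>i\<in>UNIV. \<Sum>j\<in>UNIV. norm (entry i j T)) * norm z" .
qed (intro sum_nonneg norm_ge_zero)

lemma is_adj_mat_endo:
  assumes "\<And>i j. is_adj (f i j) (g j i)"
  shows "is_adj (mat_endo f) (mat_endo g)"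
  unfolding is_adj_def ap_mat_endo
  using is_adjD[OF assms] by (auto simp: inner_prod_def inner_add_left inner_add_right)

text \<open>On [0, 1] every \<open>u\<close> is at most \<open>u powr q\<close>; apply this to the
  two shares \<open>a / (a + b)\<close> and \<open>b / (a + b)\<close>, which add up to 1.\<close>

lemma powr_add_le:
  fixes a b q :: real
  assumes "0 \<le> a" "0 \<le> b" "0 < q" "q \<le> 1"
  shows "(a + b) powr q \<le> a powr q + b powr q"
proof (cases "a + b = 0")
  case False
  then have s: "a + b > 0" using assms by simp
  have "a / (a + b) \<le> (a / (a + b)) powr q" "b / (a + b) \<le> (b / (a + b)) powr q"
    using assms s powr_mono'[of q 1 "a / (a + b)"] powr_mono'[of q 1 "b / (a + b)"] by auto
  then have "1 \<le> (a / (a + b)) powr q + (b / (a + b)) powr q"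
    using s by (metis add_divide_distrib add_mono div_self False)
  also have "\<dots> = (a powr q + b powr q) / (a + b) powr q"
    using assms s by (simp add: powr_divide add_divide_distrib)
  finally show ?thesis using s by (simp add: field_simps)
qed (use assms in auto)

section \<open>Matrices over a differential algebra form a differential algebra\<close>

context diff_algebra
begin

definition mat_alg :: "('a \<times> 'a) endo set" where
  "mat_alg = {T. \<forall>i j. entry i j T \<in> \<A>}"

definition mat_nu :: "('a \<times> 'a) endo \<Rightarrow> real" where
  "mat_nu T = (\<Sum>i\<in>UNIV. \<Sum>j\<in>UNIV. \<nu> (entry i j T))"

lemma mat_algD: "T \<in> mat_alg \<Longrightarrow> entry i j T \<in> \<A>"
  by (simp add: mat_alg_def)

lemma nu_entry_le: "T \<in> mat_alg \<Longrightarrow> \<nu> (entry i j T) \<le> mat_nu T"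
  unfolding mat_nu_def UNIV_bool
  using nu_nonneg[OF mat_algD[of T True True]] nu_nonneg[OF mat_algD[of T True False]]
    nu_nonneg[OF mat_algD[of T False True]] nu_nonneg[OF mat_algD[of T False False]]
  by (cases i; cases j) auto

lemma mat_nu_le:
  assumes "\<And>i j. \<nu> (entry i j T) \<le> c"
  shows "mat_nu T \<le> 4 * c"
  using assms[of True True] assms[of True False] assms[of False True] assms[of False False]
  by (simp add: mat_nu_def UNIV_bool)

text \<open>The 8 counts four entries, each a sum of two products.\<close>

lemma mat_nu_mult_le:
  assumes "S \<in> mat_alg" "T \<in> mat_alg" "\<And>i j k. \<nu> (entry i k S * entry k j T) \<le> c"
  shows "mat_nu (S * T) \<le> 8 * c"
proof -
  have "\<nu> (entry i j (S * T)) \<le> 2 * c" for i j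
    using nu_add[of "entry i True S * entry True j T" "entry i False S * entry False j T"]
      assms(3)[of i True j] assms(3)[of i False j] assms(1,2)
    by (simp add: entry_mult mat_algD mult_mem)
  from mat_nu_le[of "S * T", OF this] show ?thesis by simp
qed

text \<open>Bounds \<open>s\<close> and \<open>b\<close> for a matrix are also bounds for each of
  its entries, so the differential inequality can be applied product by product with the same
  \<open>s\<close> and \<open>b\<close>. An inequality in the ratios of the two norms would not pass
  to entries in this way.\<close>

lemma diff_algebra_mat: "diff_algebra mat_alg mat_nu q"
proof
  show "0 < q" "q \<le> 1" by (fact q_bounds)+
  show "1 \<in> mat_alg" by (simp add: mat_alg_def one_mem zero_mem)
  fix S T :: "('a \<times> 'a) endo" and r :: real
  assume T: "T \<in> mat_alg"
  show "r *\<^sub>R T \<in> mat_alg" using T by (simp add: mat_alg_def scaleR_mem)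
  show "0 \<le> mat_nu T" unfolding mat_nu_def by (intro sum_nonneg nu_nonneg mat_algD T)
  show "mat_nu (r *\<^sub>R T) = \<bar>r\<bar> powr q * mat_nu T"
    by (simp add: mat_nu_def nu_scaleR mat_algD T sum_distrib_left)
  show "norm T powr q \<le> mat_nu T"
  proof -
    have "norm T powr q \<le> (norm (entry True True T) + norm (entry True False T) +
        (norm (entry False True T) + norm (entry False False T))) powr q"
      using norm_le_entries[of T] q_bounds by (intro powr_mono2) (auto simp: UNIV_bool algebra_simps)
    also have "\<dots> \<le> norm (entry True True T) powr q + norm (entry True False T) powr q +
        (norm (entry False True T) powr q + norm (entry False False T) powr q)"
      by (intro order_trans[OF powr_add_le] add_mono powr_add_le q_bounds) auto
    also have "\<dots> \<le> \<nu> (entry True True T) + \<nu> (entry True False T) +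
        (\<nu> (entry False True T) + \<nu> (entry False False T))"
      by (intro add_mono norm_powr_le mat_algD T)
    finally show ?thesis by (simp add: mat_nu_def UNIV_bool)
  qed
  define g where "g i j = (SOME S. S \<in> \<A> \<and> is_adj (entry i j T) S)" for i j
  have g: "g i j \<in> \<A>" "is_adj (entry i j T) (g i j)" for i j
    using someI_ex[of "\<lambda>S. S \<in> \<A> \<and> is_adj (entry i j T) S"] adj_ex[OF mat_algD[OF T, of i j]]
    unfolding g_def by blast+
  have "is_adj (mat_endo (\<lambda>i j. entry i j T)) (mat_endo (\<lambda>i j. g j i))"
    by (rule is_adj_mat_endo) (rule g)
  moreover have "mat_endo (\<lambda>i j. g j i) \<in> mat_alg" by (simp add: mat_alg_def g)
  ultimately show "\<exists>S\<in>mat_alg. is_adj T S" by auto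
  assume S: "S \<in> mat_alg"
  show "S + T \<in> mat_alg" using S T by (simp add: mat_alg_def add_mem)
  show "S * T \<in> mat_alg" using S T by (simp add: mat_alg_def entry_mult add_mem mult_mem)
next
  obtain K where K: "1 \<le> K" "\<And>S T. S \<in> \<A> \<Longrightarrow> T \<in> \<A> \<Longrightarrow> \<nu> (S * T) \<le> K * \<nu> S * \<nu> T"
    using nu_mult by metis
  have "mat_nu (S * T) \<le> (8 * K) * mat_nu S * mat_nu T" if S: "S \<in> mat_alg" and T: "T \<in> mat_alg" for S T
  proof -
    have "\<nu> (entry i k S * entry k j T) \<le> K * mat_nu S * mat_nu T" for i j k
    proof -
      have "\<nu> (entry i k S * entry k j T) \<le> K * \<nu> (entry i k S) * \<nu> (entry k j T)"
        by (intro K mat_algD S T)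
      also have "\<dots> \<le> K * mat_nu S * mat_nu T"
        using K(1) nu_nonneg[OF mat_algD[OF S]] nu_nonneg[OF mat_algD[OF T]]
          order_trans[OF nu_nonneg[OF mat_algD[OF S]] nu_entry_le[OF S]]
        by (intro mult_mono nu_entry_le S T) auto
      finally show ?thesis .
    qed
    from mat_nu_mult_le[OF S T this] show ?thesis by simp
  qed
  then show "\<exists>K\<ge>1. \<forall>S\<in>mat_alg. \<forall>T\<in>mat_alg. mat_nu (S * T) \<le> K * mat_nu S * mat_nu T"
    using K(1) by (intro exI[of _ "8 * K"]) auto
next
  obtain \<theta> D where D: "0 < \<theta>" "\<theta> \<le> 1" "1 \<le> D" and diff: "\<And>S T s b. S \<in> \<A> \<Longrightarrow> T \<in> \<A> \<Longrightarrow> \<nu> S \<le> s \<Longrightarrow>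
      \<nu> T \<le> s \<Longrightarrow> norm S \<le> b \<Longrightarrow> norm T \<le> b \<Longrightarrow> \<nu> (S * T) \<le> D * s powr (2 - \<theta>) * b powr (q * \<theta>)"
    using nu_differential by metis
  have "mat_nu (S * T) \<le> (8 * D) * s powr (2 - \<theta>) * b powr (q * \<theta>)"
    if S: "S \<in> mat_alg" and T: "T \<in> mat_alg" and s: "mat_nu S \<le> s" "mat_nu T \<le> s"
      and b: "norm S \<le> b" "norm T \<le> b" for S T s b
  proof -
    have "\<nu> (entry i k S * entry k j T) \<le> D * s powr (2 - \<theta>) * b powr (q * \<theta>)" for i j k
      by (intro diff mat_algD S T order_trans[OF nu_entry_le] s order_trans[OF norm_entry_le] b)
    from mat_nu_mult_le[OF S T this] show ?thesis by simp
  qed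
  then show "\<exists>\<theta> D. 0 < \<theta> \<and> \<theta> \<le> 1 \<and> 1 \<le> D \<and>
      (\<forall>S\<in>mat_alg. \<forall>T\<in>mat_alg. \<forall>s b. mat_nu S \<le> s \<longrightarrow> mat_nu T \<le> s \<longrightarrow> norm S \<le> b \<longrightarrow> norm T \<le> b \<longrightarrow>
        mat_nu (S * T) \<le> D * s powr (2 - \<theta>) * b powr (q * \<theta>))"
    using D by (intro exI[of _ \<theta>] exI[of _ "8 * D"]) auto
next
  fix f :: "nat \<Rightarrow> ('a \<times> 'a) endo"
  assume f: "\<And>n. f n \<in> mat_alg" and sum: "summable (\<lambda>n. mat_nu (f n))"
  have s: "summable (\<lambda>n. \<nu> (entry i j (f n)))" for i j
    by (rule summable_comparison_test'[OF sum]) (use nu_entry_le[OF f] nu_nonneg[OF mat_algD[OF f]] in auto)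
  have n: "summable (\<lambda>n. norm (entry i j (f n)))" for i j
    by (rule summable_norm_if_summable_nu) (intro mat_algD f s)+
  have "summable (\<lambda>n. norm (f n))"
  proof (rule summable_comparison_test')
    show "summable (\<lambda>n. \<Sum>i\<in>UNIV. \<Sum>j\<in>UNIV. norm (entry i j (f n)))" by (intro summable_sum n)
    show "norm (norm (f n)) \<le> (\<Sum>i\<in>UNIV. \<Sum>j\<in>UNIV. norm (entry i j (f n)))" for n
      using norm_le_entries by simp
  qed
  then have e: "entry i j (suminf f) = (\<Sum>n. entry i j (f n))" for i j
    by (rule bounded_linear.suminf[OF bounded_linear_entry summable_norm_cancel])
  have m: "(\<Sum>n. entry i j (f n)) \<in> \<A> \<and> \<nu> (\<Sum>n. entry i j (f n)) \<le> (\<Sum>n. \<nu> (entry i j (f n)))" for i j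
    by (intro suminf_mem mat_algD f s)
  have "mat_nu (suminf f) \<le> (\<Sum>i\<in>UNIV. \<Sum>j\<in>UNIV. \<Sum>n. \<nu> (entry i j (f n)))"
    unfolding mat_nu_def e by (intro sum_mono m[THEN conjunct2])
  also have "\<dots> = (\<Sum>n. mat_nu (f n))"
    unfolding mat_nu_def by (simp add: suminf_sum s summable_sum)
  finally show "suminf f \<in> mat_alg \<and> mat_nu (suminf f) \<le> (\<Sum>n. mat_nu (f n))"
    using m by (simp add: mat_alg_def e)
qed

end

section \<open>Block calculus and exponentials under conjugation\<close>

definition blk :: "'a::real_normed_vector endo \<Rightarrow> 'a endo \<Rightarrow> 'a endo \<Rightarrow> 'a endo \<Rightarrow> ('a \<times> 'a) endo" where
  "blk a b c d = mat_endo (\<lambda>i j. if i then if j then a else b else if j then c else d)"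

lemma entry_blk [simp]:
  "entry True True (blk a b c d) = a" "entry True False (blk a b c d) = b"
  "entry False True (blk a b c d) = c" "entry False False (blk a b c d) = d"
  by (simp_all add: blk_def)

lemma blk_eqI:
  "entry True True S = entry True True T \<Longrightarrow> entry True False S = entry True False T \<Longrightarrow>
   entry False True S = entry False True T \<Longrightarrow> entry False False S = entry False False T \<Longrightarrow> S = T"
  by (rule endo_prod_eqI) (rename_tac i j, case_tac i; case_tac j; simp)

lemma blk_mult:
  "blk a b c d * blk a' b' c' d' = blk (a * a' + b * c') (a * b' + b * d') (c * a' + d * c') (c * b' + d * d')"
  by (rule blk_eqI) (simp_all add: entry_mult)

lemma blk_add: "blk a b c d + blk a' b' c' d' = blk (a + a') (b + b') (c + c') (d + d')"
  by (rule blk_eqI) simp_all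

lemma blk_diff: "blk a b c d - blk a' b' c' d' = blk (a - a') (b - b') (c - c') (d - d')"
  by (rule blk_eqI) simp_all

lemma blk_scaleR: "r *\<^sub>R blk a b c d = blk (r *\<^sub>R a) (r *\<^sub>R b) (r *\<^sub>R c) (r *\<^sub>R d)"
  by (rule blk_eqI) simp_all

lemma blk_one: "(1 :: ('a::{real_normed_vector, perfect_space} \<times> 'a) endo) = blk 1 0 0 1"
  by (rule blk_eqI) simp_all

lemma norm_blk_diag_le: "norm (blk a 0 0 d) \<le> norm a + norm d"
  using norm_le_entries[of "blk a 0 0 d"] by (simp add: UNIV_bool)

lemma blk_diag_power:
  fixes a d :: "'a::{real_normed_vector, perfect_space} endo"
  shows "blk a 0 0 d ^ n = blk (a ^ n) 0 0 (d ^ n)"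
  by (induction n) (simp_all add: blk_one blk_mult)

lemma exp_blk_diag:
  fixes a d :: "'a::{banach, perfect_space} endo"
  shows "exp (blk a 0 0 d) = blk (exp a) 0 0 (exp d)"
proof -
  have e: "(\<lambda>n. entry i j (blk a 0 0 d ^ n /\<^sub>R fact n)) sums entry i j (exp (blk a 0 0 d))" for i j
    by (intro bounded_linear.sums[OF bounded_linear_entry] exp_converges)
  show ?thesis
  proof (rule blk_eqI)
    show "entry True True (exp (blk a 0 0 d)) = entry True True (blk (exp a) 0 0 (exp d))"
      using e[of True True] exp_converges[of a] by (simp add: blk_diag_power sums_unique2)
    show "entry False False (exp (blk a 0 0 d)) = entry False False (blk (exp a) 0 0 (exp d))"
      using e[of False False] exp_converges[of d] by (simp add: blk_diag_power sums_unique2)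
    show "entry True False (exp (blk a 0 0 d)) = entry True False (blk (exp a) 0 0 (exp d))"
      using e[of True False] by (simp add: blk_diag_power sums_iff)
    show "entry False True (exp (blk a 0 0 d)) = entry False True (blk (exp a) 0 0 (exp d))"
      using e[of False True] by (simp add: blk_diag_power sums_iff)
  qed
qed

lemma conjugate_power:
  fixes S T x :: "'a::monoid_mult"
  assumes "S * T = 1" "T * S = 1"
  shows "(S * x * T) ^ n = S * x ^ n * T"
proof (induction n)
  case (Suc n)
  have "(S * x * T) ^ Suc n = S * x * T * (S * x ^ n * T)"
    by (simp only: power_Suc Suc)
  also have "\<dots> = S * x * (T * S) * x ^ n * T" by (simp only: mult.assoc)
  finally show ?case by (simp add: assms mult.assoc)
qed (simp add: assms)

lemma exp_conjugate:
  fixes S T x :: "'a::{real_normed_algebra_1, banach}"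
  assumes "S * T = 1" "T * S = 1"
  shows "exp (S * x * T) = S * exp x * T"
proof -
  have "(\<lambda>n. S * (x ^ n /\<^sub>R fact n) * T) sums (S * exp x * T)"
    by (intro sums_mult sums_mult2 exp_converges)
  moreover have "(\<lambda>n. S * (x ^ n /\<^sub>R fact n) * T) = (\<lambda>n. (S * x * T) ^ n /\<^sub>R fact n)"
    by (simp add: conjugate_power[OF assms])
  ultimately show ?thesis using exp_converges[of "S * x * T"] by (simp add: sums_unique2)
qed

section \<open>Spectral projection of the Hamiltonian\<close>

lemma one_plus_inverses:
  fixes a :: "nat \<Rightarrow> 'a::{real_normed_algebra_1, banach}"
  assumes "\<And>n. norm (a n) < 1" "a \<longlonglongrightarrow> 0"
  obtains y where "\<And>n. (1 + a n) * y n = 1" "\<And>n. y n * (1 + a n) = 1" "y \<longlonglongrightarrow> 1"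
proof
  let ?y = "\<lambda>n. (\<Sum>k. (- a n) ^ k)"
  show 1: "(1 + a n) * ?y n = 1" "?y n * (1 + a n) = 1" for n
    using neumann_series[of "- a n"] assms by simp_all
  have "norm (?y n - 1) \<le> norm (a n) * (1 / (1 - norm (a n)))" for n
  proof -
    have "?y n - 1 = - (a n * ?y n)" using 1(1)[of n] by (simp add: algebra_simps)
    then have "norm (?y n - 1) = norm (a n * ?y n)" by simp
    also have "\<dots> \<le> norm (a n) * norm (?y n)" by (rule norm_mult_ineq)
    also have "\<dots> \<le> norm (a n) * (1 / (1 - norm (a n)))"
      using neumann_series(3)[of "- a n"] assms by (intro mult_left_mono) auto
    finally show ?thesis .
  qed
  moreover have "(\<lambda>n. norm (a n) * (1 / (1 - norm (a n)))) \<longlonglongrightarrow> 0 * (1 / (1 - 0))"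
    by (intro tendsto_intros tendsto_norm_zero assms) auto
  ultimately have "(\<lambda>n. ?y n - 1) \<longlonglongrightarrow> 0"
    by (intro Lim_null_comparison[where f = "\<lambda>n. ?y n - 1"]) (auto intro: always_eventually)
  then show "?y \<longlonglongrightarrow> 1" by (rule LIM_zero_cancel)
qed

text \<open>The exponents start at 1 because \<open>x ^ 0 = 1\<close> does not have norm below 1;
  \<open>one_plus_inverses\<close> needs that bound for every index.\<close>

lemma power_tendsto_0:
  fixes x :: "'a::real_normed_algebra_1"
  assumes "norm x < 1"
  shows "(\<lambda>n. x ^ Suc n) \<longlonglongrightarrow> 0"
  using LIMSEQ_power_zero[OF assms] by (rule LIMSEQ_Suc)

lemma norm_power_less_1:
  fixes x :: "'a::real_normed_algebra_1"
  assumes "norm x < 1"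
  shows "norm (x ^ Suc n) < 1"
proof -
  have "norm (x ^ Suc n) \<le> norm x ^ Suc n" by (rule norm_power_ineq)
  also have "\<dots> \<le> norm x" using assms by (intro power_Suc_le_self) auto
  also note assms
  finally show ?thesis .
qed

context diff_algebra
begin

text \<open>
  The columns of \<open>T\<close> span the invariant subspaces that \<open>X\<close> and \<open>Y\<close> provide for the Hamiltonian
  \<open>H\<close>; the dynamics on the second one is similar to \<open>- F\<^sup>*\<close>, hence unstable.
\<close>

lemma riccati_solution_mem:
  fixes A A' S Q X Y Z :: "'a endo"
  assumes mem: "A \<in> \<A>" "S \<in> \<A>" "Q \<in> \<A>"
    and adj: "is_adj A A'" "is_adj S S" "is_adj X X"
    and riccati: "A' * X + X * A - X * S * X + Q = 0"
    and dual: "A * Y + Y * A' - Y * Q * Y + S = 0"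
    and inv: "(1 + Y * X) * Z = 1" "Z * (1 + Y * X) = 1"
    and stable: "0 < \<tau>" "norm (exp (\<tau> *\<^sub>R (A - S * X))) < 1"
  shows "X \<in> \<A>"
proof -
  interpret M: diff_algebra mat_alg mat_nu q by (rule diff_algebra_mat)
  have A': "A' \<in> \<A>" using adj_mem adj(1) mem(1) by blast
  define F where "F = A - S * X"
  define F' where "F' = A' - X * S"
  define N where "N = Q * Y - A'"
  define V where "V = 1 + X * Y"
  \<comment> \<open>The inverse of \<open>1 + X * Y\<close>, obtained from the inverse
    \<open>Z\<close> of \<open>1 + Y * X\<close>.\<close>
  define V' where "V' = 1 - X * Z * Y"
  have YXZ: "Y * (X * Z) = 1 - Z" using inv(1) by (simp add: algebra_simps)
  have ZYX: "Z * (Y * X) = 1 - Z" using inv(2) by (simp add: algebra_simps)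
  have YXZ': "Y * (X * (Z * u)) = u - Z * u" for u
    using arg_cong[OF YXZ, of "\<lambda>w. w * u"] by (simp add: algebra_simps)
  have ZYX': "Z * (Y * (X * u)) = u - Z * u" for u
    using arg_cong[OF ZYX, of "\<lambda>w. w * u"] by (simp add: algebra_simps)
  have VV': "V * V' = 1" "V' * V = 1"
    by (simp_all add: V_def V'_def algebra_simps YXZ YXZ' ZYX ZYX')
  have q: "Q = X * S * X - A' * X - X * A"
    using riccati by (simp add: algebra_simps eq_neg_iff_add_eq_0)
  have yqy: "Y * Q * Y = A * Y + Y * A' + S"
    using dual by (simp add: algebra_simps eq_neg_iff_add_eq_0)
  \<comment> \<open>Both equations enter: the dual one replaces \<open>Y * Q * Y\<close>, the primal
    one the remaining \<open>Q\<close>. The outcome is that the second diagonal block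
    \<open>N\<close> is similar to \<open>- F'\<close>.\<close>
  have "V * N = - F' * V"
  proof -
    have "V * N = Q * Y - A' + X * (Y * Q * Y) - X * Y * A'"
      by (simp add: V_def N_def algebra_simps)
    also have "\<dots> = Q * Y - A' + X * (A * Y + Y * A' + S) - X * Y * A'" by (simp only: yqy)
    also have "Q * Y = X * S * X * Y - A' * X * Y - X * A * Y" by (simp add: q algebra_simps)
    also have "X * S * X * Y - A' * X * Y - X * A * Y - A' + X * (A * Y + Y * A' + S) - X * Y * A' = - F' * V"
      by (simp add: V_def F'_def algebra_simps)
    finally show ?thesis .
  qed
  then have N: "N = V' * (- F') * V"
    using VV' by (metis mult.assoc mult_1)
  define H where "H = blk A (- S) (- Q) (- A')"
  define T where "T = blk 1 (- Y) X 1"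
  define T' where "T' = blk Z (Z * Y) (- (X * Z)) (1 - X * Z * Y)"
  have TT': "T * T' = 1" "T' * T = 1"
    unfolding T_def T'_def blk_mult blk_one
    by (simp_all add: algebra_simps YXZ YXZ' ZYX ZYX')
  have HT: "H * T = T * blk F 0 0 N"
  proof -
    have "- Q - A' * X = X * A - X * (S * X)" by (simp add: q algebra_simps)
    then show ?thesis
      unfolding H_def T_def blk_mult using yqy by (simp add: F_def N_def algebra_simps)
  qed
  have H: "H = T * blk F 0 0 N * T'"
    using HT TT' by (metis mult.assoc mult_1_right)
  have Hmem: "H \<in> mat_alg"
    unfolding mat_alg_def H_def using mem A' by (auto simp: all_bool_eq minus_mem)
  \<comment> \<open>\<open>F\<close> and \<open>F'\<close> are adjoint to each other, so
    \<open>b\<close> is a contraction together with \<open>a\<close>. The second block of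
    \<open>exp (\<tau> *\<^sub>R H)\<close> is similar to \<open>b'\<close>, the inverse of the
    contraction \<open>b\<close>.\<close>
  define a b b' where "a = exp (\<tau> *\<^sub>R F)" and "b = exp (\<tau> *\<^sub>R F')" and "b' = exp (- (\<tau> *\<^sub>R F'))"
  have "is_adj a b" unfolding a_def b_def F_def F'_def
    by (intro is_adj_exp is_adj_scaleR is_adj_diff is_adj_mult adj)
  then have ab: "norm a < 1" "norm b < 1"
    using stable norm_is_adj[of a b] by (simp_all add: a_def F_def)
  have bb': "b * b' = 1" "b' * b = 1"
    using exp_minus_inverse[of "\<tau> *\<^sub>R F'"] exp_minus_inverse[of "- (\<tau> *\<^sub>R F')"] by (simp_all add: b_def b'_def)
  define W where "W = exp (\<tau> *\<^sub>R H)"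
  have expN: "exp (\<tau> *\<^sub>R N) = V' * b' * V"
    using exp_conjugate[of V' V "- (\<tau> *\<^sub>R F')"] VV' by (simp add: N b'_def)
  have W: "W = T * blk a 0 0 (V' * b' * V) * T'"
  proof -
    have "\<tau> *\<^sub>R H = T * blk (\<tau> *\<^sub>R F) 0 0 (\<tau> *\<^sub>R N) * T'"
    proof -
      have "\<tau> *\<^sub>R H = T * (\<tau> *\<^sub>R blk F 0 0 N) * T'" by (simp add: H)
      then show ?thesis by (simp only: blk_scaleR scaleR_zero_right)
    qed
    then show ?thesis by (simp add: W_def exp_conjugate[OF TT'] exp_blk_diag expN a_def)
  qed
  have Wpow: "W ^ n = T * blk (a ^ n) 0 0 (V' * b' ^ n * V) * T'" for n
    unfolding W conjugate_power[OF TT'] blk_diag_power conjugate_power[OF VV'(2,1)] ..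
  obtain \<alpha> where \<alpha>: "\<And>n. (1 + a ^ Suc n) * \<alpha> n = 1" "\<And>n. \<alpha> n * (1 + a ^ Suc n) = 1" "\<alpha> \<longlonglongrightarrow> 1"
    by (rule one_plus_inverses[OF norm_power_less_1[OF ab(1)] power_tendsto_0[OF ab(1)]]) (rule that)
  obtain \<gamma> where \<gamma>: "\<And>n. (1 + b ^ Suc n) * \<gamma> n = 1" "\<And>n. \<gamma> n * (1 + b ^ Suc n) = 1" "\<gamma> \<longlonglongrightarrow> 1"
    by (rule one_plus_inverses[OF norm_power_less_1[OF ab(2)] power_tendsto_0[OF ab(2)]]) (rule that)
  \<comment> \<open>The inverse of \<open>1 + W ^ Suc n\<close>. On the unstable block,
    \<open>b'\<close> being the inverse of \<open>b\<close>, the inverse of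
    \<open>1 + b' ^ Suc n\<close> equals \<open>1 - \<gamma> n\<close>, which tends to 0, while
    \<open>\<alpha> n\<close> tends to 1.\<close>
  define p where "p n = T * blk (\<alpha> n) 0 0 (V' * (1 - \<gamma> n) * V) * T'" for n
  define P where "P = T * blk 1 0 0 0 * T'"
  have conj_mult: "T * x * T' * (T * y * T') = T * (x * y) * T'" for x y
  proof -
    have "T * x * T' * (T * y * T') = T * x * (T' * T) * y * T'" by (simp only: mult.assoc)
    then show ?thesis by (simp only: TT' mult_1_right mult.assoc)
  qed
  have conj_mult': "V' * x * V * (V' * y * V) = V' * (x * y) * V" for x y
  proof -
    have "V' * x * V * (V' * y * V) = V' * x * (V * V') * y * V" by (simp only: mult.assoc)
    then show ?thesis by (simp only: VV' mult_1_right mult.assoc)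
  qed
  have p: "p n \<in> mat_alg" for n
  proof -
    have bn: "b ^ Suc n * b' ^ Suc n = 1" "b' ^ Suc n * b ^ Suc n = 1"
      using bb' by (metis left_right_inverse_power)+
    have g: "1 - \<gamma> n = b ^ Suc n * \<gamma> n" "1 - \<gamma> n = \<gamma> n * b ^ Suc n"
      using \<gamma>(1,2)[of n] by (simp_all only: distrib_left distrib_right mult_1 mult_1_right) (metis add_diff_cancel_left')+
    have "(1 + b' ^ Suc n) * (1 - \<gamma> n) = (b ^ Suc n + b' ^ Suc n * b ^ Suc n) * \<gamma> n"
      unfolding g(1) by (simp only: distrib_right mult.assoc mult_1)
    then have g1: "(1 + b' ^ Suc n) * (1 - \<gamma> n) = 1"
      using \<gamma>(1)[of n] bn by (simp only: add.commute)
    have "(1 - \<gamma> n) * (1 + b' ^ Suc n) = \<gamma> n * (b ^ Suc n + b ^ Suc n * b' ^ Suc n)"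
      unfolding g(2) by (simp only: distrib_left mult.assoc mult_1_right)
    then have g2: "(1 - \<gamma> n) * (1 + b' ^ Suc n) = 1"
      using \<gamma>(2)[of n] bn by (simp only: add.commute)
    have W1: "1 + W ^ Suc n = T * blk (1 + a ^ Suc n) 0 0 (V' * (1 + b' ^ Suc n) * V) * T'"
    proof -
      have "blk (1 + a ^ Suc n) 0 0 (V' * (1 + b' ^ Suc n) * V) = 1 + blk (a ^ Suc n) 0 0 (V' * b' ^ Suc n * V)"
        unfolding blk_one blk_add using VV' by (simp add: distrib_left distrib_right)
      then show ?thesis unfolding Wpow using TT' by (simp add: distrib_left distrib_right)
    qed
    \<comment> \<open>Membership rests on the exponential of \<open>H\<close> alone; the conjugated
      form, whose factors are not known to lie in \<open>mat_alg\<close>, serves only to identify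
      the inverse.\<close>
    have "1 + W ^ Suc n \<in> mat_alg"
      unfolding W_def by (intro M.add_mem M.one_mem M.power_mem M.exp_mem M.scaleR_mem Hmem)
    moreover have "(1 + W ^ Suc n) * p n = 1"
      unfolding W1 p_def conj_mult blk_mult using TT' VV'
      by (simp only: conj_mult' \<alpha> g1 mult_zero_left mult_zero_right add_0_left add_0_right mult_1_right flip: blk_one)
    moreover have "p n * (1 + W ^ Suc n) = 1"
      unfolding W1 p_def conj_mult blk_mult using TT' VV'
      by (simp only: conj_mult' \<alpha> g2 mult_zero_left mult_zero_right add_0_left add_0_right mult_1_right flip: blk_one)
    ultimately show ?thesis by (rule M.inverse_closed)
  qed
  have "P \<in> mat_alg"
  proof (rule M.idempotent_limit_mem[OF p])
    show "p n * P = P * p n" for n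
      unfolding p_def P_def conj_mult blk_mult by simp
    show "P * P = P" unfolding P_def conj_mult blk_mult by simp
    have "(\<lambda>n. blk (\<alpha> n) 0 0 (V' * (1 - \<gamma> n) * V)) \<longlonglongrightarrow> blk 1 0 0 0"
    proof (rule LIM_zero_cancel, rule Lim_null_comparison)
      show "eventually (\<lambda>n. norm (blk (\<alpha> n) 0 0 (V' * (1 - \<gamma> n) * V) - blk 1 0 0 0) \<le>
          norm (\<alpha> n - 1) + norm (V' * (1 - \<gamma> n) * V)) sequentially"
        unfolding blk_diff using norm_blk_diag_le by (auto intro!: always_eventually)
      have "(\<lambda>n. norm (\<alpha> n - 1) + norm (V' * (1 - \<gamma> n) * V)) \<longlonglongrightarrow> norm (1 - 1 :: 'a endo) + norm (V' * (1 - 1) * V)"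
        by (intro tendsto_intros \<alpha> \<gamma>)
      then show "(\<lambda>n. norm (\<alpha> n - 1) + norm (V' * (1 - \<gamma> n) * V)) \<longlonglongrightarrow> 0" by simp
    qed
    then show "p \<longlonglongrightarrow> P" unfolding p_def P_def by (intro tendsto_intros)
  qed
  moreover have "P = blk Z (Z * Y) (X * Z) (X * Z * Y)"
    unfolding P_def T_def T'_def blk_mult by (simp add: mult.assoc)
  ultimately have Z: "Z \<in> \<A>" and XZ: "X * Z \<in> \<A>"
    using mat_algD[of P True True] mat_algD[of P False True] by auto
  \<comment> \<open>\<open>1 + Y * X\<close> is the inverse of \<open>Z\<close>, hence in the
    algebra, and multiplying \<open>X * Z\<close> by it recovers \<open>X\<close>.\<close>
  have "1 + Y * X \<in> \<A>" by (rule inverse_closed[OF Z inv(2,1)])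
  then have "X * Z * (1 + Y * X) \<in> \<A>" by (rule mult_mem[OF XZ])
  then show ?thesis by (simp only: mult.assoc inv mult_1_right)
qed

end

section \<open>Exponential stability from the Riccati equation\<close>

text \<open>The tail of the exponential series from the quadratic term on, with
  \<open>fact (n + 2)\<close> replaced by \<open>fact n\<close>. The constant is independent of
  \<open>h\<close>, which is how all second-order errors below are collected.\<close>

lemma norm_exp_minus_linear_le:
  fixes y :: "'a::{real_normed_algebra_1, banach}"
  assumes "0 \<le> h" "h \<le> 1"
  shows "norm (exp (h *\<^sub>R y) - 1 - h *\<^sub>R y) \<le> h\<^sup>2 * ((norm y)\<^sup>2 * exp (norm y))"
proof -
  let ?z = "h *\<^sub>R y"
  have nz: "norm ?z = h * norm y" using assms by simp
  have le: "norm (inverse (fact (n + 2)) *\<^sub>R ?z ^ (n + 2)) \<le> (norm ?z)\<^sup>2 * (norm ?z ^ n /\<^sub>R fact n)" for n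
  proof -
    have "norm (inverse (fact (n + 2)) *\<^sub>R ?z ^ (n + 2)) \<le> inverse (fact (n + 2)) * norm ?z ^ (n + 2)"
      unfolding norm_scaleR[of "inverse _" "_ ^ _"] abs_of_nonneg[OF inverse_nonnegative_iff_nonnegative[THEN iffD2, OF fact_ge_zero]]
      by (intro mult_left_mono norm_power_ineq) simp
    also have "\<dots> \<le> inverse (fact n) * norm ?z ^ (n + 2)"
      by (intro mult_right_mono le_imp_inverse_le fact_mono) auto
    also have "\<dots> = (norm ?z)\<^sup>2 * (norm ?z ^ n /\<^sub>R fact n)"
      unfolding real_scaleR_def by (simp only: power_add mult_ac)
    finally show ?thesis .
  qed
  have s: "summable (\<lambda>n. (norm ?z)\<^sup>2 * (norm ?z ^ n /\<^sub>R fact n))"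
    by (intro summable_mult summable_exp_generic)
  have s': "summable (\<lambda>n. norm (inverse (fact (n + 2)) *\<^sub>R ?z ^ (n + 2)))"
    by (rule summable_comparison_test'[OF s]) (unfold real_norm_def abs_norm_cancel, rule le)
  have "exp ?z - 1 - ?z = (\<Sum>n. inverse (fact (n + 2)) *\<^sub>R ?z ^ (n + 2))"
    unfolding exp_first_two_terms[of ?z] by simp
  also have "norm \<dots> \<le> (\<Sum>n. norm (inverse (fact (n + 2)) *\<^sub>R ?z ^ (n + 2)))"
    by (rule summable_norm[OF s'])
  also have "\<dots> \<le> (\<Sum>n. (norm ?z)\<^sup>2 * (norm ?z ^ n /\<^sub>R fact n))"
    by (rule suminf_le[OF le s' s])
  also have "\<dots> = (norm ?z)\<^sup>2 * exp (norm ?z)"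
    unfolding exp_def by (rule suminf_mult[OF summable_exp_generic])
  also have "\<dots> \<le> (norm ?z)\<^sup>2 * exp (norm y)"
    using assms mult_right_mono[of h 1 "norm y"] unfolding nz by (intro mult_left_mono) auto
  finally show ?thesis unfolding nz by (simp add: power_mult_distrib mult.assoc)
qed

text \<open>\<open>U\<close> decays geometrically along powers of \<open>T\<close> and is comparable
  to the squared norm. \<open>U\<close> itself need not be a quadratic form, which allows the square
  of a non-Hilbert norm in it.\<close>

lemma contraction_power_if_lyapunov:
  fixes T :: "'a::{real_normed_vector, perfect_space} endo"
  assumes "0 < \<epsilon>" "0 \<le> \<eta>" "\<eta> < 1"
    and low: "\<And>x. \<epsilon> * (norm x)\<^sup>2 \<le> U x" and up: "\<And>x. U x \<le> c * (norm x)\<^sup>2"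
    and dec: "\<And>x. U (ap T x) \<le> \<eta> * U x"
  shows "\<exists>k>0. norm (T ^ k) < 1"
proof -
  have Upow: "U (ap (T ^ k) x) \<le> \<eta> ^ k * U x" for k x
  proof (induction k)
    case (Suc k)
    have "U (ap (T ^ Suc k) x) \<le> \<eta> * U (ap (T ^ k) x)" using dec[of "ap (T ^ k) x"] by simp
    also have "\<dots> \<le> \<eta> * (\<eta> ^ k * U x)" by (intro mult_left_mono Suc assms)
    finally show ?case by (simp add: mult.assoc)
  qed simp
  have "(\<lambda>k. \<eta> ^ Suc k * (c / \<epsilon>)) \<longlonglongrightarrow> 0 * (c / \<epsilon>)"
    using assms by (intro tendsto_intros LIMSEQ_Suc[OF LIMSEQ_power_zero]) auto
  \<comment> \<open>A factor 1/4 for the squared norm gives 1/2 for the norm.\<close>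
  then have "eventually (\<lambda>k. \<eta> ^ Suc k * (c / \<epsilon>) < 1 / 4) sequentially"
    by (rule order_tendstoD) simp
  then obtain k where k: "\<eta> ^ Suc k * (c / \<epsilon>) < 1 / 4"
    using eventually_happens'[OF sequentially_bot] by blast
  have "norm (T ^ Suc k) \<le> 1 / 2"
  proof (rule norm_endo_bound)
    fix x
    have "\<epsilon> * (norm (ap (T ^ Suc k) x))\<^sup>2 \<le> \<eta> ^ Suc k * U x"
      by (rule order_trans[OF low Upow])
    also have "\<dots> \<le> \<eta> ^ Suc k * (c * (norm x)\<^sup>2)"
      using assms by (intro mult_left_mono up) auto
    also have "\<dots> = \<epsilon> * (\<eta> ^ Suc k * (c / \<epsilon>) * (norm x)\<^sup>2)" using \<open>0 < \<epsilon>\<close> by simp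
    also have "\<dots> \<le> \<epsilon> * (1 / 4 * (norm x)\<^sup>2)"
      using k \<open>0 < \<epsilon>\<close> by (intro mult_left_mono mult_right_mono) auto
    finally have "(norm (ap (T ^ Suc k) x))\<^sup>2 \<le> (1 / 2 * norm x)\<^sup>2"
      using \<open>0 < \<epsilon>\<close> by (simp add: power_mult_distrib power2_eq_square)
    then show "norm (ap (T ^ Suc k) x) \<le> 1 / 2 * norm x" by (rule power2_le_imp_le) simp
  qed simp
  then show ?thesis by (intro exI[of _ "Suc k"]) auto
qed

text \<open>Classical renorming by the supremum over \<open>t \<ge> 0\<close> of
  \<open>exp (\<alpha> * t)\<close> times the norm of the trajectory at time \<open>t\<close>.
  Shifting the trajectory by \<open>h\<close> costs exactly \<open>exp (- \<alpha> * h)\<close>, so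
  the constant \<open>E\<close> disappears from the decay estimate and survives only in the
  comparison with \<open>norm\<close>.\<close>

lemma adapted_norm:
  fixes M :: "'a::{banach, perfect_space} endo"
  assumes "\<And>t. 0 \<le> t \<Longrightarrow> norm (exp (t *\<^sub>R M)) \<le> E * exp (- \<alpha> * t)"
  obtains N :: "'a \<Rightarrow> real" where "\<And>x. norm x \<le> N x" "\<And>x. N x \<le> E * norm x"
    "\<And>x y. N (x + y) \<le> N x + N y" "\<And>h x. 0 \<le> h \<Longrightarrow> N (ap (exp (h *\<^sub>R M)) x) \<le> exp (- \<alpha> * h) * N x"
proof -
  define g where "g x t = exp (\<alpha> * t) * norm (ap (exp (t *\<^sub>R M)) x)" for x t
  define N where "N x = (SUP t\<in>{0..}. g x t)" for x
  have gE: "g x t \<le> E * norm x" if "0 \<le> t" for x t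
  proof -
    have "g x t \<le> exp (\<alpha> * t) * (norm (exp (t *\<^sub>R M)) * norm x)"
      unfolding g_def by (intro mult_left_mono norm_ap) simp
    also have "\<dots> \<le> exp (\<alpha> * t) * ((E * exp (- \<alpha> * t)) * norm x)"
      by (intro mult_left_mono mult_right_mono assms that) auto
    also have "\<dots> = E * norm x" by (simp add: exp_minus)
    finally show ?thesis .
  qed
  have bdd: "bdd_above (g x ` {0..})" for x using gE by (auto intro!: bdd_aboveI2)
  have gN: "g x t \<le> N x" if "0 \<le> t" for x t
    unfolding N_def by (rule cSUP_upper[OF _ bdd]) (use that in simp)
  have least: "N x \<le> c" if "\<And>t. 0 \<le> t \<Longrightarrow> g x t \<le> c" for x c
    unfolding N_def by (rule cSUP_least) (use that in auto)
  show ?thesis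
  proof (rule that[of N])
    show "norm x \<le> N x" for x using gN[of 0 x] by (simp add: g_def)
    show "N x \<le> E * norm x" for x by (rule least[OF gE])
    show "N (x + y) \<le> N x + N y" for x y
    proof (rule least)
      fix t :: real assume t: "0 \<le> t"
      have "g (x + y) t \<le> g x t + g y t"
        unfolding g_def by (simp add: norm_triangle_ineq flip: distrib_left)
      also have "\<dots> \<le> N x + N y" by (intro add_mono gN t)
      finally show "g (x + y) t \<le> N x + N y" .
    qed
    show "N (ap (exp (h *\<^sub>R M)) x) \<le> exp (- \<alpha> * h) * N x" if h: "0 \<le> h" for h x
    proof (rule least)
      fix t :: real assume t: "0 \<le> t"
      have "exp (t *\<^sub>R M) * exp (h *\<^sub>R M) = exp ((t + h) *\<^sub>R M)"
        unfolding scaleR_add_left by (rule exp_add_commuting[symmetric]) simp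
      then have "ap (exp (t *\<^sub>R M)) (ap (exp (h *\<^sub>R M)) x) = ap (exp ((t + h) *\<^sub>R M)) x"
        by (metis ap_mult)
      then have "g (ap (exp (h *\<^sub>R M)) x) t = exp (- \<alpha> * h) * g x (t + h)"
        by (simp add: g_def algebra_simps flip: exp_add)
      also have "\<dots> \<le> exp (- \<alpha> * h) * N x" using t h by (intro mult_left_mono gN) auto
      finally show "g (ap (exp (h *\<^sub>R M)) x) t \<le> exp (- \<alpha> * h) * N x" .
    qed
  qed
qed

lemma square_convex_le:
  fixes n y s :: real
  assumes "0 \<le> s" "s \<le> 1"
  shows "((1 - s) * n + s * y)\<^sup>2 \<le> (1 - s) * n\<^sup>2 + s * y\<^sup>2"
proof -
  have "(1 - s) * n\<^sup>2 + s * y\<^sup>2 - ((1 - s) * n + s * y)\<^sup>2 = s * (1 - s) * (n - y)\<^sup>2"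
    by (simp add: power2_eq_square algebra_simps)
  also have "\<dots> \<ge> 0" using assms by simp
  finally show ?thesis by simp
qed

text \<open>Both sides are multiplied by \<open>1 + s\<close>: the left becomes at most 1, the right
  becomes \<open>1 + s ^ 3\<close>.\<close>

lemma exp_minus_le_quadratic:
  fixes s :: real
  assumes "0 \<le> s"
  shows "exp (- s) \<le> 1 - s + s\<^sup>2"
proof -
  have "exp (- s) * (1 + s) \<le> 1"
    using exp_ge_add_one_self[of s] mult_left_mono[of "1 + s" "exp s" "exp (- s)"]
    by (simp add: exp_minus)
  also have "\<dots> \<le> (1 - s + s\<^sup>2) * (1 + s)"
    using assms by (simp add: algebra_simps power2_eq_square)
  finally show ?thesis using assms by (simp add: mult_le_cancel_right)
qed

text \<open>
  The Lyapunov function is \<open>\<langle>X x, x\<rangle> + \<epsilon> N(x)\<^sup>2\<close>: the Riccati equation makes the first summand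
  dissipate exactly the quantity by which the closed loop deviates from the stable operator
  \<open>A + L C\<close>, for which the norm \<open>N\<close> decays.
\<close>

lemma riccati_closed_loop_stable:
  fixes A A' S Q X C L :: "'a::{real_inner, banach, perfect_space} endo"
  assumes adj: "is_adj A A'" and S: "posop S" and X: "posop X"
    and riccati: "A' * X + X * A - X * S * X + Q = 0"
    and C: "\<And>x. ap Q x \<bullet> x = (norm (ap C x))\<^sup>2"
    and "0 < \<alpha>" and stable: "\<And>t. 0 \<le> t \<Longrightarrow> norm (exp (t *\<^sub>R (A + L * C))) \<le> E * exp (- \<alpha> * t)"
  shows "\<exists>\<tau>>0. norm (exp (\<tau> *\<^sub>R (A - S * X))) < 1"
proof -
  define F where "F = A - S * X"
  define M where "M = A + L * C"
  have E1: "1 \<le> E" using stable[of 0] by simp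
  have stM: "norm (exp (t *\<^sub>R M)) \<le> E * exp (- \<alpha> * t)" if "0 \<le> t" for t
    unfolding M_def by (rule stable[OF that])
  obtain N :: "'a \<Rightarrow> real" where N1: "\<And>x. norm x \<le> N x" and N2: "\<And>x. N x \<le> E * norm x"
    and N3: "\<And>x y. N (x + y) \<le> N x + N y"
    and N4: "\<And>h x. 0 \<le> h \<Longrightarrow> N (ap (exp (h *\<^sub>R M)) x) \<le> exp (- \<alpha> * h) * N x"
    by (rule adapted_norm[OF stM]) (assumption, rule that)
  have N0: "0 \<le> N x" for x using order_trans[OF norm_ge_zero N1] .
  define w where "w x = ap Q x \<bullet> x + ap S (ap X x) \<bullet> ap X x" for x
  define V where "V x = ap X x \<bullet> x" for x
  have V0: "0 \<le> V x" for x using X by (simp add: V_def posop_def)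
  have Xsym: "ap X y \<bullet> x = ap X x \<bullet> y" for x y
    using X by (metis posop_def is_adjD inner_commute)
  \<comment> \<open>The derivative of the form of \<open>X\<close> along the flow of
    \<open>F\<close>, read off by testing the Riccati equation against \<open>x\<close>.\<close>
  have XF: "2 * (ap X x \<bullet> ap F x) = - w x" for x
  proof -
    have "ap (A' * X + X * A - X * S * X + Q) x \<bullet> x = 0" by (simp add: riccati)
    moreover have "ap A' (ap X x) \<bullet> x = ap X x \<bullet> ap A x"
      using is_adjD[OF is_adj_sym[OF adj]] by simp
    moreover have "ap X (ap A x) \<bullet> x = ap X x \<bullet> ap A x" by (rule Xsym)
    moreover have "ap X (ap S (ap X x)) \<bullet> x = ap X x \<bullet> ap S (ap X x)" by (rule Xsym)
    ultimately show ?thesis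
      by (simp add: F_def w_def inner_simps inner_commute[of "ap S (ap X x)"])
  qed
  define KF where "KF = (norm F)\<^sup>2 * exp (norm F)"
  define KM where "KM = (norm M)\<^sup>2 * exp (norm M)"
  have K0: "0 \<le> KF" "0 \<le> KM" by (simp_all add: KF_def KM_def)
  define g where "g x = norm (ap (F - M) x)" for x
  \<comment> \<open>\<open>F - M\<close> is \<open>- (S * X + L * C)\<close>. Positivity of
    \<open>S\<close> bounds the first part by its share of \<open>w\<close>, and \<open>L\<close>
    acts on \<open>C x\<close>, whose squared norm is the other share. The summand 1 makes
    \<open>K4\<close> positive, as it will be divided by.\<close>
  define K4 where "K4 = 2 * (norm S + (norm L)\<^sup>2) + 1"
  have K4: "0 < K4" by (simp add: K4_def add_nonneg_pos)
  have gw: "(g x)\<^sup>2 \<le> K4 * w x" for x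
  proof -
    let ?a = "norm (ap S (ap X x))" and ?b = "norm (ap L (ap C x))"
    have "g x = norm (ap S (ap X x) + ap L (ap C x))"
      by (simp add: g_def F_def M_def norm_minus_commute flip: norm_minus_cancel[of "_ - _"]) (simp add: algebra_simps)
    also have "\<dots> \<le> ?a + ?b" by (rule norm_triangle_ineq)
    finally have "(g x)\<^sup>2 \<le> (?a + ?b)\<^sup>2" by (rule power_mono) (simp add: g_def)
    also have "\<dots> \<le> 2 * ?a\<^sup>2 + 2 * ?b\<^sup>2"
      using zero_le_power2[of "?a - ?b"] by (simp add: power2_sum power2_diff)
    also have "?a\<^sup>2 \<le> norm S * (ap S (ap X x) \<bullet> ap X x)" by (rule posop_norm_ap_le_norm[OF S])
    also have "?b\<^sup>2 \<le> (norm L * norm (ap C x))\<^sup>2" by (intro power_mono norm_ap) simp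
    also have "\<dots> = (norm L)\<^sup>2 * (ap Q x \<bullet> x)" by (simp add: C power_mult_distrib)
    finally have le: "(g x)\<^sup>2 \<le> 2 * (norm S * (ap S (ap X x) \<bullet> ap X x)) + 2 * ((norm L)\<^sup>2 * (ap Q x \<bullet> x))" by simp
    have p: "0 \<le> ap S (ap X x) \<bullet> ap X x" "0 \<le> ap Q x \<bullet> x" using S C by (auto simp: posop_def)
    have p': "0 \<le> norm S * (ap Q x \<bullet> x)" "0 \<le> (norm L)\<^sup>2 * (ap S (ap X x) \<bullet> ap X x)" using p by simp_all
    have "K4 * w x = 2 * (norm S * (ap S (ap X x) \<bullet> ap X x)) + 2 * ((norm L)\<^sup>2 * (ap Q x \<bullet> x)) +
        (2 * (norm S * (ap Q x \<bullet> x)) + 2 * ((norm L)\<^sup>2 * (ap S (ap X x) \<bullet> ap X x)) +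
          ap Q x \<bullet> x + ap S (ap X x) \<bullet> ap X x)"
      by (simp add: K4_def w_def algebra_simps)
    then show ?thesis using le p p' by linarith
  qed
  \<comment> \<open>Collects the second-order errors of one step in the norm \<open>N\<close>: the
    remainders of both exponentials, and \<open>\<alpha>\<^sup>2\<close> from expanding
    \<open>exp (- \<alpha> * h)\<close>.\<close>
  define K2 where "K2 = E * (KF + KM) + \<alpha>\<^sup>2"
  have K2: "0 \<le> K2" using E1 K0 by (simp add: K2_def)
  define K5 where "K5 = 2 * norm X * KF + norm X * (norm F + KF)\<^sup>2"
  have K5: "0 \<le> K5" using K0 by (simp add: K5_def)
  have exp_ap: "norm (ap (exp (h *\<^sub>R B)) x - x - h *\<^sub>R ap B x) \<le> h\<^sup>2 * ((norm B)\<^sup>2 * exp (norm B)) * N x"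
    if "0 \<le> h" "h \<le> 1" for h x and B :: "'a endo"
  proof -
    have "norm (ap (exp (h *\<^sub>R B)) x - x - h *\<^sub>R ap B x) = norm (ap (exp (h *\<^sub>R B) - 1 - h *\<^sub>R B) x)" by simp
    also have "\<dots> \<le> (h\<^sup>2 * ((norm B)\<^sup>2 * exp (norm B))) * N x"
      by (rule order_trans[OF norm_ap]) (intro mult_mono norm_exp_minus_linear_le N1 that, auto)
    finally show ?thesis .
  qed
  have Nstep: "N (ap (exp (h *\<^sub>R F)) x) \<le> (1 - \<alpha> * h) * N x + h * (E * g x + K2 * h * N x)"
    if h: "0 \<le> h" "h \<le> 1" for h x
  proof -
    define d where "d = ap (exp (h *\<^sub>R F)) x - ap (exp (h *\<^sub>R M)) x"
    define \<rho> where "\<rho> = ap (exp (h *\<^sub>R F)) x - x - h *\<^sub>R ap F x"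
    define \<rho>' where "\<rho>' = ap (exp (h *\<^sub>R M)) x - x - h *\<^sub>R ap M x"
    have \<rho>: "norm \<rho> \<le> h\<^sup>2 * KF * N x" "norm \<rho>' \<le> h\<^sup>2 * KM * N x"
      unfolding \<rho>_def \<rho>'_def KF_def KM_def by (intro exp_ap h)+
    have "d = h *\<^sub>R ap (F - M) x + (\<rho> - \<rho>')"
      by (simp add: d_def \<rho>_def \<rho>'_def algebra_simps)
    then have "norm d \<le> norm (h *\<^sub>R ap (F - M) x) + norm (\<rho> - \<rho>')" by (metis norm_triangle_ineq)
    also have "\<dots> \<le> h * g x + (h\<^sup>2 * KF * N x + h\<^sup>2 * KM * N x)"
      using h norm_triangle_ineq4[of \<rho> \<rho>'] \<rho> by (simp add: g_def del: ap_simps)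
    finally have d: "norm d \<le> h * g x + h\<^sup>2 * (KF + KM) * N x" by (simp add: algebra_simps)
    have "N (ap (exp (h *\<^sub>R F)) x) \<le> N (ap (exp (h *\<^sub>R M)) x) + N d"
      using N3[of "ap (exp (h *\<^sub>R M)) x" d] by (simp add: d_def)
    also have "N d \<le> E * norm d" by (rule N2)
    also have "E * norm d \<le> E * (h * g x + h\<^sup>2 * (KF + KM) * N x)"
      using d E1 by (intro mult_left_mono) auto
    also have "N (ap (exp (h *\<^sub>R M)) x) \<le> exp (- \<alpha> * h) * N x" by (rule N4[OF h(1)])
    also have "exp (- \<alpha> * h) * N x \<le> (1 - \<alpha> * h + (\<alpha> * h)\<^sup>2) * N x"
      using exp_minus_le_quadratic[of "\<alpha> * h"] \<open>0 < \<alpha>\<close> h by (intro mult_right_mono N0) auto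
    finally have "N (ap (exp (h *\<^sub>R F)) x) \<le> (1 - \<alpha> * h + (\<alpha> * h)\<^sup>2) * N x +
        E * (h * g x + h\<^sup>2 * (KF + KM) * N x)" by simp
    then show ?thesis by (simp add: K2_def algebra_simps power2_eq_square)
  qed
  have Nsq: "(N (ap (exp (h *\<^sub>R F)) x))\<^sup>2 \<le>
      (1 - \<alpha> * h) * (N x)\<^sup>2 + 2 * E\<^sup>2 * K4 / \<alpha> * (h * w x) + 2 * K2\<^sup>2 / \<alpha> * (h\<^sup>2 * (N x)\<^sup>2)"
    if h: "0 \<le> h" "h \<le> 1" "\<alpha> * h \<le> 1" for h x
  proof -
    \<comment> \<open>Chosen so that the one-step bound is the convex combination of
      \<open>N x\<close> and \<open>y\<close> with weights \<open>1 - \<alpha> * h\<close> and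
      \<open>\<alpha> * h\<close>. Convexity of the square then keeps the coefficient
      \<open>1 - \<alpha> * h\<close> in front of \<open>(N x)\<^sup>2\<close>.\<close>
    define y where "y = (E * g x + K2 * h * N x) / \<alpha>"
    have "N (ap (exp (h *\<^sub>R F)) x) \<le> (1 - \<alpha> * h) * N x + (\<alpha> * h) * y"
      using Nstep[OF h(1,2), of x] \<open>0 < \<alpha>\<close> by (simp add: y_def)
    then have "(N (ap (exp (h *\<^sub>R F)) x))\<^sup>2 \<le> ((1 - \<alpha> * h) * N x + (\<alpha> * h) * y)\<^sup>2"
      by (rule power_mono) (rule N0)
    also have "\<dots> \<le> (1 - \<alpha> * h) * (N x)\<^sup>2 + (\<alpha> * h) * y\<^sup>2"
      using h \<open>0 < \<alpha>\<close> by (intro square_convex_le) auto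
    also have "(\<alpha> * h) * y\<^sup>2 \<le> 2 * E\<^sup>2 * K4 / \<alpha> * (h * w x) + 2 * K2\<^sup>2 / \<alpha> * (h\<^sup>2 * (N x)\<^sup>2)"
    proof -
      have "(\<alpha> * h) * y\<^sup>2 = h / \<alpha> * (E * g x + K2 * h * N x)\<^sup>2"
        using \<open>0 < \<alpha>\<close> by (simp add: y_def power_divide power2_eq_square)
      also have "\<dots> \<le> h / \<alpha> * (2 * (E * g x)\<^sup>2 + 2 * (K2 * h * N x)\<^sup>2)"
        using h \<open>0 < \<alpha>\<close> zero_le_power2[of "E * g x - K2 * h * N x"]
        by (intro mult_left_mono) (auto simp: power2_sum power2_diff)
      also have "\<dots> = h / \<alpha> * (2 * E\<^sup>2 * (g x)\<^sup>2) + h / \<alpha> * (2 * K2\<^sup>2 * h\<^sup>2 * (N x)\<^sup>2)"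
        by (simp add: power_mult_distrib algebra_simps)
      also have "h / \<alpha> * (2 * E\<^sup>2 * (g x)\<^sup>2) \<le> h / \<alpha> * (2 * E\<^sup>2 * (K4 * w x))"
        using h \<open>0 < \<alpha>\<close> by (intro mult_left_mono gw) auto
      also have "h / \<alpha> * (2 * K2\<^sup>2 * h\<^sup>2 * (N x)\<^sup>2) \<le> 1 / \<alpha> * (2 * K2\<^sup>2 * h\<^sup>2 * (N x)\<^sup>2)"
        using h \<open>0 < \<alpha>\<close> by (intro mult_right_mono divide_right_mono) auto
      finally show ?thesis by (simp add: algebra_simps)
    qed
    finally show ?thesis by simp
  qed
  have Vstep: "V (ap (exp (h *\<^sub>R F)) x) \<le> V x - h * w x + K5 * (h\<^sup>2 * (N x)\<^sup>2)"
    if h: "0 \<le> h" "h \<le> 1" for h x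
  proof -
    define \<rho> where "\<rho> = ap (exp (h *\<^sub>R F)) x - x - h *\<^sub>R ap F x"
    have \<rho>: "norm \<rho> \<le> h\<^sup>2 * KF * N x" unfolding \<rho>_def KF_def by (intro exp_ap h)
    define \<delta> where "\<delta> = h *\<^sub>R ap F x + \<rho>"
    have "norm \<delta> \<le> h * (norm F * N x) + h\<^sup>2 * KF * N x"
      unfolding \<delta>_def using h \<rho> order_trans[OF norm_ap mult_left_mono[OF N1]]
      by (intro norm_triangle_mono) (auto intro!: mult_left_mono)
    also have "h\<^sup>2 * KF * N x \<le> h * KF * N x"
      using h K0 N0 by (intro mult_right_mono) (auto simp: power2_eq_square mult_left_le_one_le)
    finally have \<delta>: "norm \<delta> \<le> h * (norm F + KF) * N x" by (simp add: algebra_simps)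
    have "ap (exp (h *\<^sub>R F)) x = x + \<delta>" by (simp add: \<delta>_def \<rho>_def)
    then have "V (ap (exp (h *\<^sub>R F)) x) = V x + 2 * (ap X x \<bullet> \<delta>) + ap X \<delta> \<bullet> \<delta>"
      by (simp add: V_def inner_simps Xsym[of \<delta> x])
    also have "2 * (ap X x \<bullet> \<delta>) = h * (2 * (ap X x \<bullet> ap F x)) + 2 * (ap X x \<bullet> \<rho>)"
      by (simp add: \<delta>_def inner_simps)
    also have "\<dots> = - (h * w x) + 2 * (ap X x \<bullet> \<rho>)" by (simp only: XF mult_minus_right)
    also have "ap X x \<bullet> \<rho> \<le> norm X * N x * (h\<^sup>2 * KF * N x)"
      using norm_cauchy_schwarz[of "ap X x" \<rho>] order_trans[OF norm_ap mult_left_mono[OF N1[of x] norm_ge_zero[of X]]]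
      by (intro order_trans[OF norm_cauchy_schwarz] mult_mono \<rho>) (auto simp: N0)
    also have "ap X \<delta> \<bullet> \<delta> \<le> norm X * (h * (norm F + KF) * N x)\<^sup>2"
      by (intro order_trans[OF inner_ap_le_norm] mult_left_mono power_mono \<delta>) auto
    finally show ?thesis by (simp add: K5_def power2_eq_square algebra_simps)
  qed
  \<comment> \<open>With this value the increase of \<open>\<epsilon> * (N x)\<^sup>2\<close> caused
    by \<open>w\<close> is at most \<open>h * w x\<close>, exactly what \<open>V\<close> loses in
    the same step.\<close>
  define \<epsilon> where "\<epsilon> = \<alpha> / (2 * E\<^sup>2 * K4)"
  have \<epsilon>: "0 < \<epsilon>" using \<open>0 < \<alpha>\<close> E1 K4 by (simp add: \<epsilon>_def)
  define U where "U x = V x + \<epsilon> * (N x)\<^sup>2" for x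
  define K6 where "K6 = K5 + \<epsilon> * (2 * K2\<^sup>2 / \<alpha>) + 1"
  have K6: "0 < K6" using K5 \<epsilon> \<open>0 < \<alpha>\<close> by (simp add: K6_def add_nonneg_pos)
  \<comment> \<open>The last bound lets the second-order terms consume at most half of the decrease
    \<open>\<epsilon> * \<alpha> * h * (N x)\<^sup>2\<close>; the other two are the ranges of
    validity of the step estimates.\<close>
  define h where "h = min (min 1 (1 / \<alpha>)) (\<epsilon> * \<alpha> / (2 * K6))"
  have h: "0 < h" "h \<le> 1" "\<alpha> * h \<le> 1" "K6 * h \<le> \<epsilon> * \<alpha> / 2"
  proof -
    show "0 < h" using \<epsilon> K6 \<open>0 < \<alpha>\<close> by (simp add: h_def)
    show "h \<le> 1" by (simp add: h_def)
    have "h \<le> 1 / \<alpha>" by (simp add: h_def)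
    then show "\<alpha> * h \<le> 1" using \<open>0 < \<alpha>\<close> by (simp add: field_simps)
    have "h \<le> \<epsilon> * \<alpha> / (2 * K6)" by (simp add: h_def)
    then show "K6 * h \<le> \<epsilon> * \<alpha> / 2" using K6 by (simp add: field_simps)
  qed
  have Ustep: "U (ap (exp (h *\<^sub>R F)) x) \<le> U x - h * (\<epsilon> * \<alpha> / 2) * (N x)\<^sup>2" for x
  proof -
    have "\<epsilon> * (N (ap (exp (h *\<^sub>R F)) x))\<^sup>2 \<le> \<epsilon> * ((1 - \<alpha> * h) * (N x)\<^sup>2 +
        2 * E\<^sup>2 * K4 / \<alpha> * (h * w x) + 2 * K2\<^sup>2 / \<alpha> * (h\<^sup>2 * (N x)\<^sup>2))"
      using \<epsilon> h by (intro mult_left_mono Nsq) auto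
    also have "\<dots> = \<epsilon> * (N x)\<^sup>2 - \<epsilon> * \<alpha> * h * (N x)\<^sup>2 + (\<epsilon> * (2 * E\<^sup>2 * K4 / \<alpha>)) * (h * w x) +
        \<epsilon> * (2 * K2\<^sup>2 / \<alpha>) * (h\<^sup>2 * (N x)\<^sup>2)"
      by (simp add: algebra_simps)
    also have "\<epsilon> * (2 * E\<^sup>2 * K4 / \<alpha>) = 1" using \<open>0 < \<alpha>\<close> E1 K4 by (simp add: \<epsilon>_def)
    finally have "U (ap (exp (h *\<^sub>R F)) x) \<le> U x - \<epsilon> * \<alpha> * h * (N x)\<^sup>2 + (K5 + \<epsilon> * (2 * K2\<^sup>2 / \<alpha>)) * (h\<^sup>2 * (N x)\<^sup>2)"
      using Vstep[of h x] h by (simp add: U_def algebra_simps)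
    also have "(K5 + \<epsilon> * (2 * K2\<^sup>2 / \<alpha>)) * (h\<^sup>2 * (N x)\<^sup>2) \<le> K6 * (h\<^sup>2 * (N x)\<^sup>2)"
      by (intro mult_right_mono) (auto simp: K6_def)
    also have "\<dots> = (K6 * h) * (h * (N x)\<^sup>2)" by (simp add: power2_eq_square)
    also have "\<dots> \<le> (\<epsilon> * \<alpha> / 2) * (h * (N x)\<^sup>2)"
      using h by (intro mult_right_mono) auto
    finally show ?thesis by (simp add: algebra_simps)
  qed
  have Nn: "(N x)\<^sup>2 \<le> E\<^sup>2 * (norm x)\<^sup>2" for x
    using power_mono[OF N2[of x] N0, of 2] by (simp add: power_mult_distrib)
  have nN: "(norm x)\<^sup>2 \<le> (N x)\<^sup>2" for x by (intro power_mono N1) simp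
  have UN: "U x \<le> (norm X + \<epsilon>) * (N x)\<^sup>2" for x
    using inner_ap_le_norm[of X x] mult_left_mono[OF nN[of x] norm_ge_zero[of X]]
    by (simp add: U_def V_def algebra_simps)
  \<comment> \<open>Turns the remaining decrease, a multiple of \<open>(N x)\<^sup>2\<close>, into a
    fixed fraction of \<open>U x\<close>.\<close>
  define \<kappa> where "\<kappa> = h * (\<epsilon> * \<alpha> / 2) / (norm X + \<epsilon>)"
  have \<kappa>: "0 < \<kappa>" "\<kappa> \<le> 1"
  proof -
    have p: "0 < norm X + \<epsilon>" using \<epsilon> by (simp add: add_nonneg_pos)
    then show "0 < \<kappa>" using h \<epsilon> \<open>0 < \<alpha>\<close> by (simp add: \<kappa>_def)
    have "h * (\<epsilon> * \<alpha> / 2) = (\<alpha> * h) * \<epsilon> / 2" by simp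
    also have "\<dots> \<le> 1 * \<epsilon> / 2" using h \<epsilon> by (intro divide_right_mono mult_right_mono) auto
    also have "\<dots> \<le> norm X + \<epsilon>" using \<epsilon> norm_ge_zero[of X] by linarith
    finally show "\<kappa> \<le> 1" using p by (simp add: \<kappa>_def)
  qed
  have "\<exists>k>0. norm (exp (h *\<^sub>R F) ^ k) < 1"
  proof (rule contraction_power_if_lyapunov[OF \<epsilon>])
    show "0 \<le> 1 - \<kappa>" "1 - \<kappa> < 1" using \<kappa> by auto
    show "\<epsilon> * (norm x)\<^sup>2 \<le> U x" for x
      using V0[of x] mult_left_mono[OF nN[of x] less_imp_le[OF \<epsilon>]] unfolding U_def by linarith
    show "U x \<le> ((norm X + \<epsilon>) * E\<^sup>2) * (norm x)\<^sup>2" for x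
      using UN[of x] mult_left_mono[OF Nn[of x], of "norm X + \<epsilon>"] \<epsilon> by (simp add: mult.assoc)
    show "U (ap (exp (h *\<^sub>R F)) x) \<le> (1 - \<kappa>) * U x" for x
    proof -
      have "\<kappa> * U x \<le> \<kappa> * ((norm X + \<epsilon>) * (N x)\<^sup>2)" using \<kappa> UN by (intro mult_left_mono) auto
      also have "\<dots> = h * (\<epsilon> * \<alpha> / 2) * (N x)\<^sup>2"
      proof -
        have "norm X + \<epsilon> \<noteq> 0" using \<epsilon> norm_ge_zero[of X] by linarith
        then have "\<kappa> * (norm X + \<epsilon>) = h * (\<epsilon> * \<alpha> / 2)"
          using \<kappa>_def by (rule nonzero_eq_divide_eq[THEN iffD1])
        then show ?thesis by (simp only: mult.assoc[symmetric])
      qed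
      finally show ?thesis using Ustep[of x] by (simp add: algebra_simps)
    qed
  qed
  then obtain k where k: "k > 0" "norm (exp (h *\<^sub>R F) ^ k) < 1" by blast
  then have "norm (exp ((real k * h) *\<^sub>R F)) < 1"
    using exp_real_scaleR[of k "h *\<^sub>R F"] by simp
  then show ?thesis using k h by (intro exI[of _ "real k * h"]) (auto simp: F_def)
qed

section \<open>Completeness of \<open>\<ell>\<^sup>2\<close> and existence of adjoints\<close>

lemma norm_ell2_sq: "(norm x)\<^sup>2 = (\<Sum>\<^sub>\<infinity>i. (cmod (coord x i))\<^sup>2)"
  by (simp add: norm_ell2_def infsum_nonneg)

lemma ell2_eqI: "(\<And>i. coord x i = coord y i) \<Longrightarrow> x = y"
  by (metis coord_inject ext)

lemma coord_minus: "coord (x - y) i = coord x i - coord y i"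
  unfolding minus_ell2_def plus_ell2.rep_eq uminus_ell2.rep_eq by simp

lemma coord_scaleR: "coord (r *\<^sub>R x) i = of_real r * coord x i"
  by (simp add: scaleR_ell2_def scaleC_ell2.rep_eq)

lemmas coord_simps = coord_minus coord_scaleR plus_ell2.rep_eq zero_ell2.rep_eq
  uminus_ell2.rep_eq scaleC_ell2.rep_eq

lemma sum_coord_sq_le: "finite F \<Longrightarrow> (\<Sum>i\<in>F. (cmod (coord x i))\<^sup>2) \<le> (norm x)\<^sup>2"
  unfolding norm_ell2_sq by (rule finite_sum_le_infsum[OF coord_square_summable]) auto

lemma cmod_coord_le: "cmod (coord x i) \<le> norm x"
proof (rule power2_le_imp_le)
  show "(cmod (coord x i))\<^sup>2 \<le> (norm x)\<^sup>2" using sum_coord_sq_le[of "{i}" x] by simp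
qed simp

lemma ell2_of_bounded_sums:
  assumes "\<And>F. finite F \<Longrightarrow> (\<Sum>i\<in>F. (cmod (f i))\<^sup>2) \<le> c\<^sup>2" "0 \<le> c"
  obtains x where "coord x = f" "norm x \<le> c"
proof -
  have s: "(\<lambda>i. (cmod (f i))\<^sup>2) summable_on UNIV"
    using assms(1) by (intro nonneg_bdd_above_summable_on) (auto intro!: bdd_aboveI2)
  then have c: "coord (Abs_ell2 f) = f" by (simp add: Abs_ell2_inverse)
  moreover have "(norm (Abs_ell2 f))\<^sup>2 \<le> c\<^sup>2"
    unfolding norm_ell2_sq c by (rule infsum_le_finite_sums[OF s]) (use assms in auto)
  then have "norm (Abs_ell2 f) \<le> c" by (rule power2_le_imp_le) fact
  ultimately show ?thesis by (rule that)
qed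

text \<open>Coordinates converge, and bounds on finite coordinate sums survive the pointwise limit;
  \<open>ell2_of_bounded_sums\<close> then yields both the limit vector and the norm
  estimate.\<close>

instance ell2 :: (type) banach
proof
  fix X :: "nat \<Rightarrow> 'a ell2"
  assume X: "Cauchy X"
  have "Cauchy (\<lambda>n. coord (X n) i)" for i
  proof (rule CauchyI)
    fix e :: real assume "0 < e"
    then obtain M where M: "\<And>m n. M \<le> m \<Longrightarrow> M \<le> n \<Longrightarrow> norm (X m - X n) < e"
      using CauchyD[OF X] by blast
    have "norm (coord (X m) i - coord (X n) i) < e" if "M \<le> m" "M \<le> n" for m n
      using le_less_trans[OF cmod_coord_le[of "X m - X n" i] M[OF that]] by (simp add: coord_minus)
    then show "\<exists>M. \<forall>m\<ge>M. \<forall>n\<ge>M. norm (coord (X m) i - coord (X n) i) < e" by blast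
  qed
  then have "convergent (\<lambda>n. coord (X n) i)" for i by (rule Cauchy_convergent)
  then obtain L where L: "\<And>i. (\<lambda>n. coord (X n) i) \<longlonglongrightarrow> L i"
    unfolding convergent_def by metis
  have lim: "\<exists>x M. coord x = L \<and> (\<forall>m\<ge>M. norm (X m - x) \<le> e)" if "0 < e" for e
  proof -
    obtain M where M: "\<And>m n. M \<le> m \<Longrightarrow> M \<le> n \<Longrightarrow> norm (X m - X n) < e"
      using CauchyD[OF X \<open>0 < e\<close>] by blast
    have ex: "\<exists>y. coord y = (\<lambda>i. coord (X m) i - L i) \<and> norm y \<le> e" if "M \<le> m" for m
    proof (rule ell2_of_bounded_sums)
      fix F :: "'a set" assume F: "finite F"
      have "(\<lambda>n. \<Sum>i\<in>F. (cmod (coord (X m) i - coord (X n) i))\<^sup>2) \<longlonglongrightarrow> (\<Sum>i\<in>F. (cmod (coord (X m) i - L i))\<^sup>2)"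
        by (intro tendsto_intros L)
      moreover have "(\<Sum>i\<in>F. (cmod (coord (X m) i - coord (X n) i))\<^sup>2) \<le> e\<^sup>2" if "M \<le> n" for n
        using order_trans[OF sum_coord_sq_le[OF F, of "X m - X n"] power_mono[of "norm (X m - X n)" e 2]]
          M[OF \<open>M \<le> m\<close> that] by (simp add: coord_minus)
      ultimately show "(\<Sum>i\<in>F. (cmod (coord (X m) i - L i))\<^sup>2) \<le> e\<^sup>2"
        by (intro LIMSEQ_le_const2) auto
    qed (use \<open>0 < e\<close> in auto)
    then obtain y where y: "coord y = (\<lambda>i. coord (X M) i - L i)" by blast
    have "coord (X M - y) = L" by (auto simp: coord_minus y)
    moreover have "norm (X m - (X M - y)) \<le> e" if m: "M \<le> m" for m
    proof -
      obtain z where z: "coord z = (\<lambda>i. coord (X m) i - L i)" "norm z \<le> e" using ex[OF m] by blast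
      have "X m - (X M - y) = z" by (rule ell2_eqI) (simp add: coord_minus y z)
      then show ?thesis using z by simp
    qed
    ultimately show ?thesis by blast
  qed
  obtain x where x: "coord x = L" using lim[of 1] by auto
  have "X \<longlonglongrightarrow> x"
  proof (rule LIMSEQ_I)
    fix r :: real assume "0 < r"
    then obtain x' M where x': "coord x' = L" and M: "\<And>m. M \<le> m \<Longrightarrow> norm (X m - x') \<le> r / 2"
      using lim[of "r / 2"] by auto
    have "x' = x" using x x' by (simp add: coord_inject[symmetric])
    then have "norm (X n - x) < r" if "M \<le> n" for n using M[OF that] \<open>0 < r\<close> by simp
    then show "\<exists>no. \<forall>n\<ge>no. norm (X n - x) < r" by blast
  qed
  then show "convergent X" by (auto simp: convergent_def)
qed

section \<open>Unit vectors, complex inner product and existence of adjoints\<close>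

lift_definition unit_ell2 :: "'i \<Rightarrow> 'i ell2" is "\<lambda>i j. if j = i then 1 else 0"
proof -
  fix i :: 'i
  show "(\<lambda>j. (cmod (if j = i then 1 else 0))\<^sup>2) summable_on UNIV"
    by (rule finite_nonzero_values_imp_summable_on) (rule finite_subset[of _ "{i}"], auto)
qed

instance ell2 :: (type) perfect_space
proof
  fix x :: "'a ell2"
  show "\<not> open {x}"
  proof
    assume "open {x}"
    then obtain e where e: "0 < e" "\<And>y. dist y x < e \<Longrightarrow> y = x"
      unfolding open_dist by auto
    define u where "u = (unit_ell2 undefined :: 'a ell2)"
    have "coord u undefined \<noteq> coord 0 undefined" by (simp add: u_def unit_ell2.rep_eq zero_ell2.rep_eq)
    then have u: "u \<noteq> 0" by metis
    have "dist (x + (e / 2 / norm u) *\<^sub>R u) x < e" using e(1) u by (simp add: dist_norm)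
    then have "x + (e / 2 / norm u) *\<^sub>R u = x" by (rule e(2))
    then show False using e(1) u by simp
  qed
qed

lemma cinner_commute: "cinner y x = cnj (cinner x y)"
  by (simp add: cinner_def mult.commute flip: infsum_cnj)

lemma cinner_scaleC_left: "cinner (c *\<^sub>C x) y = c * cinner x y"
  by (simp add: cinner_def scaleC_ell2.rep_eq mult.assoc infsum_cmult_right coord_mult_summable)

lemma cinner_add_left: "cinner (x + y) z = cinner x z + cinner y z"
  by (simp add: cinner_def plus_ell2.rep_eq distrib_right infsum_add coord_mult_summable)

text \<open>The imaginary part of a complex number is the real part of its product with
  \<open>- \<i>\<close>. Through this formula identities for the real inner product lift to
  \<open>cinner\<close> for complex linear operators.\<close>

lemma cinner_eq_inner: "cinner x y = Complex (x \<bullet> y) (((- \<i>) *\<^sub>C x) \<bullet> y)"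
  by (simp add: inner_ell2_def cinner_scaleC_left complex_eq_iff)

lemma cinner_unit: "cinner x (c *\<^sub>C unit_ell2 i) = coord x i * cnj c"
proof -
  have "cinner x (c *\<^sub>C unit_ell2 i) = (\<Sum>\<^sub>\<infinity>j\<in>{i}. coord x j * cnj c)"
    unfolding cinner_def
    by (rule infsum_cong_neutral) (auto simp: scaleC_ell2.rep_eq unit_ell2.rep_eq)
  then show ?thesis by simp
qed

lemma inner_unit: "x \<bullet> (c *\<^sub>C unit_ell2 i) = Re (coord x i * cnj c)"
  by (simp add: inner_ell2_def cinner_unit)

lemma cmod_sq: "(cmod z)\<^sup>2 = Re z * Re z + Im z * Im z"
  by (simp add: cmod_power2 flip: power2_eq_square)

lemma coord_sum_unit:
  assumes "finite F"
  shows "coord (\<Sum>i\<in>F. f i *\<^sub>C unit_ell2 i) j = (if j \<in> F then f j else 0)"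
  using assms by induction (auto simp: coord_simps unit_ell2.rep_eq)

lemma norm_sum_unit_sq:
  assumes "finite F"
  shows "(norm (\<Sum>i\<in>F. f i *\<^sub>C unit_ell2 i))\<^sup>2 = (\<Sum>i\<in>F. (cmod (f i))\<^sup>2)"
proof -
  have "(\<Sum>i\<in>F. f i *\<^sub>C unit_ell2 i) \<bullet> (\<Sum>i\<in>F. f i *\<^sub>C unit_ell2 i) = (\<Sum>i\<in>F. (cmod (f i))\<^sup>2)"
    unfolding inner_sum_right
    by (intro sum.cong) (auto simp: inner_unit coord_sum_unit assms cmod_sq)
  then show ?thesis by (simp only: power2_norm_eq_inner)
qed

text \<open>By orthogonality the squared distance from \<open>x\<close> to a finite section is the
  squared norm minus the finite coordinate sum.\<close>

lemma has_sum_unit_ell2: "((\<lambda>i. coord x i *\<^sub>C unit_ell2 i) has_sum x) UNIV"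
  unfolding has_sum_def
proof (rule LIM_zero_cancel, rule tendsto_norm_zero_cancel)
  let ?v = "\<lambda>F. \<Sum>i\<in>F. coord x i *\<^sub>C unit_ell2 i"
  have eq: "norm (?v F - x) = sqrt ((norm x)\<^sup>2 - (\<Sum>i\<in>F. (cmod (coord x i))\<^sup>2))" if F: "finite F" for F
  proof -
    have "x \<bullet> ?v F = (\<Sum>i\<in>F. (cmod (coord x i))\<^sup>2)"
      unfolding inner_sum_right
      by (intro sum.cong) (auto simp: inner_unit cmod_sq)
    then have "(norm (?v F - x))\<^sup>2 = (norm x)\<^sup>2 - (\<Sum>i\<in>F. (cmod (coord x i))\<^sup>2)"
      using norm_sum_unit_sq[OF F, of "coord x"]
      by (simp add: power2_norm_eq_inner inner_diff_left inner_diff_right inner_commute)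
    then show ?thesis by (metis norm_ge_zero real_sqrt_unique)
  qed
  have "((\<lambda>F. \<Sum>i\<in>F. (cmod (coord x i))\<^sup>2) \<longlongrightarrow> (norm x)\<^sup>2) (finite_subsets_at_top UNIV)"
    using has_sum_infsum[OF coord_square_summable[of x]] by (simp add: has_sum_def norm_ell2_sq)
  then have "((\<lambda>F. sqrt ((norm x)\<^sup>2 - (\<Sum>i\<in>F. (cmod (coord x i))\<^sup>2))) \<longlongrightarrow> sqrt ((norm x)\<^sup>2 - (norm x)\<^sup>2)) (finite_subsets_at_top UNIV)"
    by (intro tendsto_intros)
  moreover have "eventually (\<lambda>F. sqrt ((norm x)\<^sup>2 - (\<Sum>i\<in>F. (cmod (coord x i))\<^sup>2)) = norm (?v F - x)) (finite_subsets_at_top UNIV)"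
    by (rule eventually_finite_subsets_at_top_weakI) (simp add: eq)
  ultimately show "((\<lambda>F. norm (?v F - x)) \<longlongrightarrow> 0) (finite_subsets_at_top UNIV)"
    by (simp add: Lim_transform_eventually)
qed

text \<open>Phrased as commutation with scalars so that the commutant property of the square root
  transports complex linearity from an operator to its root.\<close>

definition clinear_endo :: "'i ell2 endo \<Rightarrow> bool" where
  "clinear_endo T \<longleftrightarrow> (\<forall>c. T * Endo (scale_op c) = Endo (scale_op c) * T)"

lemma ap_Endo [simp]: "ap (Endo T) x = blinfun_apply T x"
  by (simp add: ap.rep_eq Endo_inverse)

lemma ap_scale_op [simp]: "blinfun_apply (scale_op c) x = c *\<^sub>C x"
  by (simp add: scale_op.rep_eq)

lemma clinear_endo_iff: "clinear_endo T \<longleftrightarrow> (\<forall>c x. ap T (c *\<^sub>C x) = c *\<^sub>C ap T x)"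
proof -
  have "T * Endo (scale_op c) = Endo (scale_op c) * T \<longleftrightarrow> (\<forall>x. ap T (c *\<^sub>C x) = c *\<^sub>C ap T x)" for c
  proof
    assume "T * Endo (scale_op c) = Endo (scale_op c) * T"
    then have "ap (T * Endo (scale_op c)) x = ap (Endo (scale_op c) * T) x" for x by (rule arg_cong)
    then show "\<forall>x. ap T (c *\<^sub>C x) = c *\<^sub>C ap T x" by simp
  qed (auto intro: endo_eqI)
  then show ?thesis unfolding clinear_endo_def by blast
qed

lemma is_adj_cinner:
  assumes "clinear_endo T" "is_adj T S"
  shows "cinner (ap T x) y = cinner x (ap S y)"
proof -
  have "(- \<i>) *\<^sub>C ap T x = ap T ((- \<i>) *\<^sub>C x)" using assms(1) by (simp add: clinear_endo_iff)
  then show ?thesis by (simp only: cinner_eq_inner is_adjD[OF assms(2)])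
qed

text \<open>Coordinate \<open>i\<close> of the adjoint at \<open>y\<close> has to be
  \<open>f y i\<close>. Applying \<open>T\<close> to the finite vector with these coordinates, whose
  norm is \<open>sqrt s\<close>, bounds \<open>s\<close> by \<open>norm T * sqrt s * norm y\<close>,
  so the family is square summable. The adjoint identity holds on multiples of unit vectors and
  extends by continuity.\<close>

lemma adj_exists:
  assumes "clinear_endo T"
  shows "\<exists>S. is_adj T S"
proof -
  have lin: "ap T (c *\<^sub>C x) = c *\<^sub>C ap T x" for c x using assms by (simp add: clinear_endo_iff)
  define f where "f y i = cnj (cinner (ap T (unit_ell2 i)) y)" for y i
  have le: "(\<Sum>i\<in>F. (cmod (f y i))\<^sup>2) \<le> (norm T * norm y)\<^sup>2" if F: "finite F" for F y
  proof -
    define s where "s = (\<Sum>i\<in>F. (cmod (f y i))\<^sup>2)"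
    let ?v = "\<Sum>i\<in>F. f y i *\<^sub>C unit_ell2 i"
    have s0: "0 \<le> s" by (simp add: s_def sum_nonneg)
    have nv: "norm ?v = sqrt s" using norm_sum_unit_sq[OF F, of "f y"] by (metis s_def norm_ge_zero real_sqrt_unique)
    have "ap T ?v \<bullet> y = (\<Sum>i\<in>F. Re (cinner (f y i *\<^sub>C ap T (unit_ell2 i)) y))"
      by (simp only: ap.sum_right inner_sum_left lin) (simp only: inner_ell2_def)
    also have "\<dots> = s"
      unfolding s_def
      by (intro sum.cong) (auto simp: cinner_scaleC_left f_def cmod_sq)
    finally have "s = ap T ?v \<bullet> y" ..
    also have "\<dots> \<le> (norm T * norm ?v) * norm y"
      by (rule order_trans[OF norm_cauchy_schwarz]) (intro mult_right_mono norm_ap, simp)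
    finally have le: "sqrt s * sqrt s \<le> (norm T * norm y) * sqrt s"
      using s0 by (simp add: nv mult_ac)
    have "sqrt s \<le> norm T * norm y"
    proof (cases "s = 0")
      case False
      then have "0 < sqrt s" using s0 by simp
      with le show ?thesis by (rule mult_right_le_imp_le)
    qed simp
    then have "(sqrt s)\<^sup>2 \<le> (norm T * norm y)\<^sup>2" by (rule power_mono) (simp add: s0)
    then show ?thesis using s0 by (simp add: s_def)
  qed
  have "\<exists>z. coord z = f y \<and> norm z \<le> norm T * norm y" for y
    by (rule ell2_of_bounded_sums[of "f y" "norm T * norm y"]) (use le in auto)
  then obtain g where g: "\<And>y. coord (g y) = f y" "\<And>y. norm (g y) \<le> norm T * norm y" by metis
  have "bounded_linear g"
  proof (rule bounded_linear_intro)
    show "g (x + y) = g x + g y" for x y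
    proof (rule ell2_eqI)
      fix i
      have "cinner z (x + y) = cinner z x + cinner z y" for z
        by (metis cinner_add_left cinner_commute complex_cnj_add)
      then show "coord (g (x + y)) i = coord (g x + g y) i" by (simp add: g f_def coord_simps)
    qed
    show "g (r *\<^sub>R x) = r *\<^sub>R g x" for r x
    proof (rule ell2_eqI)
      fix i
      have "cinner z (r *\<^sub>R x) = of_real r * cinner z x" for z
        unfolding scaleR_ell2_def by (metis cinner_scaleC_left cinner_commute complex_cnj_mult complex_cnj_complex_of_real)
      then show "coord (g (r *\<^sub>R x)) i = coord (r *\<^sub>R g x) i" by (simp add: g f_def coord_simps)
    qed
    show "norm (g x) \<le> norm x * norm T" for x using g(2)[of x] by (simp add: mult.commute)
  qed
  then have ap_g: "ap (mk_endo g) = g" by (rule ap_mk_endo)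
  have "ap T x \<bullet> y = x \<bullet> g y" for x y
  proof -
    have 1: "((\<lambda>i. ap T (coord x i *\<^sub>C unit_ell2 i) \<bullet> y) has_sum (ap T x \<bullet> y)) UNIV"
      by (rule has_sum_bounded_linear[OF bounded_linear_compose[OF bounded_linear_inner_left ap.bounded_linear_right] has_sum_unit_ell2])
    have 2: "((\<lambda>i. coord x i *\<^sub>C unit_ell2 i \<bullet> g y) has_sum (x \<bullet> g y)) UNIV"
      by (rule has_sum_bounded_linear[OF bounded_linear_inner_left has_sum_unit_ell2])
    have "ap T (c *\<^sub>C unit_ell2 i) \<bullet> y = c *\<^sub>C unit_ell2 i \<bullet> g y" for c i
      unfolding lin inner_commute[of "c *\<^sub>C unit_ell2 i"] inner_unit g f_def
      by (simp add: inner_ell2_def cinner_scaleC_left)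
    then show ?thesis using 1 2 by (simp add: infsumI[symmetric] has_sum_unique)
  qed
  then have "is_adj T (mk_endo g)" by (simp add: is_adj_def ap_g)
  then show ?thesis by blast
qed

section \<open>Operators on \<open>\<ell>\<^sup>2(G)\<close> as endomorphisms\<close>

lemma Endo_mult: "Endo (S \<cdot> T) = Endo S * Endo T"
  by (rule endo_eqI) simp

lemma Endo_linear_simps:
  "Endo (S + T) = Endo S + Endo T" "Endo (S - T) = Endo S - Endo T"
  "Endo 0 = 0" "Endo (r *\<^sub>R S) = r *\<^sub>R Endo S"
  by (rule endo_eqI; simp add: blinfun.bilinear_simps)+

lemmas Endo_simps = Endo_mult Endo_linear_simps

lemma Endo_op_of [simp]: "Endo (op_of T) = T" "op_of (Endo S) = S"
  by (simp_all add: op_of_inverse Endo_inverse)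

lemma norm_Endo [simp]: "norm (Endo T) = norm T" "norm (op_of S) = norm S"
  by (simp_all add: norm_endo.rep_eq Endo_inverse)

lemma bounded_linear_op_of: "bounded_linear op_of"
  by (rule bounded_linear_intro[where K = 1])
    (simp_all add: plus_endo.rep_eq scaleR_endo.rep_eq)

abbreviation prj :: "'i set \<Rightarrow> 'i ell2 endo" where
  "prj G \<equiv> Endo (proj_op G)"

lemma ap_prj: "ap (prj G) x = restrict_ell2 G x"
  by (simp add: proj_op.rep_eq)

lemma coord_prj: "coord (ap (prj G) x) i = (if i \<in> G then coord x i else 0)"
  unfolding ap_prj by (simp add: restrict_ell2.rep_eq)

lemma prj_idem [simp]: "prj G * prj G = prj G"
  by (intro endo_eqI ell2_eqI) (simp add: coord_prj del: ap_Endo)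

lemma prj_idem_left [simp]: "prj G * (prj G * w) = prj G * w"
  unfolding mult.assoc[symmetric] by simp

lemma is_adj_prj: "is_adj (prj G) (prj G)"
proof -
  have "cinner (ap (prj G) x) y = cinner x (ap (prj G) y)" for x y
    unfolding cinner_def coord_prj by (intro infsum_cong) auto
  then show ?thesis by (simp add: is_adj_def inner_ell2_def del: ap_Endo)
qed

lemma clinear_prj: "clinear_endo (prj G)"
  unfolding clinear_endo_iff by (auto intro!: ell2_eqI simp: coord_prj scaleC_ell2.rep_eq simp del: ap_Endo)

lemma prj_in_ell2_on: "ap (prj G) x \<in> ell2_on G"
  by (simp add: ell2_on_def coord_prj del: ap_Endo)

lemma clinear_mult: "clinear_endo S \<Longrightarrow> clinear_endo T \<Longrightarrow> clinear_endo (S * T)"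
  by (simp add: clinear_endo_iff)

lemma inner_prj: "ap (prj G) x \<bullet> x = (norm (ap (prj G) x))\<^sup>2"
  using is_adjD[OF is_adj_prj, of G "ap (prj G) x" x]
  by (simp add: inner_commute power2_norm_eq_inner del: ap_Endo flip: ap_mult)

lemma posop_prj: "posop (prj G)"
  unfolding posop_def inner_prj by (simp add: is_adj_prj)

lemma posop_one_minus_prj: "posop (1 - prj G)"
proof -
  have "ap (prj G) x \<bullet> x \<le> x \<bullet> x" for x
  proof -
    have "(norm (ap (prj G) x))\<^sup>2 \<le> norm (ap (prj G) x) * norm x"
      using norm_cauchy_schwarz[of "ap (prj G) x" x] by (simp only: inner_prj)
    then have "norm (ap (prj G) x) \<le> norm x"
      by (cases "norm (ap (prj G) x) = 0") (simp_all add: power2_eq_square del: ap_Endo)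
    then have "(norm (ap (prj G) x))\<^sup>2 \<le> (norm x)\<^sup>2" by (rule power_mono) simp
    then show ?thesis by (simp only: inner_prj power2_norm_eq_inner)
  qed
  then show ?thesis
    unfolding posop_def by (intro conjI is_adj_diff is_adj_one is_adj_prj) (simp add: inner_diff_left del: ap_Endo)
qed

lemma norm_prj_le: "norm (prj G) \<le> 1" "norm (1 - prj G) \<le> 1"
proof -
  show "norm (prj G) \<le> 1"
    using posop_one_minus_prj[of G]
    by (intro posop_norm_le posop_prj) (simp_all add: posop_def inner_diff_left power2_norm_eq_inner del: ap_Endo)
  show "norm (1 - prj G) \<le> 1"
    using posop_prj[of G]
    by (intro posop_norm_le posop_one_minus_prj) (simp_all add: posop_def inner_diff_left power2_norm_eq_inner del: ap_Endo)
qed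

lemma bounded_ops_iff:
  "T \<in> bounded_ops G \<longleftrightarrow> clinear_endo (Endo T) \<and> prj G * Endo T * prj G = Endo T"
  by (simp add: bounded_ops_def clinear_endo_iff Endo_inject flip: Endo_simps)

lemma bounded_ops_corner:
  assumes "T \<in> bounded_ops G"
  shows "prj G * Endo T = Endo T" "Endo T * prj G = Endo T"
proof -
  have e: "Endo T = prj G * Endo T * prj G" using assms by (simp add: bounded_ops_iff)
  show "prj G * Endo T = Endo T" by (subst (1 2) e) (simp add: mult.assoc)
  show "Endo T * prj G = Endo T" by (subst (1 2) e) (simp add: mult.assoc)
qed

lemma op_adj_eqI:
  assumes "clinear_endo (Endo T)" "is_adj (Endo T) (Endo S)"
  shows "op_adj T = S"
  unfolding op_adj_def
proof (rule the_equality)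
  show "\<forall>x y. cinner (blinfun_apply T x) y = cinner x (blinfun_apply S y)"
    using is_adj_cinner[OF assms] by simp
  fix S' assume "\<forall>x y. cinner (blinfun_apply T x) y = cinner x (blinfun_apply S' y)"
  then have "is_adj (Endo T) (Endo S')" by (simp add: is_adj_def inner_ell2_def)
  then have "Endo S = Endo S'" by (rule is_adj_unique[OF assms(2)])
  then show "S' = S" by (simp add: Endo_inject)
qed

lemma is_adj_op_adj:
  assumes "T \<in> bounded_ops G"
  shows "is_adj (Endo T) (Endo (op_adj T))"
proof -
  have c: "clinear_endo (Endo T)" using assms by (simp add: bounded_ops_iff)
  then obtain S where S: "is_adj (Endo T) S" using adj_exists by blast
  then have "op_adj T = op_of S" using op_adj_eqI[OF c, of "op_of S"] by simp
  then show ?thesis using S by simp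
qed

lemma self_adjoint_iff:
  "self_adjoint G T \<longleftrightarrow> T \<in> bounded_ops G \<and> is_adj (Endo T) (Endo T)"
  using is_adj_op_adj[of T G] op_adj_eqI[of T T] by (auto simp: self_adjoint_def bounded_ops_iff)

lemma positive_op_iff:
  "positive_op G T \<longleftrightarrow> T \<in> bounded_ops G \<and> posop (Endo T)"
proof
  assume T: "positive_op G T"
  then have b: "T \<in> bounded_ops G" and a: "is_adj (Endo T) (Endo T)"
    and p: "\<And>x. x \<in> ell2_on G \<Longrightarrow> 0 \<le> ap (Endo T) x \<bullet> x"
    by (simp_all add: positive_op_def self_adjoint_iff inner_ell2_def)
  have "ap (Endo T) x \<bullet> x = ap (Endo T) (ap (prj G) x) \<bullet> ap (prj G) x" for x
    using is_adjD[OF is_adj_prj, of G "ap (Endo T * prj G) x" x] bounded_ops_corner[OF b]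
    by (simp del: ap_Endo flip: ap_mult)
  then have "0 \<le> ap (Endo T) x \<bullet> x" for x using p[OF prj_in_ell2_on[of G x]] by metis
  then show "T \<in> bounded_ops G \<and> posop (Endo T)" using a b unfolding posop_def by blast
qed (simp add: positive_op_def self_adjoint_iff posop_def inner_ell2_def)

text \<open>Coercivity is given only on \<open>ell2_on G\<close>. Adding the complementary
  projection supplies the constant 1 on the complement, whence \<open>min c 1\<close> on the whole
  space.\<close>

lemma strictly_positive_op_coercive:
  assumes "strictly_positive_op G T"
  shows "positive_op G T" "\<exists>c>0. \<forall>x. c * (norm x)\<^sup>2 \<le> ap (Endo T + (1 - prj G)) x \<bullet> x"
proof -
  from assms obtain c where sa: "self_adjoint G T" and c: "0 < c"
    "\<And>x. x \<in> ell2_on G \<Longrightarrow> c * (norm x)\<^sup>2 \<le> ap (Endo T) x \<bullet> x"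
    by (auto simp: strictly_positive_op_def inner_ell2_def)
  have b: "T \<in> bounded_ops G" using sa by (simp add: self_adjoint_def)
  have "0 \<le> ap (Endo T) x \<bullet> x" if "x \<in> ell2_on G" for x
    using order_trans[OF _ c(2)[OF that], of 0] c(1) by simp
  then show "positive_op G T"
    using sa by (simp add: positive_op_def inner_ell2_def)
  have e: "ap (Endo T) x \<bullet> x = ap (Endo T) (ap (prj G) x) \<bullet> ap (prj G) x" for x
    using is_adjD[OF is_adj_prj, of G "ap (Endo T * prj G) x" x] bounded_ops_corner[OF b]
    by (simp del: ap_Endo flip: ap_mult)
  have "min c 1 * (norm x)\<^sup>2 \<le> ap (Endo T + (1 - prj G)) x \<bullet> x" for x
  proof -
    have p: "0 \<le> ap (prj G) x \<bullet> x" "0 \<le> ap (1 - prj G) x \<bullet> x"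
      using posop_prj posop_one_minus_prj unfolding posop_def by blast+
    have "(norm x)\<^sup>2 = ap (prj G) x \<bullet> x + ap (1 - prj G) x \<bullet> x"
      by (simp add: power2_norm_eq_inner inner_diff_left del: ap_Endo)
    then have "min c 1 * (norm x)\<^sup>2 = min c 1 * (ap (prj G) x \<bullet> x) + min c 1 * (ap (1 - prj G) x \<bullet> x)"
      by (simp only: distrib_left)
    also have "\<dots> \<le> c * (ap (prj G) x \<bullet> x) + 1 * (ap (1 - prj G) x \<bullet> x)"
      using p by (intro add_mono mult_right_mono) auto
    also have "c * (ap (prj G) x \<bullet> x) \<le> ap (Endo T) x \<bullet> x"
      unfolding e[of x] inner_prj by (rule c(2)[OF prj_in_ell2_on])
    finally show ?thesis by (simp add: inner_add_left del: ap_Endo)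
  qed
  then show "\<exists>c>0. \<forall>x. c * (norm x)\<^sup>2 \<le> ap (Endo T + (1 - prj G)) x \<bullet> x"
    using c(1) by (intro exI[of _ "min c 1"]) auto
qed

lemma op_inv_eqI:
  assumes "is_op_inverse G T S"
  shows "op_inv G T = S"
  unfolding op_inv_def
proof (rule the_equality[where P = "is_op_inverse G T", OF assms])
  fix S' assume S': "is_op_inverse G T S'"
  have i: "Endo T * Endo S = prj G" "Endo S' * Endo T = prj G"
    "Endo S' * prj G = Endo S'" "prj G * Endo S = Endo S"
    using assms S' bounded_ops_corner unfolding is_op_inverse_def by (auto simp flip: Endo_mult)
  have "Endo S' = Endo S' * (Endo T * Endo S)" using i by simp
  also have "\<dots> = (Endo S' * Endo T) * Endo S" by (simp only: mult.assoc)
  also have "\<dots> = prj G * Endo S" by (simp only: i)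
  also have "\<dots> = Endo S" by (simp only: i)
  finally show "S' = S" by (simp add: Endo_inject)
qed

section \<open>Square roots of positive operators\<close>

lemma gbinomial_Suc_ratio: "((a :: real) gchoose Suc n) = (a gchoose n) * ((a - real n) / real (Suc n))"
  by (simp add: gbinomial_prod_rev field_simps)

lemma gbinomial_half_sign: "(-1) ^ Suc n * ((1 / 2 :: real) gchoose Suc n) \<le> 0"
proof (induction n)
  case (Suc n)
  have "(-1) ^ Suc (Suc n) * ((1 / 2 :: real) gchoose Suc (Suc n)) =
      ((-1) ^ Suc n * ((1 / 2) gchoose Suc n)) * (- ((1 / 2 - real (Suc n)) / real (Suc (Suc n))))"
    unfolding gbinomial_Suc_ratio[of _ "Suc n"] power_Suc[of _ "Suc n"] by (simp only: mult_minus1 mult_minus_left mult_minus_right mult.assoc)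
  also have "\<dots> \<le> 0" by (rule mult_nonpos_nonneg[OF Suc]) (simp add: divide_le_0_iff)
  finally show ?case .
qed simp

lemma gbinomial_minus_half_sign: "0 \<le> (-1) ^ n * ((- 1 / 2 :: real) gchoose n)"
proof (induction n)
  case (Suc n)
  have "(-1) ^ Suc n * ((- 1 / 2 :: real) gchoose Suc n) =
      ((-1) ^ n * ((- 1 / 2) gchoose n)) * (- ((- 1 / 2 - real n) / real (Suc n)))"
    unfolding gbinomial_Suc_ratio power_Suc by (simp only: mult_minus1 mult_minus_left mult_minus_right mult.assoc)
  also have "0 \<le> \<dots>" by (rule mult_nonneg_nonneg[OF Suc]) (simp add: divide_le_0_iff)
  finally show ?case .
qed simp

text \<open>From index 1 on, the coefficients of the square root series at -1 all have the same
  sign, and its partial sums equal up to sign binomial coefficients of -1/2, which the sign lemma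
  makes nonnegative. Hence the absolute values sum to at most 1.\<close>

lemma gbinomial_half_abs_summable:
  shows "summable (\<lambda>n. \<bar>(1 / 2 :: real) gchoose Suc n\<bar>)"
    and "(\<Sum>n. \<bar>(1 / 2 :: real) gchoose Suc n\<bar>) \<le> 1"
proof -
  have abs: "\<bar>(1 / 2 :: real) gchoose Suc n\<bar> = - ((-1) ^ Suc n * ((1 / 2) gchoose Suc n))" for n
  proof -
    have "\<bar>(1 / 2 :: real) gchoose Suc n\<bar> = \<bar>(-1) ^ Suc n * ((1 / 2) gchoose Suc n)\<bar>"
      by (simp add: abs_mult power_abs)
    then show ?thesis using gbinomial_half_sign[of n] by simp
  qed
  have le: "(\<Sum>k<n. \<bar>(1 / 2 :: real) gchoose Suc k\<bar>) \<le> 1" for n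
  proof -
    have "(\<Sum>k\<le>n. ((1 / 2 :: real) gchoose k) * (-1) ^ k) = 1 + (\<Sum>k<n. ((1 / 2) gchoose Suc k) * (-1) ^ Suc k)"
      by (subst sum.atMost_shift) simp
    also have "(\<Sum>k<n. ((1 / 2 :: real) gchoose Suc k) * (-1) ^ Suc k) = - (\<Sum>k<n. \<bar>(1 / 2 :: real) gchoose Suc k\<bar>)"
      unfolding abs by (simp add: sum_negf mult.commute)
    finally show ?thesis
      using gbinomial_sum_lower_neg[of "1 / 2 :: real" n] gbinomial_minus_half_sign[of n] by simp
  qed
  show s: "summable (\<lambda>n. \<bar>(1 / 2 :: real) gchoose Suc n\<bar>)"
    by (rule summableI_nonneg_bounded[OF _ le]) simp
  show "(\<Sum>n. \<bar>(1 / 2 :: real) gchoose Suc n\<bar>) \<le> 1"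
    by (rule suminf_le_const[OF s le])
qed

text \<open>Absolute summability of the coefficients gives convergence on the closed unit ball; the
  boundary is needed because the operators whose roots are taken need not be coercive. Exponent 1
  makes the product series stop after two terms.\<close>

lemma binomial_series_half:
  fixes x :: "'a::{real_normed_algebra_1, banach}"
  assumes "norm x \<le> 1"
  shows "summable (\<lambda>n. norm (((1 / 2) gchoose n) *\<^sub>R x ^ n))"
    and "binomial_series (1 / 2) x * binomial_series (1 / 2) x = 1 + x"
proof -
  have "norm (norm (((1 / 2) gchoose Suc n) *\<^sub>R x ^ Suc n)) \<le> \<bar>(1 / 2 :: real) gchoose Suc n\<bar>" for n
  proof -
    have "norm (x ^ Suc n) \<le> 1"
      using norm_power_ineq[of x "Suc n"] power_le_one[of "norm x" "Suc n"] assms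
      by (meson norm_ge_zero order_trans)
    then show ?thesis by (simp add: mult_left_le del: power_Suc)
  qed
  then have "summable (\<lambda>n. norm (((1 / 2) gchoose Suc n) *\<^sub>R x ^ Suc n))"
    by (rule summable_comparison_test'[OF gbinomial_half_abs_summable(1)])
  then show s: "summable (\<lambda>n. norm (((1 / 2) gchoose n) *\<^sub>R x ^ n))"
    by (subst (asm) summable_Suc_iff)
  have "(\<lambda>n. ((1 / 2 + 1 / 2 :: real) gchoose n) *\<^sub>R x ^ n) sums (binomial_series (1 / 2) x * binomial_series (1 / 2) x)"
    by (rule binomial_series_mult[OF s s])
  moreover have "(\<lambda>n. ((1 / 2 + 1 / 2 :: real) gchoose n) *\<^sub>R x ^ n) sums (\<Sum>n\<in>{0, 1}. ((1 / 2 + 1 / 2 :: real) gchoose n) *\<^sub>R x ^ n)"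
  proof (rule sums_finite)
    fix n :: nat assume "n \<notin> {0, 1}"
    then have "((1 :: real) gchoose n) = 0"
      using binomial_gbinomial[of 1 n, where 'a = real] by (simp add: binomial_eq_0)
    then show "((1 / 2 + 1 / 2 :: real) gchoose n) *\<^sub>R x ^ n = 0" by simp
  qed simp
  ultimately show "binomial_series (1 / 2) x * binomial_series (1 / 2) x = 1 + x"
    using sums_unique2 by fastforce
qed

text \<open>The constant term contributes the squared norm of \<open>x\<close>, and the remaining
  coefficients, of total absolute value at most 1, cannot take away more than that.\<close>

lemma posop_binomial_series_half:
  fixes z :: "'a::{real_inner, banach, perfect_space} endo"
  assumes "is_adj z z" "norm z \<le> 1"
  shows "posop (binomial_series (1 / 2) z)"
  unfolding posop_def
proof (intro conjI allI)
  let ?c = "\<lambda>n. (1 / 2 :: real) gchoose n" and ?B = "binomial_series (1 / 2) z"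
  have n: "summable (\<lambda>n. norm (?c n *\<^sub>R z ^ n))" by (rule binomial_series_half(1)[OF assms(2)])
  then have s: "(\<lambda>n. ?c n *\<^sub>R z ^ n) sums ?B"
    unfolding binomial_series_def by (rule summable_sums[OF summable_norm_cancel])
  show "is_adj (?B) (?B)"
    by (rule is_adj_sums[OF _ s s]) (intro is_adj_scaleR is_adj_power assms)
  fix x
  have "(\<lambda>n. ap (?c n *\<^sub>R z ^ n) x \<bullet> x) sums (ap (?B) x \<bullet> x)"
    by (rule bounded_linear.sums[OF bounded_linear_compose[OF bounded_linear_inner_left ap.bounded_linear_left] s])
  then have 1: "(\<lambda>n. ap (?c (Suc n) *\<^sub>R z ^ Suc n) x \<bullet> x) sums (ap (?B) x \<bullet> x - x \<bullet> x)"
    using sums_Suc_iff[of "\<lambda>n. ap (?c n *\<^sub>R z ^ n) x \<bullet> x" "ap (?B) x \<bullet> x - x \<bullet> x"]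
    by simp
  have 2: "(\<lambda>n. - (\<bar>?c (Suc n)\<bar> * (norm x)\<^sup>2)) sums (- ((\<Sum>n. \<bar>?c (Suc n)\<bar>) * (norm x)\<^sup>2))"
    by (intro sums_minus sums_mult2 summable_sums gbinomial_half_abs_summable)
  have "- (\<bar>?c (Suc n)\<bar> * (norm x)\<^sup>2) \<le> ap (?c (Suc n) *\<^sub>R z ^ Suc n) x \<bullet> x" for n
  proof -
    have "norm (z ^ Suc n) \<le> 1"
      using norm_power_ineq[of z "Suc n"] power_le_one[of "norm z" "Suc n"] assms(2)
      by (meson norm_ge_zero order_trans)
    then have "norm (z ^ Suc n) * (norm x)\<^sup>2 \<le> 1 * (norm x)\<^sup>2" by (rule mult_right_mono) simp
    moreover have "\<bar>ap (z ^ Suc n) x \<bullet> x\<bar> \<le> norm (z ^ Suc n) * (norm x)\<^sup>2"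
      using inner_ap_le_norm[of "z ^ Suc n" x] inner_ap_le_norm[of "- (z ^ Suc n)" x]
      by (simp add: abs_le_iff del: power_Suc)
    ultimately have "\<bar>?c (Suc n)\<bar> * \<bar>ap (z ^ Suc n) x \<bullet> x\<bar> \<le> \<bar>?c (Suc n)\<bar> * (norm x)\<^sup>2"
      by (intro mult_left_mono) auto
    then show ?thesis by (simp add: abs_mult[symmetric] abs_le_iff del: power_Suc)
  qed
  then have "- ((\<Sum>n. \<bar>?c (Suc n)\<bar>) * (norm x)\<^sup>2) \<le> ap (?B) x \<bullet> x - x \<bullet> x"
    by (rule sums_le[OF _ 2 1])
  moreover have "(\<Sum>n. \<bar>?c (Suc n)\<bar>) * (norm x)\<^sup>2 \<le> 1 * (norm x)\<^sup>2"
    by (rule mult_right_mono[OF gbinomial_half_abs_summable(2)]) simp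
  ultimately show "0 \<le> ap (?B) x \<bullet> x" by (simp add: power2_norm_eq_inner)
qed

text \<open>Write \<open>T\<close> as \<open>c\<close> times \<open>1 - z\<close>, with the form of
  \<open>z\<close> between 0 and that of the identity, and take \<open>sqrt c\<close> times the
  square root series at \<open>- z\<close>. Being a power series in \<open>T\<close>, the root
  commutes with everything that commutes with \<open>T\<close>. The summand 1 in \<open>c\<close>
  covers \<open>T = 0\<close>.\<close>

lemma posop_sqrt_exists:
  fixes T :: "'a::{real_inner, banach, perfect_space} endo"
  assumes "posop T"
  obtains S where "posop S" "S * S = T" "\<And>W. W * T = T * W \<Longrightarrow> W * S = S * W"
proof -
  define c where "c = norm T + 1"
  have c: "0 < c" by (simp add: c_def add_nonneg_pos)
  define z where "z = 1 - (1 / c) *\<^sub>R T"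
  have Tx: "0 \<le> ap T x \<bullet> x" "ap T x \<bullet> x \<le> c * (x \<bullet> x)" for x
    using assms order_trans[OF inner_ap_le_norm[of T x], of "c * (norm x)\<^sup>2"]
    by (auto simp: posop_def c_def power2_norm_eq_inner mult_right_mono)
  have az: "is_adj z z"
    using assms unfolding z_def posop_def by (intro is_adj_diff is_adj_one is_adj_scaleR) auto
  have "posop z"
    unfolding posop_def using Tx c az by (auto simp: z_def inner_diff_left field_simps)
  moreover have "ap z x \<bullet> x \<le> 1 * (norm x)\<^sup>2" for x
    using Tx c by (simp add: z_def inner_diff_left power2_norm_eq_inner)
  ultimately have nz: "norm z \<le> 1" by (intro posop_norm_le) auto
  let ?B = "binomial_series (1 / 2) (- z)"
  have n: "norm (- z) \<le> 1" using nz by simp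
  show ?thesis
  proof (rule that[of "sqrt c *\<^sub>R ?B"])
    have "posop ?B" by (rule posop_binomial_series_half[OF is_adj_minus[OF az] n])
    then show "posop (sqrt c *\<^sub>R ?B)"
      unfolding posop_def using c by (auto intro: is_adj_scaleR)
    have "(sqrt c *\<^sub>R ?B) * (sqrt c *\<^sub>R ?B) = c *\<^sub>R (?B * ?B)" using c by simp
    also have "?B * ?B = (1 / c) *\<^sub>R T" unfolding binomial_series_half(2)[OF n] by (simp add: z_def)
    finally show "(sqrt c *\<^sub>R ?B) * (sqrt c *\<^sub>R ?B) = T" using c by simp
    show "W * (sqrt c *\<^sub>R ?B) = (sqrt c *\<^sub>R ?B) * W" if "W * T = T * W" for W
      using binomial_series_commute[OF binomial_series_half(1)[OF n], of W] that
      by (simp add: z_def algebra_simps)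
  qed
qed

text \<open>On \<open>d\<close>, the image of \<open>x\<close> under \<open>C - S\<close>, the sum
  \<open>C + S\<close> vanishes, so both nonnegative forms vanish at \<open>d\<close> and both
  operators kill \<open>d\<close>. Then \<open>C - S\<close> kills \<open>d\<close>, and
  self-adjointness gives \<open>d \<bullet> d = 0\<close>.\<close>

lemma posop_sqrt_unique:
  fixes S C :: "'a::{real_inner, perfect_space} endo"
  assumes "posop S" "posop C" "S * S = C * C" "C * S = S * C"
  shows "C = S"
proof (rule endo_eqI)
  fix x
  define d where "d = ap (C - S) x"
  have sum: "ap (C + S) d = 0"
  proof -
    have "(C + S) * (C - S) = 0" using assms(3,4) by (simp add: algebra_simps)
    then show ?thesis unfolding d_def by (metis ap_mult ap.zero_left)
  qed
  then have "ap C d \<bullet> d + ap S d \<bullet> d = 0" by (metis ap.add_left inner_add_left inner_zero_left)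
  moreover have "0 \<le> ap C d \<bullet> d" "0 \<le> ap S d \<bullet> d" using assms by (auto simp: posop_def)
  ultimately have "ap C d \<bullet> d = 0" "ap S d \<bullet> d = 0" by linarith+
  then have "ap C d = 0" "ap S d = 0"
    using posop_norm_ap_le_norm[OF assms(1), of d] posop_norm_ap_le_norm[OF assms(2), of d] by auto
  then have "ap (C - S) d = 0" by simp
  moreover have "is_adj (C - S) (C - S)" using assms by (intro is_adj_diff) (auto simp: posop_def)
  ultimately have "d \<bullet> d = 0" unfolding d_def by (metis is_adjD inner_zero_right)
  then show "ap C x = ap S x" by (simp add: d_def)
qed

text \<open>The root on the whole space commutes with the projection and with complex scalars, so it
  compresses to an operator on \<open>ell2_on G\<close>. Any other positive root commutes with its
  own square \<open>T\<close>, hence with this one, and uniqueness applies.\<close>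

lemma op_sqrt:
  assumes "positive_op G T"
  shows "positive_op G (op_sqrt G T)" "op_sqrt G T \<cdot> op_sqrt G T = T"
proof -
  have T: "T \<in> bounded_ops G" "posop (Endo T)" using assms by (simp_all add: positive_op_iff)
  note corner = bounded_ops_corner[OF T(1)]
  obtain B where B: "posop B" "B * B = Endo T" "\<And>W. W * Endo T = Endo T * W \<Longrightarrow> W * B = B * W"
    using posop_sqrt_exists[OF T(2)] by metis
  have PB: "prj G * B = B * prj G" by (rule B(3)) (simp add: corner)
  have JB: "B * Endo (scale_op c) = Endo (scale_op c) * B" for c
    using B(3)[of "Endo (scale_op c)"] T(1) by (simp add: bounded_ops_iff clinear_endo_def)
  define S where "S = B * prj G"
  have PS: "prj G * S = S" "S * prj G = S"
  proof -
    have "prj G * S = (prj G * B) * prj G" by (simp only: S_def mult.assoc)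
    also have "\<dots> = (B * prj G) * prj G" by (simp only: PB)
    finally show "prj G * S = S" by (simp only: S_def mult.assoc prj_idem)
    show "S * prj G = S" by (simp only: S_def mult.assoc prj_idem)
  qed
  have SS: "S * S = Endo T"
  proof -
    have "S * S = B * (prj G * B) * prj G" by (simp add: S_def mult.assoc)
    also have "\<dots> = B * B * prj G" unfolding PB by (simp add: mult.assoc)
    finally show ?thesis by (simp add: B corner)
  qed
  have "posop S"
    unfolding posop_def
  proof (intro conjI allI)
    have "is_adj (B * prj G) (prj G * B)"
      using B(1) by (intro is_adj_mult is_adj_prj) (simp add: posop_def)
    then show "is_adj S S" by (simp add: S_def PB)
    fix x
    have "ap S x = ap (prj G * S) x" by (simp only: PS)
    then have "ap S x = ap (prj G) (ap B (ap (prj G) x))" by (simp only: S_def ap_mult)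
    then have "ap S x \<bullet> x = ap B (ap (prj G) x) \<bullet> ap (prj G) x"
      using is_adjD[OF is_adj_prj] by metis
    then show "0 \<le> ap S x \<bullet> x" using B(1) by (simp add: posop_def)
  qed
  moreover have "op_of S \<in> bounded_ops G"
  proof -
    have "clinear_endo S" unfolding S_def using JB by (intro clinear_mult clinear_prj) (simp add: clinear_endo_def)
    moreover have "prj G * S * prj G = S" by (simp only: PS)
    ultimately show ?thesis by (simp add: bounded_ops_iff)
  qed
  ultimately have S: "positive_op G (op_of S) \<and> op_of S \<cdot> op_of S = T"
    using SS by (simp add: positive_op_iff Endo_inject[symmetric] Endo_simps)
  have "op_sqrt G T = op_of S"
    unfolding op_sqrt_def
  proof (rule the_equality[where P = "\<lambda>S. positive_op G S \<and> S \<cdot> S = T", OF S])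
    fix C assume C: "positive_op G C \<and> C \<cdot> C = T"
    then have b: "C \<in> bounded_ops G" and p: "posop (Endo C)" and CC: "Endo C * Endo C = Endo T"
      by (auto simp: positive_op_iff Endo_simps)
    have "Endo C * B = B * Endo C" by (rule B(3)) (simp add: CC[symmetric] mult.assoc)
    then have "Endo C * S = B * (Endo C * prj G)" by (simp only: S_def mult.assoc[symmetric])
    also have "\<dots> = B * (prj G * Endo C)" by (simp only: bounded_ops_corner[OF b])
    finally have "Endo C * S = S * Endo C" by (simp only: S_def mult.assoc)
    then have "Endo C = S" by (rule posop_sqrt_unique[OF \<open>posop S\<close> p, rotated]) (simp only: SS CC)
    then show "C = op_of S" by auto
  qed
  then show "positive_op G (op_sqrt G T)" "op_sqrt G T \<cdot> op_sqrt G T = T" using S by auto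
qed

section \<open>Exponentials in a corner\<close>

text \<open>\<open>T\<close> lives in the corner of \<open>P\<close> and annihilates the complement,
  so powers and exponentials split. The damping by \<open>t\<close> makes the complementary part
  decay as well, where \<open>exp T\<close> alone would act as the identity.\<close>

lemma exp_corner:
  fixes T P :: "'a::{real_normed_algebra_1, banach}"
  assumes "P * P = P" "P * T = T" "T * P = T"
  shows "exp (T - t *\<^sub>R (1 - P)) = P * exp T + exp (- t) *\<^sub>R (1 - P)"
proof -
  let ?D = "T - t *\<^sub>R (1 - P)"
  have pow: "?D ^ n = P * T ^ n + (- t) ^ n *\<^sub>R (1 - P)" for n
  proof (induction n)
    case (Suc n)
    have "?D ^ Suc n = ?D * (P * T ^ n + (- t) ^ n *\<^sub>R (1 - P))" by (simp only: power_Suc Suc)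
    also have "\<dots> = (T - t *\<^sub>R (1 - P)) * P * T ^ n + (- t) ^ n *\<^sub>R ((T - t *\<^sub>R (1 - P)) * (1 - P))"
      by (simp only: distrib_left mult.assoc mult_scaleR_right)
    also have "(T - t *\<^sub>R (1 - P)) * P = P * T" using assms by (simp add: algebra_simps)
    also have "(T - t *\<^sub>R (1 - P)) * (1 - P) = (- t) *\<^sub>R (1 - P)" using assms by (simp add: algebra_simps)
    finally show ?case by (simp add: mult.assoc mult.commute)
  qed simp
  have "(\<lambda>n. P * (T ^ n /\<^sub>R fact n) + ((- t) ^ n /\<^sub>R fact n) *\<^sub>R (1 - P)) sums (P * exp T + exp (- t) *\<^sub>R (1 - P))"
    by (intro sums_add sums_mult exp_converges bounded_linear.sums[OF bounded_linear_scaleR_left])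
  moreover have "(\<lambda>n. P * (T ^ n /\<^sub>R fact n) + ((- t) ^ n /\<^sub>R fact n) *\<^sub>R (1 - P)) = (\<lambda>n. ?D ^ n /\<^sub>R fact n)"
    by (simp add: pow scaleR_add_right)
  ultimately show ?thesis using exp_converges[of ?D] by (simp add: sums_unique2)
qed

text \<open>The powers defining \<open>op_exp\<close> start from the projection instead of the
  identity, which amounts to compressing the full exponential.\<close>

lemma Endo_op_exp:
  assumes "T \<in> bounded_ops G"
  shows "Endo (op_exp G T) = prj G * exp (Endo T)"
proof -
  have p: "Endo (op_power G T n) = prj G * Endo T ^ n" for n
  proof (induction n)
    case (Suc n)
    have "Endo (op_power G T (Suc n)) = Endo T * prj G * Endo T ^ n"
      by (simp add: Endo_simps Suc mult.assoc)
    also have "\<dots> = prj G * Endo T * Endo T ^ n" by (simp only: bounded_ops_corner[OF assms])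
    finally show ?case by (simp add: mult.assoc)
  qed simp
  have "(\<lambda>n. op_of (prj G * (Endo T ^ n /\<^sub>R fact n))) sums op_of (prj G * exp (Endo T))"
    by (intro bounded_linear.sums[OF bounded_linear_op_of] sums_mult exp_converges)
  moreover have "op_of (prj G * (Endo T ^ n /\<^sub>R fact n)) = (1 / fact n) *\<^sub>R op_power G T n" for n
  proof -
    have "prj G * (Endo T ^ n /\<^sub>R fact n) = Endo ((1 / fact n) *\<^sub>R op_power G T n)"
      by (simp only: mult_scaleR_right Endo_simps p inverse_eq_divide)
    then show ?thesis by simp
  qed
  ultimately have "op_exp G T = op_of (prj G * exp (Endo T))"
    by (simp add: op_exp_def sums_iff)
  then show ?thesis by simp
qed

section \<open>Unitization of a proper \<open>q\<close>-Banach subalgebra\<close>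

lemma suminf_powr_le:
  fixes x :: "nat \<Rightarrow> real"
  assumes x: "\<And>n. 0 \<le> x n" and q: "0 < q" "q \<le> 1" and s: "summable (\<lambda>n. x n powr q)"
  shows "suminf x powr q \<le> (\<Sum>n. x n powr q)"
proof -
  have part: "(\<Sum>k<n. x k) powr q \<le> (\<Sum>k<n. x k powr q)" for n
  proof (induction n)
    case (Suc n)
    have "(\<Sum>k<Suc n. x k) powr q \<le> (\<Sum>k<n. x k) powr q + x n powr q"
      using powr_add_le[of "\<Sum>k<n. x k" "x n" q] x q by (simp add: sum_nonneg)
    then show ?case using Suc by simp
  qed simp
  have "summable x" by (rule summable_if_summable_powr[OF x q s])
  then have "(\<lambda>n. (\<Sum>k<n. x k) powr q) \<longlonglongrightarrow> suminf x powr q"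
    using q x by (intro tendsto_powr' summable_LIMSEQ tendsto_const) (auto intro!: always_eventually sum_nonneg)
  moreover have "(\<Sum>k<n. x k) powr q \<le> (\<Sum>n. x n powr q)" for n
    by (rule order_trans[OF part sum_le_suminf[OF s]]) auto
  ultimately show ?thesis by (intro LIMSEQ_le_const2) auto
qed

text \<open>The left side equals
  \<open>(a powr q) powr (1 - \<theta>) * c powr (q * \<theta>)\<close> for positive
  \<open>a\<close>, and this expression is monotone in both \<open>a powr q\<close> and
  \<open>c\<close>. It converts the ratio form of the differential inequality into the form with
  common bounds.\<close>

lemma powr_interpolate:
  fixes a c q \<theta> s b :: real
  assumes "0 \<le> a" "0 \<le> c" "c \<le> b" "a powr q \<le> s" "0 < q" "0 < \<theta>" "\<theta> \<le> 1"
  shows "a powr q * (c / a) powr (q * \<theta>) \<le> s powr (1 - \<theta>) * b powr (q * \<theta>)"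
proof (cases "a = 0")
  case False
  then have a: "0 < a" using assms by simp
  have "a powr q * (c / a) powr (q * \<theta>) = (a powr q / a powr (q * \<theta>)) * c powr (q * \<theta>)"
    using assms by (simp add: powr_divide)
  also have "a powr q / a powr (q * \<theta>) = (a powr q) powr (1 - \<theta>)"
    by (simp add: powr_powr algebra_simps flip: powr_diff)
  also have "\<dots> * c powr (q * \<theta>) \<le> s powr (1 - \<theta>) * b powr (q * \<theta>)"
    using assms by (intro mult_mono powr_mono2) auto
  finally show ?thesis .
qed (use assms in simp)

lemma powr_mult_self:
  fixes s :: real
  assumes "0 \<le> s" "\<theta> \<le> 1"
  shows "s * s powr (1 - \<theta>) = s powr (2 - \<theta>)"
proof (cases "s = 0")
  case False
  then have "s * s powr (1 - \<theta>) = s powr 1 * s powr (1 - \<theta>)" using assms by simp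
  also have "\<dots> = s powr (1 + (1 - \<theta>))" by (rule powr_add[symmetric])
  finally show ?thesis by (simp add: algebra_simps)
qed simp

context proper_q_banach_subalgebra
begin

lemma mem_bounded: "T \<in> \<A> \<Longrightarrow> T \<in> bounded_ops G"
  using subset_bounded_ops by blast

lemma scale_op_of_real: "scale_op (of_real r) \<cdot> T = r *\<^sub>R T"
  by (rule blinfun_eqI) (simp add: scaleR_blinfun.rep_eq scaleR_ell2_def)

lemma scaleR_mem: "T \<in> \<A> \<Longrightarrow> r *\<^sub>R T \<in> \<A>"
  using scale_mem[of T "of_real r"] by (simp add: scale_op_of_real)

lemma qnorm_scaleR: "T \<in> \<A> \<Longrightarrow> qnorm (r *\<^sub>R T) = \<bar>r\<bar> * qnorm T"
  using qnorm_scale[of T "of_real r"] by (simp add: scale_op_of_real)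

lemma minus_mem: "T \<in> \<A> \<Longrightarrow> - T \<in> \<A>"
  using scaleR_mem[of T "-1"] by simp

lemma qnorm_minus: "T \<in> \<A> \<Longrightarrow> qnorm (- T) = qnorm T"
  using qnorm_scaleR[of T "-1"] by simp

lemma sum_mem: "(\<And>n :: nat. f n \<in> \<A>) \<Longrightarrow> finite I \<Longrightarrow> sum f I \<in> \<A>"
  by (induction I rule: infinite_finite_induct) (auto intro: zero_mem add_mem)

lemma qnorm_sum:
  assumes "\<And>n :: nat. f n \<in> \<A>" "finite I"
  shows "qnorm (sum f I) powr q \<le> (\<Sum>n\<in>I. qnorm (f n) powr q)"
  using assms(2)
proof induction
  case (insert n I)
  then show ?case
    using qnorm_add[OF assms(1)[of n] sum_mem[of f I, OF assms(1)]] by simp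
qed (use qnorm_eq_0_iff[OF zero_mem] in simp)

text \<open>Completeness provides a limit with respect to \<open>qnorm\<close>; since
  \<open>qnorm\<close> dominates the operator norm, it is the same as the operator-norm sum.\<close>

lemma sums_mem:
  assumes f: "\<And>n :: nat. f n \<in> \<A>" and s: "summable (\<lambda>n. qnorm (f n) powr q)" and F: "f sums F"
  shows "F \<in> \<A>" "qnorm F powr q \<le> (\<Sum>n. qnorm (f n) powr q)"
proof -
  let ?S = "\<lambda>n. sum f {..<n}"
  have S: "?S n \<in> \<A>" for n by (intro sum_mem f) simp
  have diff: "qnorm (?S m - ?S n) powr q \<le> \<bar>\<Sum>k\<in>{min m n..<max m n}. qnorm (f k) powr q\<bar>" for m n
  proof -
    have *: "qnorm (?S m - ?S n) powr q \<le> \<bar>\<Sum>k\<in>{n..<m}. qnorm (f k) powr q\<bar>" if "n \<le> m" for m n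
    proof -
      have "?S m - ?S n = sum f {n..<m}" using that by (simp add: sum_diff_nat_ivl lessThan_atLeast0)
      then show ?thesis using order_trans[OF qnorm_sum[of f "{n..<m}", OF f] abs_ge_self] by simp
    qed
    show ?thesis
    proof (cases "n \<le> m")
      case False
      then have "qnorm (?S m - ?S n) = qnorm (?S n - ?S m)"
        using qnorm_minus[of "?S n - ?S m"] S add_mem[OF S minus_mem[OF S], of n m] by simp
      then show ?thesis using *[of m n] False by (simp add: min_absorb1 max_absorb2)
    qed (use *[of n m] in \<open>simp add: min_absorb2 max_absorb1\<close>)
  qed
  have "\<exists>N. \<forall>m\<ge>N. \<forall>n\<ge>N. qnorm (?S m - ?S n) powr q < e" if "0 < e" for e
  proof -
    obtain N where N: "\<And>m n. N \<le> m \<Longrightarrow> norm (\<Sum>k\<in>{m..<n}. qnorm (f k) powr q) < e"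
      using s[unfolded summable_Cauchy] \<open>0 < e\<close> by blast
    have "qnorm (?S m - ?S n) powr q < e" if "N \<le> m" "N \<le> n" for m n
      using le_less_trans[OF diff N[unfolded real_norm_def]] that by simp
    then show ?thesis by blast
  qed
  from qnorm_complete[OF S this] obtain L where L: "L \<in> \<A>" "(\<lambda>n. qnorm (?S n - L) powr q) \<longlonglongrightarrow> 0"
    by blast
  have SL: "?S n - L \<in> \<A>" for n using add_mem[OF S minus_mem[OF L(1)]] by simp
  have "(\<lambda>n. (qnorm (?S n - L) powr q) powr (1 / q)) \<longlonglongrightarrow> 0 powr (1 / q)"
    using q_pos L(2) by (intro tendsto_powr' tendsto_const) auto
  then have "(\<lambda>n. qnorm (?S n - L)) \<longlonglongrightarrow> 0"
    using q_pos qnorm_nonneg[OF SL] by (simp add: powr_powr)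
  then have "(\<lambda>n. ?S n - L) \<longlonglongrightarrow> 0"
    by (rule Lim_null_comparison[rotated]) (simp add: norm_le_qnorm SL)
  then have "?S \<longlonglongrightarrow> L" by (rule LIM_zero_cancel)
  then have FL: "F = L" using F LIMSEQ_unique unfolding sums_def by blast
  then show "F \<in> \<A>" using L by simp
  have "qnorm L powr q \<le> qnorm (?S n - L) powr q + (\<Sum>n. qnorm (f n) powr q)" for n
  proof -
    have "qnorm L powr q \<le> qnorm (- (?S n - L)) powr q + qnorm (?S n) powr q"
      using qnorm_add[OF minus_mem[OF SL] S, of n n] by simp
    also have "qnorm (- (?S n - L)) = qnorm (?S n - L)" by (rule qnorm_minus[OF SL])
    also have "qnorm (?S n) powr q \<le> (\<Sum>k<n. qnorm (f k) powr q)" by (intro qnorm_sum f) simp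
    also have "\<dots> \<le> (\<Sum>n. qnorm (f n) powr q)" by (intro sum_le_suminf s) auto
    finally show ?thesis by simp
  qed
  moreover have "(\<lambda>n. qnorm (?S n - L) powr q + (\<Sum>n. qnorm (f n) powr q)) \<longlonglongrightarrow> 0 + (\<Sum>n. qnorm (f n) powr q)"
    by (intro tendsto_add L tendsto_const)
  ultimately show "qnorm F powr q \<le> (\<Sum>n. qnorm (f n) powr q)"
    unfolding FL by (intro LIMSEQ_le_const) auto
qed

text \<open>
  Adjoining all block-diagonal operators on the complement of \<open>\<ell>\<^sup>2(G)\<close> (rather than only the
  scalars) turns \<open>\<A>\<close> into an algebra whose unit is the identity, and keeps it complete.
\<close>

definition unitization :: "'i ell2 endo set" where
  "unitization = {T. T * prj G = prj G * T \<and> op_of (T * prj G) \<in> \<A> \<and> (\<exists>S. is_adj T S)}"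

definition unit_nu :: "'i ell2 endo \<Rightarrow> real" where
  "unit_nu T = qnorm (op_of (T * prj G)) powr q + norm (T * (1 - prj G)) powr q"

lemma unitizationD:
  assumes "T \<in> unitization"
  shows "T * prj G = prj G * T" "op_of (T * prj G) \<in> \<A>" "\<exists>S. is_adj T S"
  using assms unfolding unitization_def by blast+

lemma op_of_add: "op_of (S + T) = op_of S + op_of T"
  and op_of_scaleR: "op_of (r *\<^sub>R T) = r *\<^sub>R op_of T"
  by (simp_all add: plus_endo.rep_eq scaleR_endo.rep_eq)

lemma op_of_mult: "op_of (S * T) = op_of S \<cdot> op_of T"
  by (simp add: times_endo.rep_eq)

lemma mult_corner:
  assumes "T * prj G = prj G * T"
  shows "S * T * prj G = (S * prj G) * (T * prj G)" "S * T * (1 - prj G) = (S * (1 - prj G)) * (T * (1 - prj G))"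
proof -
  have "(S * prj G) * (T * prj G) = S * (prj G * T) * prj G" by (simp only: mult.assoc)
  also have "\<dots> = S * (T * prj G) * prj G" by (simp only: assms)
  finally show 1: "S * T * prj G = (S * prj G) * (T * prj G)" by (simp only: mult.assoc prj_idem)
  have "(S * (1 - prj G)) * (T * (1 - prj G)) = S * T - S * T * prj G - S * (prj G * T) + (S * prj G) * (T * prj G)"
    by (simp add: algebra_simps)
  also have "\<dots> = S * T - S * T * prj G"
    unfolding 1[symmetric] assms[symmetric] by (simp add: mult.assoc)
  finally show "S * T * (1 - prj G) = (S * (1 - prj G)) * (T * (1 - prj G))"
    by (simp add: right_diff_distrib)
qed

lemma unit_nu_parts:
  assumes "T \<in> unitization" "unit_nu T \<le> s"
  shows "qnorm (op_of (T * prj G)) powr q \<le> s" "norm (T * (1 - prj G)) powr q \<le> s"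
proof -
  have "0 \<le> qnorm (op_of (T * prj G)) powr q" "0 \<le> norm (T * (1 - prj G)) powr q" by simp_all
  then show "qnorm (op_of (T * prj G)) powr q \<le> s" "norm (T * (1 - prj G)) powr q \<le> s"
    using assms(2) unfolding unit_nu_def by linarith+
qed

lemma norm_mult_prj_le: "norm (T * prj G) \<le> norm T" "norm (T * (1 - prj G)) \<le> norm T"
  using order_trans[OF norm_mult_ineq mult_left_mono[OF norm_prj_le(1)]]
    order_trans[OF norm_mult_ineq mult_left_mono[OF norm_prj_le(2)]] by auto

text \<open>Products split into the corner of \<open>G\<close> and its complement, because elements
  commute with the projection. The corner inherits the axioms of the given algebra, and on the
  complement the operator norm is submultiplicative with constant 1, whence the maxima and summands
  1 in the constants.\<close>

lemma diff_algebra_unitization: "diff_algebra unitization unit_nu q"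
proof
  show "0 < q" "q \<le> 1" by (fact q_pos q_le_1)+
  show "1 \<in> unitization" using is_adj_one one_mem by (auto simp: unitization_def)
  fix T :: "'i ell2 endo" and r :: real
  assume T: "T \<in> unitization"
  note TD = unitizationD[OF T]
  show "r *\<^sub>R T \<in> unitization"
    using TD is_adj_scaleR[of T] scaleR_mem[OF TD(2), of r] unfolding unitization_def by (auto simp: op_of_scaleR)
  show "0 \<le> unit_nu T" by (simp add: unit_nu_def)
  show "unit_nu (r *\<^sub>R T) = \<bar>r\<bar> powr q * unit_nu T"
    using qnorm_nonneg[OF TD(2)]
    by (simp add: unit_nu_def op_of_scaleR qnorm_scaleR[OF TD(2)] powr_mult distrib_left)
  show "norm T powr q \<le> unit_nu T"
  proof -
    have "T = T * prj G + T * (1 - prj G)" by (simp add: right_diff_distrib)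
    then have "norm T \<le> norm (T * prj G) + norm (T * (1 - prj G))" by (metis norm_triangle_ineq)
    then have "norm T powr q \<le> (norm (T * prj G) + norm (T * (1 - prj G))) powr q"
      using q_pos by (intro powr_mono2) auto
    also have "\<dots> \<le> norm (T * prj G) powr q + norm (T * (1 - prj G)) powr q"
      by (intro powr_add_le q_pos q_le_1) auto
    also have "norm (T * prj G) powr q \<le> qnorm (op_of (T * prj G)) powr q"
      using norm_le_qnorm[OF TD(2)] q_pos by (intro powr_mono2) auto
    finally show ?thesis by (simp add: unit_nu_def)
  qed
  show "\<exists>S\<in>unitization. is_adj T S"
  proof -
    obtain S where S: "is_adj T S" using TD(3) by blast
    have 1: "is_adj (T * prj G) (prj G * S)" "is_adj (prj G * T) (S * prj G)"
      by (intro is_adj_mult S is_adj_prj)+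
    then have c: "S * prj G = prj G * S" using is_adj_unique TD(1) by metis
    have "op_adj (op_of (T * prj G)) = op_of (S * prj G)"
      using mem_bounded[OF TD(2)] 1(1) c by (intro op_adj_eqI) (simp_all add: bounded_ops_iff)
    then have "op_of (S * prj G) \<in> \<A>" using adj_mem[OF TD(2)] by simp
    then have "S \<in> unitization"
      using c is_adj_sym[OF S] unfolding unitization_def by blast
    then show ?thesis using S by blast
  qed
  fix S assume S: "S \<in> unitization"
  note SD = unitizationD[OF S]
  show "S + T \<in> unitization"
    using SD TD is_adj_add[of S _ T] add_mem[OF SD(2) TD(2)] unfolding unitization_def
    by (auto simp: distrib_left distrib_right op_of_add)
  have "S * T * prj G = prj G * (S * T)" by (metis SD(1) TD(1) mult.assoc)
  moreover have "op_of (S * T * prj G) \<in> \<A>"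
    unfolding mult_corner(1)[OF TD(1)] op_of_mult[of "S * prj G"] by (intro mult_mem SD TD)
  moreover have "\<exists>U. is_adj (S * T) U" using SD(3) TD(3) is_adj_mult by blast
  ultimately show "S * T \<in> unitization" by (simp add: unitization_def)
next
  obtain K where K: "0 < K" "\<And>A B. A \<in> \<A> \<Longrightarrow> B \<in> \<A> \<Longrightarrow> qnorm (A \<cdot> B) \<le> K * qnorm A * qnorm B"
    using qnorm_mult by metis
  define K' where "K' = max 1 (K powr q)"
  have "unit_nu (S * T) \<le> K' * unit_nu S * unit_nu T" if S: "S \<in> unitization" and T: "T \<in> unitization" for S T
  proof -
    note SD = unitizationD[OF S] and TD = unitizationD[OF T]
    let ?a = "qnorm (op_of (S * prj G))" and ?b = "qnorm (op_of (T * prj G))"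
    let ?c = "norm (S * (1 - prj G))" and ?d = "norm (T * (1 - prj G))"
    have nn: "0 \<le> ?a" "0 \<le> ?b" using qnorm_nonneg SD TD by auto
    have ab: "qnorm (op_of (S * T * prj G)) \<le> K * ?a * ?b"
      unfolding mult_corner(1)[OF TD(1)] op_of_mult[of "S * prj G"] by (intro K SD TD)
    have "qnorm (op_of (S * T * prj G)) powr q \<le> (K * ?a * ?b) powr q"
      using ab q_pos qnorm_nonneg[of "op_of (S * T * prj G)"] mult_mem[OF SD(2) TD(2)]
      by (intro powr_mono2) (auto simp: mult_corner(1)[OF TD(1)] op_of_mult[of "S * prj G"])
    also have "\<dots> = K powr q * (?a powr q * ?b powr q)" using nn K(1) by (simp add: powr_mult)
    also have "\<dots> \<le> K' * (?a powr q * ?b powr q)" by (intro mult_right_mono) (auto simp: K'_def)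
    finally have 1: "qnorm (op_of (S * T * prj G)) powr q \<le> K' * (?a powr q * ?b powr q)" .
    have "norm (S * T * (1 - prj G)) powr q \<le> (?c * ?d) powr q"
      unfolding mult_corner(2)[OF TD(1)] using q_pos by (intro powr_mono2 norm_mult_ineq) auto
    also have "\<dots> = 1 * (?c powr q * ?d powr q)" by (simp add: powr_mult)
    also have "\<dots> \<le> K' * (?c powr q * ?d powr q)" by (intro mult_right_mono) (auto simp: K'_def)
    finally have 2: "norm (S * T * (1 - prj G)) powr q \<le> K' * (?c powr q * ?d powr q)" .
    have "?a powr q * ?b powr q + ?c powr q * ?d powr q \<le> unit_nu S * unit_nu T"
      by (simp add: unit_nu_def algebra_simps add_nonneg_nonneg)
    then have "K' * (?a powr q * ?b powr q + ?c powr q * ?d powr q) \<le> K' * (unit_nu S * unit_nu T)"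
      by (rule mult_left_mono) (simp add: K'_def)
    then show ?thesis using 1 2 by (simp add: unit_nu_def[of "S * T"] algebra_simps)
  qed
  then show "\<exists>K\<ge>1. \<forall>S\<in>unitization. \<forall>T\<in>unitization. unit_nu (S * T) \<le> K * unit_nu S * unit_nu T"
    by (intro exI[of _ K']) (auto simp: K'_def)
next
  obtain \<theta> D where \<theta>: "0 < \<theta>" "\<theta> \<le> 1" "0 < D" and diff: "\<And>A B. A \<in> \<A> \<Longrightarrow> B \<in> \<A> \<Longrightarrow> qnorm (A \<cdot> B) powr q \<le>
      D * qnorm A powr q * qnorm B powr q * ((norm A / qnorm A) powr (q * \<theta>) + (norm B / qnorm B) powr (q * \<theta>))"
    using differential by metis
  have "unit_nu (S * T) \<le> (2 * D + 1) * s powr (2 - \<theta>) * b powr (q * \<theta>)"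
    if S: "S \<in> unitization" and T: "T \<in> unitization" and s: "unit_nu S \<le> s" "unit_nu T \<le> s"
      and b: "norm S \<le> b" "norm T \<le> b" for S T s b
  proof -
    note SD = unitizationD[OF S] and TD = unitizationD[OF T]
    let ?A = "op_of (S * prj G)" and ?B = "op_of (T * prj G)"
    let ?r = "s powr (1 - \<theta>) * b powr (q * \<theta>)"
    have sA: "qnorm ?A powr q \<le> s" "norm (S * (1 - prj G)) powr q \<le> s"
      and sB: "qnorm ?B powr q \<le> s" "norm (T * (1 - prj G)) powr q \<le> s"
      using unit_nu_parts S T s by auto
    have s0: "0 \<le> s" by (rule order_trans[OF powr_ge_zero sA(1)])
    have A: "qnorm ?A powr q * (norm ?A / qnorm ?A) powr (q * \<theta>) \<le> ?r"
      using order_trans[OF norm_mult_prj_le(1) b(1)]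
      by (intro powr_interpolate qnorm_nonneg SD sA \<theta> q_pos) auto
    have B: "qnorm ?B powr q * (norm ?B / qnorm ?B) powr (q * \<theta>) \<le> ?r"
      using order_trans[OF norm_mult_prj_le(1) b(2)]
      by (intro powr_interpolate qnorm_nonneg TD sB \<theta> q_pos) auto
    have "qnorm (op_of (S * T * prj G)) powr q \<le>
      D * qnorm ?A powr q * qnorm ?B powr q * ((norm ?A / qnorm ?A) powr (q * \<theta>) + (norm ?B / qnorm ?B) powr (q * \<theta>))"
      unfolding mult_corner(1)[OF TD(1)] op_of_mult[of "S * prj G"] by (intro diff SD TD)
    also have "\<dots> = D * (qnorm ?B powr q * (qnorm ?A powr q * (norm ?A / qnorm ?A) powr (q * \<theta>)) +
        qnorm ?A powr q * (qnorm ?B powr q * (norm ?B / qnorm ?B) powr (q * \<theta>)))"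
      by (simp only: distrib_left mult_ac)
    also have "\<dots> \<le> D * (s * ?r + s * ?r)"
      using \<theta>(3) s0 by (intro mult_left_mono add_mono mult_mono A B sA sB) auto
    also have "\<dots> = 2 * D * (s * s powr (1 - \<theta>)) * b powr (q * \<theta>)" by simp
    also have "s * s powr (1 - \<theta>) = s powr (2 - \<theta>)" using s0 \<theta>(2) by (rule powr_mult_self)
    finally have 1: "qnorm (op_of (S * T * prj G)) powr q \<le> 2 * D * s powr (2 - \<theta>) * b powr (q * \<theta>)" .
    let ?c = "norm (S * (1 - prj G))" and ?d = "norm (T * (1 - prj G))"
    \<comment> \<open>The operator norm fits the differential inequality trivially: its ratio to
      itself is 1, or the term vanishes when the norm is 0.\<close>
    have C: "?c powr q * (?c / ?c) powr (q * \<theta>) \<le> ?r"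
      using order_trans[OF norm_mult_prj_le(2) b(1)]
      by (intro powr_interpolate sA \<theta> q_pos) auto
    have "norm (S * T * (1 - prj G)) powr q \<le> (?c * ?d) powr q"
      unfolding mult_corner(2)[OF TD(1)] using q_pos by (intro powr_mono2 norm_mult_ineq) auto
    also have "\<dots> = ?d powr q * (?c powr q * (?c / ?c) powr (q * \<theta>))"
      using q_pos by (cases "?c = 0") (simp_all add: powr_mult)
    also have "\<dots> \<le> s * ?r" using s0 by (intro mult_mono C sB) auto
    also have "\<dots> = (s * s powr (1 - \<theta>)) * b powr (q * \<theta>)" by simp
    also have "s * s powr (1 - \<theta>) = s powr (2 - \<theta>)" using s0 \<theta>(2) by (rule powr_mult_self)
    finally have 2: "norm (S * T * (1 - prj G)) powr q \<le> s powr (2 - \<theta>) * b powr (q * \<theta>)" .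
    have "(2 * D + 1) * s powr (2 - \<theta>) * b powr (q * \<theta>) =
        2 * D * s powr (2 - \<theta>) * b powr (q * \<theta>) + s powr (2 - \<theta>) * b powr (q * \<theta>)"
      by (simp add: algebra_simps)
    then show ?thesis using 1 2 unfolding unit_nu_def[of "S * T"] by linarith
  qed
  then show "\<exists>\<theta> D. 0 < \<theta> \<and> \<theta> \<le> 1 \<and> 1 \<le> D \<and>
      (\<forall>S\<in>unitization. \<forall>T\<in>unitization. \<forall>s b. unit_nu S \<le> s \<longrightarrow> unit_nu T \<le> s \<longrightarrow> norm S \<le> b \<longrightarrow> norm T \<le> b \<longrightarrow>
        unit_nu (S * T) \<le> D * s powr (2 - \<theta>) * b powr (q * \<theta>))"
    using \<theta> by (intro exI[of _ \<theta>] exI[of _ "2 * D + 1"]) auto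
next
  fix f :: "nat \<Rightarrow> 'i ell2 endo"
  assume f: "\<And>n. f n \<in> unitization" and s: "summable (\<lambda>n. unit_nu (f n))"
  note fD = unitizationD[OF f]
  have s1: "summable (\<lambda>n. qnorm (op_of (f n * prj G)) powr q)"
    by (rule summable_comparison_test'[OF s]) (simp add: unit_nu_def)
  have s2: "summable (\<lambda>n. norm (f n * (1 - prj G)) powr q)"
    by (rule summable_comparison_test'[OF s]) (simp add: unit_nu_def)
  have n1: "summable (\<lambda>n. qnorm (op_of (f n * prj G)))"
    by (rule summable_if_summable_powr[OF qnorm_nonneg[OF fD(2)] q_pos q_le_1 s1])
  have n2: "summable (\<lambda>n. norm (f n * (1 - prj G)))"
    by (rule summable_if_summable_powr[OF norm_ge_zero q_pos q_le_1 s2])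
  have n: "summable (\<lambda>n. norm (f n))"
  proof (rule summable_comparison_test'[OF summable_add[OF n1 n2]])
    fix n
    have "f n = f n * prj G + f n * (1 - prj G)" by (simp add: right_diff_distrib)
    then have "norm (f n) \<le> norm (f n * prj G) + norm (f n * (1 - prj G))" by (metis norm_triangle_ineq)
    then show "norm (norm (f n)) \<le> qnorm (op_of (f n * prj G)) + norm (f n * (1 - prj G))"
      using norm_le_qnorm[OF fD(2)[of n]] by simp
  qed
  then have fs: "f sums suminf f" by (rule summable_sums[OF summable_norm_cancel])
  have "prj G * suminf f = suminf f * prj G"
    by (rule suminf_commute[OF summable_norm_cancel[OF n]]) (simp add: fD(1))
  moreover have "\<exists>S. is_adj (suminf f) S"
  proof -
    obtain g where g: "\<And>n. is_adj (f n) (g n)" using fD(3) by metis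
    have "summable (\<lambda>n. norm (g n))" using n norm_is_adj[OF g] by simp
    then have "g sums suminf g" by (rule summable_sums[OF summable_norm_cancel])
    then show ?thesis using is_adj_sums[OF g fs] by blast
  qed
  moreover have m: "op_of (suminf f * prj G) \<in> \<A>"
    "qnorm (op_of (suminf f * prj G)) powr q \<le> (\<Sum>n. qnorm (op_of (f n * prj G)) powr q)"
    by (rule sums_mem[OF fD(2) s1 bounded_linear.sums[OF bounded_linear_op_of sums_mult2[OF fs]]])+
  moreover have "norm (suminf f * (1 - prj G)) powr q \<le> (\<Sum>n. norm (f n * (1 - prj G)) powr q)"
  proof -
    have "suminf f * (1 - prj G) = (\<Sum>n. f n * (1 - prj G))"
      using sums_mult2[OF fs, of "1 - prj G"] by (simp add: sums_iff)
    then have "norm (suminf f * (1 - prj G)) \<le> (\<Sum>n. norm (f n * (1 - prj G)))"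
      using summable_norm[OF n2] by simp
    then have "norm (suminf f * (1 - prj G)) powr q \<le> (\<Sum>n. norm (f n * (1 - prj G))) powr q"
      using q_pos by (intro powr_mono2) auto
    also have "\<dots> \<le> (\<Sum>n. norm (f n * (1 - prj G)) powr q)"
      by (rule suminf_powr_le[OF norm_ge_zero q_pos q_le_1 s2])
    finally show ?thesis .
  qed
  moreover have "(\<Sum>n. unit_nu (f n)) = (\<Sum>n. qnorm (op_of (f n * prj G)) powr q) + (\<Sum>n. norm (f n * (1 - prj G)) powr q)"
    unfolding unit_nu_def by (rule suminf_add[OF s1 s2, symmetric])
  ultimately show "suminf f \<in> unitization \<and> unit_nu (suminf f) \<le> (\<Sum>n. unit_nu (f n))"
    by (simp add: unitization_def unit_nu_def)
qed

text \<open>The scalar \<open>r\<close> on the complement is free because the data of the Riccati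
  equations are padded by different values.\<close>

lemma embed_mem:
  assumes "T \<in> \<A>"
  shows "Endo T + r *\<^sub>R (1 - prj G) \<in> unitization"
proof -
  note corner = bounded_ops_corner[OF mem_bounded[OF assms]]
  have e: "(Endo T + r *\<^sub>R (1 - prj G)) * prj G = Endo T" "prj G * (Endo T + r *\<^sub>R (1 - prj G)) = Endo T"
    by (simp_all add: distrib_left distrib_right left_diff_distrib right_diff_distrib corner)
  moreover have "is_adj (Endo T + r *\<^sub>R (1 - prj G)) (Endo (op_adj T) + r *\<^sub>R (1 - prj G))"
    by (intro is_adj_add is_adj_op_adj[OF mem_bounded[OF assms]] is_adj_scaleR is_adj_diff is_adj_one is_adj_prj)
  ultimately show ?thesis using assms by (auto simp: unitization_def)
qed

end

text \<open>The adjoint of \<open>S\<close> is again an inverse of the self-adjoint \<open>R\<close>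
  in the corner, so \<open>S\<close> is self-adjoint. Then \<open>S = S R S\<close> turns the form
  of \<open>S\<close> at \<open>x\<close> into the form of \<open>R\<close> at
  \<open>S x\<close>.\<close>

lemma op_inv_positive:
  assumes R: "positive_op G R" and S: "is_op_inverse G R S"
  shows "posop (Endo S)"
proof -
  have b: "S \<in> bounded_ops G" "R \<in> bounded_ops G" and p: "posop (Endo R)"
    using assms by (simp_all add: is_op_inverse_def positive_op_iff)
  have i: "Endo R * Endo S = prj G" "Endo S * Endo R = prj G"
    using S by (simp_all add: is_op_inverse_def flip: Endo_mult)
  note corner = bounded_ops_corner[OF b(1)]
  let ?S' = "Endo (op_adj S)"
  have adj: "is_adj (Endo S) ?S'" by (rule is_adj_op_adj[OF b(1)])
  have "is_adj (Endo S * prj G) (prj G * ?S')" by (intro is_adj_mult adj is_adj_prj)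
  then have "is_adj (Endo S) (prj G * ?S')" by (simp only: corner)
  then have S'P: "?S' = prj G * ?S'" by (rule is_adj_unique[OF adj])
  have "is_adj (Endo R * Endo S) (?S' * Endo R)"
    using p by (intro is_adj_mult adj) (simp add: posop_def)
  then have S'R: "?S' * Endo R = prj G" using is_adj_unique[OF is_adj_prj] i by metis
  have "is_adj (prj G * Endo S) (?S' * prj G)" by (intro is_adj_mult adj is_adj_prj)
  then have "is_adj (Endo S) (?S' * prj G)" by (simp only: corner)
  then have "?S' = ?S' * prj G" by (rule is_adj_unique[OF adj])
  also have "\<dots> = ?S' * Endo R * Endo S" by (simp only: i mult.assoc)
  also have "\<dots> = Endo S" by (simp only: S'R corner)
  finally have sa: "is_adj (Endo S) (Endo S)" using adj by simp
  show ?thesis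
    unfolding posop_def
  proof (intro conjI allI sa)
    fix x
    have "ap (Endo S) x = ap (Endo S * Endo R * Endo S) x" by (simp only: i corner)
    then have "ap (Endo S) x \<bullet> x = ap (Endo S) (ap (Endo R) (ap (Endo S) x)) \<bullet> x" by (simp only: ap_mult)
    also have "\<dots> = ap (Endo R) (ap (Endo S) x) \<bullet> ap (Endo S) x" by (rule is_adjD[OF sa])
    also have "\<dots> \<ge> 0" using p unfolding posop_def by blast
    finally show "0 \<le> ap (Endo S) x \<bullet> x" .
  qed
qed

lemma posop_conjugate: "posop S \<Longrightarrow> is_adj B B' \<Longrightarrow> posop (B * S * B')"
  unfolding posop_def
proof (intro conjI allI; elim conjE)
  fix x
  assume S: "is_adj S S" "\<forall>x. 0 \<le> ap S x \<bullet> x" and B: "is_adj B B'"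
  show "is_adj (B * S * B') (B * S * B')"
    using is_adj_mult[OF is_adj_mult[OF B S(1)] is_adj_sym[OF B]] by (simp add: mult.assoc)
  show "0 \<le> ap (B * S * B') x \<bullet> x" using S(2) by (simp add: is_adjD[OF B])
qed

lemma posop_add: "posop S \<Longrightarrow> posop T \<Longrightarrow> posop (S + T)"
  unfolding posop_def by (auto intro: is_adj_add simp: inner_add_left)

context proper_q_banach_subalgebra
begin

text \<open>\<open>T\<close> plus the complementary projection is coercive on the whole space and
  lies in the unitization. The corner of its inverse there is the inverse of \<open>T\<close>
  relative to \<open>proj_op G\<close>.\<close>

lemma op_inv_mem:
  assumes "T \<in> \<A>" "strictly_positive_op G T"
  shows "op_inv G T \<in> \<A>" "is_op_inverse G T (op_inv G T)"
proof -
  interpret U: diff_algebra unitization unit_nu q by (rule diff_algebra_unitization)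
  let ?T = "Endo T + (1 - prj G)"
  note corner = bounded_ops_corner[OF mem_bounded[OF assms(1)]]
  have T: "?T \<in> unitization" using embed_mem[OF assms(1), of 1] by simp
  note sp = strictly_positive_op_coercive[OF assms(2)]
  obtain c where c: "0 < c" "\<And>x. c * (norm x)\<^sup>2 \<le> ap ?T x \<bullet> x" using sp(2) by blast
  have "is_adj ?T ?T"
    using sp(1) by (intro is_adj_add is_adj_diff is_adj_one is_adj_prj) (simp add: positive_op_iff posop_def)
  then obtain V where V: "V \<in> unitization" "?T * V = 1" "V * ?T = 1"
    using U.coercive_inverse[OF T _ c] by metis
  note VD = unitizationD[OF V(1)]
  define S where "S = op_of (V * prj G)"
  have TP: "Endo T = prj G * ?T" "Endo T = ?T * prj G"
    by (simp_all add: distrib_left distrib_right right_diff_distrib left_diff_distrib corner)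
  have "Endo T * (V * prj G) = prj G * (?T * V) * prj G" by (subst TP(1)) (simp only: mult.assoc)
  then have 1: "Endo T * (V * prj G) = prj G" unfolding V by simp
  have "(V * prj G) * Endo T = prj G * (V * ?T) * prj G"
    by (subst TP(2)) (simp only: mult.assoc VD(1)[unfolded mult.assoc])
  then have 2: "(V * prj G) * Endo T = prj G" unfolding V by simp
  have "is_op_inverse G T S"
    using 1 2 mem_bounded[OF VD(2)]
    by (simp add: is_op_inverse_def S_def Endo_inject[symmetric, where 'a = "'i ell2"] Endo_mult)
  then show "op_inv G T \<in> \<A>" "is_op_inverse G T (op_inv G T)"
    using VD(2) by (simp_all add: op_inv_eqI S_def)
qed

end

section \<open>The theorem: padding the data on the complement of the domain\<close>

theorem theorem9p1:
  fixes q :: real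
    and G :: "(int ^ 'd) set"
    and \<A> :: "((int ^ 'd) ell2 \<Rightarrow>\<^sub>L (int ^ 'd) ell2) set"
    and qnorm :: "((int ^ 'd) ell2 \<Rightarrow>\<^sub>L (int ^ 'd) ell2) \<Rightarrow> real"
    and A B Q R X :: "(int ^ 'd) ell2 \<Rightarrow>\<^sub>L (int ^ 'd) ell2"
  assumes q: "0 < q" "q \<le> 1"
    and proper: "proper_q_banach_subalgebra q G \<A> qnorm"
    and mem: "A \<in> \<A>" "B \<in> \<A>" "Q \<in> \<A>" "R \<in> \<A>"
    and Q: "positive_op G Q"
    and R: "strictly_positive_op G R"
    and X: "strictly_positive_op G X"
    and riccati: "op_adj A \<cdot> X + X \<cdot> A - X \<cdot> B \<cdot> op_inv G R \<cdot> op_adj B \<cdot> X + Q = 0"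
    and stabilizable: "exp_stabilizable G A B"
    and detectable: "exp_detectable G A (op_sqrt G Q)"
    and dual: "\<exists>Y. self_adjoint G Y \<and>
      A \<cdot> Y + Y \<cdot> op_adj A - Y \<cdot> Q \<cdot> Y + B \<cdot> op_inv G R \<cdot> op_adj B = 0 \<and>
      op_invertible G (proj_op G + Y \<cdot> X)"
  shows "X \<in> \<A> \<and> exp_stable G \<A> qnorm (A - B \<cdot> op_inv G R \<cdot> op_adj B \<cdot> X)"
proof -
  interpret proper_q_banach_subalgebra q G \<A> qnorm by (rule proper)
  interpret U: diff_algebra unitization unit_nu q by (rule diff_algebra_unitization)
  obtain Y where Y: "self_adjoint G Y"
    and dual_eq: "A \<cdot> Y + Y \<cdot> op_adj A - Y \<cdot> Q \<cdot> Y + B \<cdot> op_inv G R \<cdot> op_adj B = 0"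
    and inv: "op_invertible G (proj_op G + Y \<cdot> X)" using dual by blast
  obtain W where W: "is_op_inverse G (proj_op G + Y \<cdot> X) W"
    using inv by (auto simp: op_invertible_def)
  obtain L where L: "L \<in> bounded_ops G" and M: "exp_stable G (bounded_ops G) norm (A + L \<cdot> op_sqrt G Q)"
    using detectable by (auto simp: exp_detectable_def)
  note Rinv = op_inv_mem[OF mem(4) R]
  define S where "S = B \<cdot> op_inv G R \<cdot> op_adj B"
  have S: "S \<in> \<A>" unfolding S_def by (intro mult_mem mem Rinv adj_mem)
  define C where "C = op_sqrt G Q"
  have C: "positive_op G C" "C \<cdot> C = Q" unfolding C_def by (rule op_sqrt[OF Q])+
  have Xp: "positive_op G X" by (rule strictly_positive_op_coercive[OF X])
  have bnd: "A \<in> bounded_ops G" "op_adj A \<in> bounded_ops G" "S \<in> bounded_ops G" "Q \<in> bounded_ops G"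
    "X \<in> bounded_ops G" "Y \<in> bounded_ops G" "W \<in> bounded_ops G" "C \<in> bounded_ops G" "L \<in> bounded_ops G"
    using mem S Xp Y W C L by (auto intro: mem_bounded adj_mem simp: positive_op_iff self_adjoint_def is_op_inverse_def)
  define P where "P = prj G"
  define N where "N = 1 - P"
  define h where "h = (1 / 2) *\<^sub>R N"
  have PN: "1 = P + N" by (simp add: N_def)
  have NN: "N * N = N" by (simp add: N_def P_def algebra_simps)
  have hh: "h + h = N" by (simp add: h_def flip: scaleR_add_left)
  have Nz: "N * Endo T = 0" "Endo T * N = 0" "N * (Endo T * w) = 0" "Endo T * (N * w) = 0"
    if "T \<in> bounded_ops G" for T w
  proof -
    show 1: "N * Endo T = 0" "Endo T * N = 0"
      using bounded_ops_corner[OF that] by (simp_all add: N_def P_def algebra_simps)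
    show "N * (Endo T * w) = 0" "Endo T * (N * w) = 0"
      by (simp_all add: 1 flip: mult.assoc)
  qed
  have hz: "h * Endo T = 0" "Endo T * h = 0" "h * (Endo T * w) = 0" "Endo T * (h * w) = 0"
    if "T \<in> bounded_ops G" for T w
    using Nz[OF that] by (simp_all add: h_def)
  have hN: "h * N = h" "N * h = h" by (simp_all add: h_def NN)
  note z = Nz[OF bnd(1)] Nz[OF bnd(2)] Nz[OF bnd(3)] Nz[OF bnd(4)] Nz[OF bnd(5)] Nz[OF bnd(6)] Nz[OF bnd(7)]
    Nz[OF bnd(8)] Nz[OF bnd(9)] hz[OF bnd(1)] hz[OF bnd(2)] hz[OF bnd(3)] hz[OF bnd(4)] hz[OF bnd(5)]
    hz[OF bnd(6)] hz[OF bnd(7)] hz[OF bnd(8)] hz[OF bnd(9)] hN NN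
  \<comment> \<open>On the complement the data become the scalars \<open>a = a' = -1/2\<close>,
    \<open>s = 0\<close>, \<open>k = x = c = 1\<close>, \<open>y = l = 0\<close>. There the Riccati
    equation reads -1/2 - 1/2 - 0 + 1 = 0, every term of the dual one is 0, \<open>1 + y * x\<close>
    is 1, \<open>c\<close> squares to \<open>k\<close>, and \<open>a + l * c\<close> and
    \<open>a - s * x\<close> are both -1/2, hence stable.\<close>
  define a a' s k x y c l where "a = Endo A - h" and "a' = Endo (op_adj A) - h" and "s = Endo S"
    and "k = Endo Q + N" and "x = Endo X + N" and "y = Endo Y" and "c = Endo C + N" and "l = Endo L"
  have adjN: "is_adj N N" "is_adj h h"
    unfolding h_def N_def P_def by (intro is_adj_scaleR is_adj_diff is_adj_one is_adj_prj)+
  have adj: "is_adj a a'"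
    unfolding a_def a'_def by (intro is_adj_diff is_adj_op_adj[OF bnd(1)] adjN)
  have ps: "posop s"
  proof -
    have "posop (Endo (op_inv G R))"
      by (rule op_inv_positive[OF strictly_positive_op_coercive(1)[OF R] Rinv(2)])
    then show ?thesis
      unfolding s_def S_def Endo_mult by (rule posop_conjugate) (rule is_adj_op_adj[OF mem_bounded[OF mem(2)]])
  qed
  have pN: "posop N" unfolding N_def P_def by (rule posop_one_minus_prj)
  have px: "posop x"
    unfolding x_def using Xp pN by (intro posop_add) (simp_all add: positive_op_iff)
  have ric: "a' * x + x * a - x * s * x + k = 0"
  proof -
    have e: "Endo (op_adj A) * Endo X + Endo X * Endo A - Endo X * (Endo S * Endo X) + Endo Q = 0"
      using arg_cong[OF riccati, of Endo] by (simp add: S_def Endo_simps mult.assoc)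
    have "a' * x + x * a - x * s * x + k =
        (Endo (op_adj A) * Endo X + Endo X * Endo A - Endo X * (Endo S * Endo X) + Endo Q) + (N - (h + h))"
      by (simp add: a'_def a_def x_def s_def k_def distrib_left distrib_right left_diff_distrib right_diff_distrib mult.assoc z)
    then show ?thesis by (simp only: e hh) simp
  qed
  have dua: "a * y + y * a' - y * k * y + s = 0"
  proof -
    have e: "Endo A * Endo Y + Endo Y * Endo (op_adj A) - Endo Y * (Endo Q * Endo Y) + Endo S = 0"
      using arg_cong[OF dual_eq, of Endo] by (simp add: S_def Endo_simps mult.assoc)
    have "a * y + y * a' - y * k * y + s =
        Endo A * Endo Y + Endo Y * Endo (op_adj A) - Endo Y * (Endo Q * Endo Y) + Endo S"
      by (simp add: a'_def a_def y_def s_def k_def distrib_left distrib_right left_diff_distrib right_diff_distrib mult.assoc z)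
    then show ?thesis by (simp only: e)
  qed
  have invs: "(1 + y * x) * (Endo W + N) = 1" "(Endo W + N) * (1 + y * x) = 1"
  proof -
    have i: "(P + Endo Y * Endo X) * Endo W = P" "Endo W * (P + Endo Y * Endo X) = P"
      using W by (simp_all add: is_op_inverse_def P_def flip: Endo_mult Endo_linear_simps(1))
    have e: "1 + y * x = (P + Endo Y * Endo X) + N"
      by (simp add: PN y_def x_def distrib_left z)
    have PNz: "P * N = 0" "N * P = 0" by (simp_all add: N_def P_def algebra_simps)
    show "(1 + y * x) * (Endo W + N) = 1" "(Endo W + N) * (1 + y * x) = 1"
      unfolding e distrib_left[of _ _ N] distrib_right[of _ N] distrib_left[of _ "Endo W"] distrib_right[of "Endo W"] i
      by (simp_all add: PN PNz z distrib_left distrib_right mult.assoc)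
  qed
  have cc: "ap k v \<bullet> v = (norm (ap c v))\<^sup>2" for v
  proof -
    have "is_adj c c"
      using C pN unfolding c_def by (intro is_adj_add) (simp_all add: positive_op_iff posop_def)
    moreover have "k = c * c"
      using C(2) by (simp add: k_def c_def distrib_left distrib_right z flip: Endo_mult)
    ultimately show ?thesis by (simp add: is_adjD power2_norm_eq_inner)
  qed
  obtain E \<alpha> where E: "0 < \<alpha>" "\<And>t. 0 \<le> t \<Longrightarrow> norm (exp (t *\<^sub>R (a + l * c))) \<le> E * exp (- \<alpha> * t)"
  proof -
    let ?M = "A + L \<cdot> C"
    obtain E \<alpha> where Ea: "0 < E" "0 < \<alpha>" "\<And>t. 0 \<le> t \<Longrightarrow> norm (op_exp G (t *\<^sub>R ?M)) \<le> E * exp (- \<alpha> * t)"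
      using M unfolding exp_stable_def C_def by blast
    have Mb: "?M \<in> bounded_ops G" using M unfolding exp_stable_def C_def by blast
    note Mc = bounded_ops_corner[OF Mb]
    \<comment> \<open>The padded part decays at rate 1/2 with constant 1, so the smaller rate and
      the constant \<open>E + 1\<close> serve for the sum.\<close>
    have "norm (exp (t *\<^sub>R (a + l * c))) \<le> (E + 1) * exp (- min \<alpha> (1 / 2) * t)" if t: "0 \<le> t" for t
    proof -
      have tb: "t *\<^sub>R ?M \<in> bounded_ops G"
        using Mb by (auto simp: bounded_ops_iff Endo_linear_simps clinear_endo_def)
      have "a + l * c = Endo ?M - h"
        by (simp add: a_def l_def c_def Endo_simps distrib_left z)
      then have "t *\<^sub>R (a + l * c) = Endo (t *\<^sub>R ?M) - (t / 2) *\<^sub>R (1 - prj G)"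
        by (simp add: h_def N_def P_def Endo_linear_simps(4) scaleR_diff_right)
      also have "exp \<dots> = prj G * exp (Endo (t *\<^sub>R ?M)) + exp (- (t / 2)) *\<^sub>R (1 - prj G)"
        by (rule exp_corner) (simp_all add: bounded_ops_corner[OF tb])
      also have "\<dots> = Endo (op_exp G (t *\<^sub>R ?M)) + exp (- (t / 2)) *\<^sub>R (1 - prj G)"
        by (simp only: Endo_op_exp[OF tb])
      also have "norm \<dots> \<le> norm (op_exp G (t *\<^sub>R ?M)) + exp (- (t / 2)) * 1"
        by (rule order_trans[OF norm_triangle_ineq]) (auto intro!: mult_left_mono norm_prj_le)
      also have "norm (op_exp G (t *\<^sub>R ?M)) \<le> E * exp (- min \<alpha> (1 / 2) * t)"
        using t Ea(1) by (intro order_trans[OF Ea(3)[OF t]] mult_left_mono) (auto intro: mult_right_mono)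
      also have "exp (- (t / 2)) \<le> exp (- min \<alpha> (1 / 2) * t)"
        using mult_right_mono[of "min \<alpha> (1 / 2)" "1 / 2" t] t by simp
      finally show ?thesis by (simp add: algebra_simps)
    qed
    then show ?thesis using that[of "min \<alpha> (1 / 2)" "E + 1"] Ea(2) by simp
  qed
  obtain \<tau> where \<tau>: "0 < \<tau>" "norm (exp (\<tau> *\<^sub>R (a - s * x))) < 1"
    using riccati_closed_loop_stable[OF adj ps px ric cc E] by blast
  have amem: "a \<in> unitization"
    using embed_mem[OF mem(1), of "- 1 / 2"] by (simp add: a_def h_def N_def P_def)
  have smem: "s \<in> unitization" using embed_mem[OF S, of 0] by (simp add: s_def)
  have kmem: "k \<in> unitization" using embed_mem[OF mem(3), of 1] by (simp add: k_def N_def P_def)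
  have xmem: "x \<in> unitization"
    by (rule U.riccati_solution_mem[OF amem smem kmem adj _ _ ric dua invs \<tau>])
      (use ps px in \<open>simp_all add: posop_def\<close>)
  have "x * prj G = Endo X"
    using bounded_ops_corner[OF bnd(5)] by (simp add: x_def N_def P_def distrib_right left_diff_distrib)
  then have Xmem: "X \<in> \<A>" using unitizationD(2)[OF xmem] by simp
  define F where "F = A - S \<cdot> X"
  have Fmem: "F \<in> \<A>"
    unfolding F_def using add_mem[OF mem(1) minus_mem[OF mult_mem[OF S Xmem]]] by simp
  have Fe: "a - s * x = Endo F - (1 / 2) *\<^sub>R (1 - prj G)"
  proof -
    have "a - s * x = Endo F - h"
      by (simp add: F_def a_def s_def x_def Endo_simps distrib_left z)
    then show ?thesis by (simp only: h_def N_def P_def)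
  qed
  have fmem: "a - s * x \<in> unitization" by (intro U.diff_mem U.mult_mem amem smem xmem)
  obtain E' \<alpha>' where E': "0 < E'" "0 < \<alpha>'" "\<And>t. 0 \<le> t \<Longrightarrow> unit_nu (exp (t *\<^sub>R (a - s * x))) \<le> E' * exp (- \<alpha>' * t)"
    using U.nu_exp_decay[OF fmem \<tau>] by blast
  \<comment> \<open>\<open>unit_nu\<close> dominates the \<open>q\<close>-th power of
    \<open>qnorm\<close> on the corner, so extracting the root turns \<open>E'\<close> into
    \<open>E' powr (1 / q)\<close> and divides the rate by \<open>q\<close>.\<close>
  have "op_exp G (t *\<^sub>R F) \<in> \<A> \<and> qnorm (op_exp G (t *\<^sub>R F)) \<le> E' powr (1 / q) * exp (- (\<alpha>' / q) * t)"
    if t: "0 \<le> t" for t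
  proof -
    have tb: "t *\<^sub>R F \<in> bounded_ops G" by (intro mem_bounded scaleR_mem Fmem)
    let ?e = "exp (t *\<^sub>R (a - s * x))"
    have em: "?e \<in> unitization" by (intro U.exp_mem U.scaleR_mem fmem)
    have "t *\<^sub>R (a - s * x) = Endo (t *\<^sub>R F) - (t / 2) *\<^sub>R (1 - prj G)"
      by (simp add: Fe Endo_linear_simps scaleR_diff_right)
    also have "exp \<dots> = prj G * exp (Endo (t *\<^sub>R F)) + exp (- (t / 2)) *\<^sub>R (1 - prj G)"
      by (rule exp_corner) (simp_all add: bounded_ops_corner[OF tb])
    finally have "prj G * ?e = Endo (op_exp G (t *\<^sub>R F))"
      by (simp add: Endo_op_exp[OF tb] distrib_left right_diff_distrib)
    then have e: "op_of (?e * prj G) = op_exp G (t *\<^sub>R F)" by (simp add: unitizationD(1)[OF em])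
    have m: "op_exp G (t *\<^sub>R F) \<in> \<A>" using unitizationD(2)[OF em] by (simp only: e)
    have "qnorm (op_exp G (t *\<^sub>R F)) powr q \<le> E' * exp (- \<alpha>' * t)"
      using unit_nu_parts(1)[OF em E'(3)[OF t]] by (simp only: e)
    then have "(qnorm (op_exp G (t *\<^sub>R F)) powr q) powr (1 / q) \<le> (E' * exp (- \<alpha>' * t)) powr (1 / q)"
      using q by (intro powr_mono2) auto
    also have "\<dots> = E' powr (1 / q) * exp (- (\<alpha>' / q) * t)"
      using E'(1) by (simp add: powr_mult exp_powr_real)
    finally show ?thesis using m q qnorm_nonneg[OF m] by (simp add: powr_powr)
  qed
  moreover have "0 < E' powr (1 / q)" "0 < \<alpha>' / q" using E' q by auto
  ultimately have "exp_stable G \<A> qnorm F" unfolding exp_stable_def using Fmem by blast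
  then show ?thesis using Xmem by (simp add: F_def S_def)
qed

end
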